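(* Let $n\ge5$, let $J=J_{G_n}$, and let $T\in\mathcal C(G_n)$; write $P_T=P_T(G_n)$, and let the types (i)–(vii) of elements of $\mathcal C(G_n)$ be those listed in the context. Then the following hold: (i) If $T$ is of type (i), then $v_{P_T}(J)=4$. (ii) If $T$ is of type (ii), then $v_{P_T}(J)=6$ when $n=5$, and $v_{P_T}(J)=4$ when $n\ge6$. (iii) If $T$ is of type (iii) or (iv), then $v_{P_T}(J)=5$. (iv) If $T$ is of type (v), (vi), or (vii), then $v_{P_T}(J)=6$. Consequently, $v(J)=4$.
   Context: Graph $G_n$: let $X=\{u_0,\dots,u_{n-1}\}$ and $Y=\{v_0,\dots,v_{n-1}\}$ be disjoint, indices modulo $n$. Let $F_n\cong C_{2n}$ be the cycle on $X\sqcup Y$ with edges $\{u_i,v_i\},\{u_i,v_{i-1}\}$, $i\in\mathbb Z_n$, and $G_n=K_{X,Y}\setminus E(F_n)$, i.e. $\{u_i,v_j\}\in E(G_n)$ iff $j\notin\{i,i-1\}$ modulo $n$. Binomial edge ideals: $\mathbb K$ is an arbitrary field. For a finite simple graph $G$, $S_G=\mathbb K[x_w,y_w:w\in V(G)]$ (standard graded) and $J_G$ is generated by $x_ay_b-x_by_a$, $\{a,b\}\in E(G)$. For $T\subseteq V(G)$ let $c_G(T)$ be the number of connected components of $G[V(G)\setminus T]$ (with $c_G(V(G))=0$), let $G_1,\dots,G_{c_G(T)}$ be these components and $\widetilde G_j$ the complete graph on $V(G_j)$, and put $P_T(G)=(x_i,y_i:i\in T)+\sum_jJ_{\widetilde G_j}$.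 $T$ has the cut point property if $T=\varnothing$ or $c_G(T\setminus\{i\})<c_G(T)$ for every $i\in T$; $\mathcal C(G)$ is the set of all such $T$. The minimal primes of the radical ideal $J_G$ are exactly the $P_T(G)$, $T\in\mathcal C(G)$. Local $v$-numbers: for $P\in\operatorname{Min}(J_G)$, $v_P(J_G)=\min\{\deg f: f\in S_G\text{ homogeneous with } J_G:f=P\}$, and $v(J_G)=\min_{P\in\operatorname{Min}(J_G)}v_P(J_G)$. Types: $P_r$ is the path on $r$ vertices, $2P_3=P_3\sqcup P_3$. For $T\in\mathcal C(G_n)$ put $U=V(G_n)\setminus T$, $U_X=U\cap X$, $U_Y=U\cap Y$. Each $T\in\mathcal C(G_n)$ is of exactly one of the following types: (i) $T=\varnothing$; (ii) $U=X$ or $U=Y$; (iii) $U=X\cup\{v_i\}$ or $U=Y\cup\{u_i\}$ for some $i$; (iv) $U=X\cup\{v_i,v_{i+1}\}$ or $U=Y\cup\{u_i,u_{i+1}\}$ for some $i$; (v) $(|U_X|,|U_Y|)\in\{(3,2),(2,3)\}$ and $F_n[U]\cong P_5$; (vi) $(|U_X|,|U_Y|)\in\{(4,2),(2,4)\}$ and $F_n[U]\cong2P_3$ with the two vertices of the smaller part being the centres of the two copies of $P_3$; (vii) $|U_X|=|U_Y|=3$ and $F_n[U]\cong P_6$ or $F_n[U]\cong 2P_3$. *)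

theory Defs
  imports "HOL-Library.Poly_Mapping" "HOL-Algebra.Ideal"
begin

section \<open>Simple graphs\<close>

text \<open>Edges are two-element sets of vertices.\<close>

datatype 'v ugraph = UGraph (verts: "'v set") (edges: "'v set set")

definition simple_graph :: "'v ugraph \<Rightarrow> bool" where
  "simple_graph G \<longleftrightarrow> finite (verts G) \<and> (\<forall>e\<in>edges G. e \<subseteq> verts G \<and> card e = 2)"

definition induced :: "'v ugraph \<Rightarrow> 'v set \<Rightarrow> 'v ugraph" where
  "induced G U = UGraph (verts G \<inter> U) {e \<in> edges G. e \<subseteq> U}"

definition complete_graph :: "'v set \<Rightarrow> 'v ugraph" where
  "complete_graph U = UGraph U {{a, b} | a b. a \<in> U \<and> b \<in> U \<and> a \<noteq> b}"

definition graph_iso :: "('v \<Rightarrow> 'w) \<Rightarrow> 'v ugraph \<Rightarrow> 'w ugraph \<Rightarrow> bool" where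
  "graph_iso \<phi> G H \<longleftrightarrow> bij_betw \<phi> (verts G) (verts H) \<and>
     (\<forall>a\<in>verts G. \<forall>b\<in>verts G. {a, b} \<in> edges G \<longleftrightarrow> {\<phi> a, \<phi> b} \<in> edges H)"

definition isomorphic :: "'v ugraph \<Rightarrow> 'w ugraph \<Rightarrow> bool" where
  "isomorphic G H \<longleftrightarrow> (\<exists>\<phi>. graph_iso \<phi> G H)"

text \<open>The vertex sets of the connected components.\<close>

definition components :: "'v ugraph \<Rightarrow> 'v set set" where
  "components G = {{b. (a, b) \<in> {(s, t). {s, t} \<in> edges G}\<^sup>*} | a. a \<in> verts G}"

definition path_graph :: "nat \<Rightarrow> nat ugraph" where
  "path_graph r = UGraph {..<r} {{i, Suc i} | i. Suc i < r}"

definition disjoint_union :: "'v ugraph \<Rightarrow> 'w ugraph \<Rightarrow> ('v + 'w) ugraph" where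
  "disjoint_union G H = UGraph (Inl ` verts G \<union> Inr ` verts H)
     ((`) Inl ` edges G \<union> (`) Inr ` edges H)"

text \<open>Two disjoint copies of the path on three vertices; the centres are \<open>Inl 1\<close> and \<open>Inr 1\<close>.\<close>

definition two_P3 :: "(nat + nat) ugraph" where
  "two_P3 = disjoint_union (path_graph 3) (path_graph 3)"

definition num_comp :: "'v ugraph \<Rightarrow> 'v set \<Rightarrow> nat" where
  "num_comp G T = card (components (induced G (verts G - T)))"

definition cut_sets :: "'v ugraph \<Rightarrow> 'v set set" where
  "cut_sets G = {T. T \<subseteq> verts G \<and>
     (T = {} \<or> (\<forall>i\<in>T. num_comp G (T - {i}) < num_comp G T))}"

section \<open>Binomial edge ideals\<close>

text \<open>Polynomials in the variables \<open>x\<^sub>w, y\<^sub>w\<close>, where \<open>w\<close> ranges over all of the type \<open>'v\<close>: a polynomial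
  maps exponent vectors to coefficients. The ring of a graph \<open>G\<close> is the subring of
  polynomials that involve only variables indexed by \<open>verts G\<close>.\<close>

datatype 'v var = XVar 'v | YVar 'v

type_synonym ('v, 'k) vpoly = "('v var \<Rightarrow>\<^sub>0 nat) \<Rightarrow>\<^sub>0 'k"

definition poly_ring :: "'v set \<Rightarrow> ('v, 'k::field) vpoly ring" where
  "poly_ring W = \<lparr>carrier =
       {f. \<forall>m\<in>Poly_Mapping.keys f. Poly_Mapping.keys m \<subseteq> XVar ` W \<union> YVar ` W},
     mult = (*), one = 1, zero = 0, add = (+)\<rparr>"

lemma cring_poly_ring: "cring (poly_ring W :: ('v, 'k::field) vpoly ring)"
proof -
  let ?R = "poly_ring W :: ('v, 'k::field) vpoly ring"
  have mem: "x \<in> carrier ?R \<longleftrightarrow>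
      (\<forall>m\<in>Poly_Mapping.keys x. Poly_Mapping.keys m \<subseteq> XVar ` W \<union> YVar ` W)" for x
    by (simp add: poly_ring_def)
  have add: "x + y \<in> carrier ?R" if "x \<in> carrier ?R" "y \<in> carrier ?R" for x y
    using that Poly_Mapping.keys_add[of x y] unfolding mem by blast
  have mult: "x * y \<in> carrier ?R" if xy: "x \<in> carrier ?R" "y \<in> carrier ?R" for x y
    unfolding mem
  proof
    fix m assume "m \<in> Poly_Mapping.keys (x * y)"
    then obtain a b where "a \<in> Poly_Mapping.keys x" "b \<in> Poly_Mapping.keys y" "m = a + b"
      using Poly_Mapping.keys_mult[of x y] by blast
    then show "Poly_Mapping.keys m \<subseteq> XVar ` W \<union> YVar ` W"
      using Poly_Mapping.keys_add[of a b] xy unfolding mem by blast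
  qed
  have minus: "- x \<in> carrier ?R" if "x \<in> carrier ?R" for x
    using that unfolding mem by simp
  have zero: "0 \<in> carrier ?R" and one: "1 \<in> carrier ?R"
    by (simp_all add: mem)
  have ops: "add ?R = (+)" "monoid.mult ?R = (*)" "zero ?R = 0" "one ?R = 1"
    by (simp_all add: poly_ring_def)
  have inv: "\<exists>y\<in>carrier ?R. x + y = 0" if "x \<in> carrier ?R" for x
    using minus[OF that] by (intro bexI[of _ "- x"]) simp_all
  have "abelian_group ?R"
    by (rule abelian_groupI; unfold ops) (simp_all add: add zero inv ac_simps)
  moreover have "comm_monoid ?R"
    by (rule comm_monoidI; unfold ops) (simp_all add: mult one ac_simps)
  ultimately show ?thesis
    by (rule cringI) (simp add: ops distrib_right)
qed

definition xv :: "'v \<Rightarrow> ('v, 'k::field) vpoly" where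
  "xv w = Poly_Mapping.single (Poly_Mapping.single (XVar w) 1) 1"

definition yv :: "'v \<Rightarrow> ('v, 'k::field) vpoly" where
  "yv w = Poly_Mapping.single (Poly_Mapping.single (YVar w) 1) 1"

definition edge_binomials :: "'v ugraph \<Rightarrow> ('v, 'k::field) vpoly set" where
  "edge_binomials G = {xv a * yv b - xv b * yv a | a b. {a, b} \<in> edges G}"

definition binomial_edge_ideal :: "'v ugraph \<Rightarrow> ('v, 'k::field) vpoly set" where
  "binomial_edge_ideal G = Idl\<^bsub>poly_ring (verts G)\<^esub> (edge_binomials G)"

text \<open>The sum of the ideals \<open>(x\<^sub>i, y\<^sub>i : i \<in> T)\<close> and \<open>J\<close> of the completed components, all extended to
  the ring of \<open>G\<close>, is the ideal generated by the union of their generators.\<close>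

definition P_ideal :: "'v ugraph \<Rightarrow> 'v set \<Rightarrow> ('v, 'k::field) vpoly set" where
  "P_ideal G T = Idl\<^bsub>poly_ring (verts G)\<^esub> (xv ` T \<union> yv ` T \<union>
     (\<Union>C\<in>components (induced G (verts G - T)). edge_binomials (complete_graph C)))"

section \<open>v-numbers\<close>

text \<open>The zero polynomial is homogeneous of every degree. This is harmless below, since its
  colon ideal is the whole ring and therefore never a prime ideal.\<close>

definition homogeneous :: "nat \<Rightarrow> ('v, 'k::field) vpoly \<Rightarrow> bool" where
  "homogeneous d f \<longleftrightarrow>
     (\<forall>m\<in>Poly_Mapping.keys f. (\<Sum>z\<in>Poly_Mapping.keys m. Poly_Mapping.lookup m z) = d)"

definition colon :: "('a, 'm) ring_scheme \<Rightarrow> 'a set \<Rightarrow> 'a \<Rightarrow> 'a set" where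
  "colon R J f = {g \<in> carrier R. g \<otimes>\<^bsub>R\<^esub> f \<in> J}"

definition min_primes :: "('a, 'm) ring_scheme \<Rightarrow> 'a set \<Rightarrow> 'a set set" where
  "min_primes R J = {P. primeideal P R \<and> J \<subseteq> P \<and>
     (\<forall>Q. primeideal Q R \<and> J \<subseteq> Q \<and> Q \<subseteq> P \<longrightarrow> Q = P)}"

text \<open>\<open>W\<close> is the set of vertices indexing the variables of the ambient ring. The infimum of a
  nonempty set of naturals is its minimum. The infimum of the empty set is 0, so a positive value
  of \<open>v_local\<close> or \<open>v_number\<close> entails that the set in question is nonempty.\<close>

definition v_local :: "'v set \<Rightarrow> ('v, 'k::field) vpoly set \<Rightarrow> ('v, 'k) vpoly set \<Rightarrow> nat" where
  "v_local W J P =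
     Inf {d. \<exists>f\<in>carrier (poly_ring W). homogeneous d f \<and> colon (poly_ring W) J f = P}"

definition v_number :: "'v set \<Rightarrow> ('v, 'k::field) vpoly set \<Rightarrow> nat" where
  "v_number W J = Inf (v_local W J ` min_primes (poly_ring W) J)"

section \<open>The complement of a Hamiltonian cycle in a complete bipartite graph\<close>

text \<open>The indices modulo \<open>n\<close> are represented by \<open>0, \<dots>, n - 1\<close>; so \<open>(i + n - 1) mod n\<close> stands
  for \<open>i - 1\<close>.\<close>

datatype vertex = Uv nat | Vv nat

definition partX :: "nat \<Rightarrow> vertex set" where "partX n = Uv ` {..<n}"

definition partY :: "nat \<Rightarrow> vertex set" where "partY n = Vv ` {..<n}"

definition F_graph :: "nat \<Rightarrow> vertex ugraph" where
  "F_graph n = UGraph (partX n \<union> partY n)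
     ({{Uv i, Vv i} | i. i < n} \<union> {{Uv i, Vv ((i + n - 1) mod n)} | i. i < n})"

definition G_graph :: "nat \<Rightarrow> vertex ugraph" where
  "G_graph n = UGraph (partX n \<union> partY n)
     ({{a, b} | a b. a \<in> partX n \<and> b \<in> partY n} - edges (F_graph n))"

lemma simple_graph_G_graph: "simple_graph (G_graph n)"
  unfolding simple_graph_def G_graph_def partX_def partY_def by auto

lemma edge_G_graph_iff: "i < n \<Longrightarrow> j < n \<Longrightarrow>
   {Uv i, Vv j} \<in> edges (G_graph n) \<longleftrightarrow> j \<noteq> i \<and> j \<noteq> (i + n - 1) mod n"
  unfolding G_graph_def F_graph_def partX_def partY_def by (auto simp: doubleton_eq_iff)

text \<open>The types of cut sets \<open>T\<close>, in terms of \<open>U = verts (G_graph n) - T\<close>.\<close>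

definition type1 :: "nat \<Rightarrow> vertex set \<Rightarrow> bool" where
  "type1 n T \<longleftrightarrow> T = {}"

definition type2 :: "nat \<Rightarrow> vertex set \<Rightarrow> bool" where
  "type2 n T \<longleftrightarrow> (let U = verts (G_graph n) - T in U = partX n \<or> U = partY n)"

definition type3 :: "nat \<Rightarrow> vertex set \<Rightarrow> bool" where
  "type3 n T \<longleftrightarrow> (let U = verts (G_graph n) - T in
     \<exists>i<n. U = partX n \<union> {Vv i} \<or> U = partY n \<union> {Uv i})"

definition type4 :: "nat \<Rightarrow> vertex set \<Rightarrow> bool" where
  "type4 n T \<longleftrightarrow> (let U = verts (G_graph n) - T in
     \<exists>i<n. U = partX n \<union> {Vv i, Vv ((i + 1) mod n)} \<or>
           U = partY n \<union> {Uv i, Uv ((i + 1) mod n)})"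

definition type5 :: "nat \<Rightarrow> vertex set \<Rightarrow> bool" where
  "type5 n T \<longleftrightarrow> (let U = verts (G_graph n) - T in
     (card (U \<inter> partX n), card (U \<inter> partY n)) \<in> {(3, 2), (2, 3)} \<and>
     isomorphic (path_graph 5) (induced (F_graph n) U))"

definition type6 :: "nat \<Rightarrow> vertex set \<Rightarrow> bool" where
  "type6 n T \<longleftrightarrow> (let U = verts (G_graph n) - T; UX = U \<inter> partX n; UY = U \<inter> partY n in
     (card UX, card UY) \<in> {(4, 2), (2, 4)} \<and>
     (\<exists>\<phi>. graph_iso \<phi> two_P3 (induced (F_graph n) U) \<and>
          \<phi> ` {Inl 1, Inr 1} = (if card UX < card UY then UX else UY)))"

definition type7 :: "nat \<Rightarrow> vertex set \<Rightarrow> bool" where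
  "type7 n T \<longleftrightarrow> (let U = verts (G_graph n) - T in
     card (U \<inter> partX n) = 3 \<and> card (U \<inter> partY n) = 3 \<and>
     (isomorphic (path_graph 6) (induced (F_graph n) U) \<or>
      isomorphic two_P3 (induced (F_graph n) U)))"

end

theory Submission
  imports Defs "HOL-Library.Countable"
begin

text \<open>
  Write \<open>[a, b] = x\<^sub>a y\<^sub>b - x\<^sub>b y\<^sub>a\<close>, let \<open>J\<close> be the binomial edge ideal of a graph with vertex set \<open>V\<close>,
  and let \<open>P\<^sub>T\<close> be the ideal attached to \<open>T \<subseteq> V\<close>.

  \<^emph>\<open>Points.\<close> A point assigns to every vertex a vector of the plane, with coordinates in a polynomial
  domain. \<open>J\<close> vanishes at it as soon as adjacent vertices carry parallel vectors. The generic point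
  of \<open>T\<close> is zero on \<open>T\<close> and has one direction on every component of \<open>V - T\<close>. It sends monomials to
  monomials, and monomials with the same image are congruent modulo \<open>P\<^sub>T\<close>; so its kernel is \<open>P\<^sub>T\<close>
  (\<open>P_ideal_kernel\<close>). Hence \<open>P\<^sub>T\<close> is prime, and membership is decided by evaluation.

  \<^emph>\<open>Upper bounds.\<close> A certificate of \<open>T\<close> is a homogeneous \<open>g \<notin> P\<^sub>T\<close> with \<open>g P\<^sub>T \<subseteq> J\<close>. It satisfies
  \<open>J : g = P\<^sub>T\<close>, because \<open>J \<subseteq> P\<^sub>T\<close> and \<open>P\<^sub>T\<close> is prime. Products of variables and brackets suffice: if \<open>k\<close>
  is adjacent to \<open>a\<close> and \<open>b\<close>, then the Pluecker relation \<open>x\<^sub>k [a, b] = x\<^sub>a [k, b] + x\<^sub>b [a, k]\<close> puts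
  \<open>x\<^sub>k [a, b]\<close> into \<open>J\<close>, and along a path the relation can be repeated (\<open>prod_br_in_JG\<close>).

  \<^emph>\<open>Lower bounds.\<close> If \<open>J : f = P\<^sub>T\<close> and \<open>T\<close> has a certificate, then some component of \<open>f\<close> in the
  grading by vertices is a witness: it lies outside \<open>P\<^sub>T\<close> and multiplies \<open>P\<^sub>T\<close> into \<open>J\<close>
  (\<open>witness_of_colon\<close>). Let \<open>S\<close> be the set of vertices that occur in its degree. If \<open>U \<supseteq> S\<close> meets \<open>T\<close>,
  or separates two vertices of one component of \<open>V - T\<close>, then \<open>P\<^sub>T\<close> is not contained in the prime of
  \<open>V - U\<close>, and the witness vanishes at all points that are constant along the edges inside \<open>U\<close>
  (\<open>witness_vanishes\<close>). So every \<open>k \<in> T\<close> has two neighbours in \<open>S\<close> that belong to different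
  components of \<open>V - T\<close>, and no set between \<open>S\<close> and \<open>V - T\<close> isolates one of its vertices from another
  one of the same component. When these conditions leave a degree that is still too small, the witness is linear in the vector of some vertex and
  vanishes for two independent values of it; then it vanishes identically (\<open>ev_linear_zero\<close>).

  \<^emph>\<open>The graph.\<close> The vertices are numbered around the Hamiltonian cycle by positions modulo \<open>2 n\<close>. Two
  of them are adjacent in \<open>G\<^sub>n\<close> iff their distance is odd and different from \<open>\<plusminus>1\<close>, and rotating the
  positions by one exchanges the two sides. For every type of cut set there is a certificate of the
  claimed degree, and the conditions on witnesses force the same degree. The case \<open>n = 5\<close> of \<open>type2\<close>
  is exceptional: there a witness is a polynomial in five vectors that vanishes whenever three
  cyclically consecutive ones agree, and such polynomials have degree at least 6.

  \<^emph>\<open>The global value.\<close> Every minimal prime is a \<open>P\<^sub>T\<close> such that each \<open>i \<in> T\<close> has neighbours in two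
  components of \<open>V - T\<close> (\<open>min_prime_is_P_ideal\<close>). Such a \<open>T\<close> has a certificate, and all witnesses
  have degree at least 4 (\<open>witness_deg_ge_4\<close>); the empty set attains 4.
\<close>

section \<open>Polynomials and generated ideals\<close>

abbreviation "lookup \<equiv> Poly_Mapping.lookup"
abbreviation "keys \<equiv> Poly_Mapping.keys"
abbreviation "single \<equiv> Poly_Mapping.single"

lemma carrier_poly_ring:
  "f \<in> carrier (poly_ring W) \<longleftrightarrow>
     (\<forall>m\<in>keys f. keys m \<subseteq> XVar ` W \<union> YVar ` W)"
  by (simp add: poly_ring_def)

lemma poly_ring_ops:
  "add (poly_ring W) = (+)" "monoid.mult (poly_ring W) = (*)" "zero (poly_ring W) = 0"
  "one (poly_ring W) = 1"
  by (simp_all add: poly_ring_def)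

lemma carr_zero [simp]: "(0 :: ('v, 'k::field) vpoly) \<in> carrier (poly_ring W)"
  and carr_one [simp]: "(1 :: ('v, 'k::field) vpoly) \<in> carrier (poly_ring W)"
  and carr_add [simp]: "f \<in> carrier (poly_ring W) \<Longrightarrow> g \<in> carrier (poly_ring W) \<Longrightarrow>
    f + g \<in> carrier (poly_ring W)"
  and carr_mult [simp]: "f \<in> carrier (poly_ring W) \<Longrightarrow> g \<in> carrier (poly_ring W) \<Longrightarrow>
    f * g \<in> carrier (poly_ring W)"
  for f g :: "('v, 'k::field) vpoly"
proof -
  interpret cring "poly_ring W :: ('v, 'k::field) vpoly ring" by (rule cring_poly_ring)
  show "(0 :: ('v, 'k::field) vpoly) \<in> carrier (poly_ring W)" using zero_closed
    by (simp add: poly_ring_ops)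
  show "(1 :: ('v, 'k::field) vpoly) \<in> carrier (poly_ring W)" using one_closed
    by (simp add: poly_ring_ops)
  show "f + g \<in> carrier (poly_ring W)"
    if "f \<in> carrier (poly_ring W)" "g \<in> carrier (poly_ring W)" for f g :: "('v, 'k::field) vpoly"
    using a_closed[OF that] by (simp add: poly_ring_ops)
  show "f * g \<in> carrier (poly_ring W)"
    if "f \<in> carrier (poly_ring W)" "g \<in> carrier (poly_ring W)" for f g :: "('v, 'k::field) vpoly"
    using m_closed[OF that] by (simp add: poly_ring_ops)
qed

lemma carr_uminus [simp]: "f \<in> carrier (poly_ring W) \<Longrightarrow> - f \<in> carrier (poly_ring W)"
  for f :: "('v, 'k::field) vpoly"
  by (simp add: carrier_poly_ring)

lemma carr_diff [simp]: "f \<in> carrier (poly_ring W) \<Longrightarrow> g \<in> carrier (poly_ring W) \<Longrightarrow>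
    f - g \<in> carrier (poly_ring W)" for f g :: "('v, 'k::field) vpoly"
  using carr_add[of f W "- g"] by simp

lemma carr_sum [simp]: "(\<And>i. i \<in> I \<Longrightarrow> f i \<in> carrier (poly_ring W)) \<Longrightarrow>
    (\<Sum>i\<in>I. f i) \<in> carrier (poly_ring W)" for f :: "'i \<Rightarrow> ('v, 'k::field) vpoly"
  by (induction I rule: infinite_finite_induct) auto

lemma carr_prod [simp]: "(\<And>i. i \<in> I \<Longrightarrow> f i \<in> carrier (poly_ring W)) \<Longrightarrow>
    (\<Prod>i\<in>I. f i) \<in> carrier (poly_ring W)" for f :: "'i \<Rightarrow> ('v, 'k::field) vpoly"
  by (induction I rule: infinite_finite_induct) auto

lemma carr_single [simp]: "keys m \<subseteq> XVar ` W \<union> YVar ` W \<Longrightarrow>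
    single m c \<in> carrier (poly_ring W)"
  by (auto simp: carrier_poly_ring split: if_splits)

lemma carr_xv [simp]: "a \<in> W \<Longrightarrow> xv a \<in> carrier (poly_ring W)"
  and carr_yv [simp]: "a \<in> W \<Longrightarrow> yv a \<in> carrier (poly_ring W)"
  by (auto simp: xv_def yv_def carrier_poly_ring)

lemma poly_mapping_sum_singles:
  "f = (\<Sum>m\<in>keys f. single m (lookup f m))"
proof (rule poly_mapping_eqI)
  fix k
  have "lookup (\<Sum>m\<in>keys f. single m (lookup f m)) k
    = (\<Sum>m\<in>keys f. if m = k then lookup f m else 0)"
    by (simp add: lookup_sum lookup_single when_def)
  also have "\<dots> = lookup f k"
    by (simp add: sum.delta' not_in_keys_iff_lookup_eq_zero in_keys_iff)
  finally show "lookup f k = lookup (\<Sum>m\<in>keys f.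
      single m (lookup f m)) k" by simp
qed

inductive_set ideal_span :: "'v set \<Rightarrow> ('v, 'k::field) vpoly set \<Rightarrow> ('v, 'k) vpoly set" for W S where
  span_zero: "0 \<in> ideal_span W S"
| span_step: "f \<in> ideal_span W S \<Longrightarrow> g \<in> S \<Longrightarrow> keys m \<subseteq> XVar ` W \<union> YVar ` W \<Longrightarrow>
    f + single m c * g \<in> ideal_span W S"

lemma ideal_span_add: "f \<in> ideal_span W S \<Longrightarrow> g \<in> ideal_span W S \<Longrightarrow> g + f \<in> ideal_span W S"
  by (induction rule: ideal_span.induct)
    (auto simp: add.assoc[symmetric] intro: span_step)

lemma ideal_span_mult_single:
  assumes "f \<in> ideal_span W S" "keys m \<subseteq> XVar ` W \<union> YVar ` W"
  shows "single m c * f \<in> ideal_span W S"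
  using assms(1)
proof (induction rule: ideal_span.induct)
  case span_zero
  then show ?case by (simp add: ideal_span.span_zero)
next
  case (span_step f g m' c')
  have "single m c * (f + single m' c' * g) =
     single m c * f + single (m + m') (c * c') * g"
    by (simp add: distrib_left mult.assoc[symmetric] mult_single)
  moreover have "keys (m + m') \<subseteq> XVar ` W \<union> YVar ` W"
    using assms(2) span_step Poly_Mapping.keys_add[of m m'] by blast
  ultimately show ?case using span_step by (simp add: ideal_span.span_step)
qed

lemma ideal_span_mult:
  assumes "f \<in> ideal_span W S" "r \<in> carrier (poly_ring W)"
  shows "r * f \<in> ideal_span W S"
proof -
  have "(\<Sum>m\<in>A. single m (lookup r m)) * f \<in> ideal_span W S"
    if "finite A" "A \<subseteq> keys r" for A
    using that
  proof (induction A)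
    case (insert m A)
    then have "keys m \<subseteq> XVar ` W \<union> YVar ` W"
      using assms(2) by (auto simp: carrier_poly_ring)
    then show ?case
      using insert ideal_span_mult_single[OF assms(1)] by (simp add: distrib_right ideal_span_add)
  qed (simp add: span_zero)
  from this[of "keys r"] show ?thesis
    using poly_mapping_sum_singles[of r] by simp
qed

lemma ideal_span_subset_carrier:
  assumes "S \<subseteq> carrier (poly_ring W)" "f \<in> ideal_span W S"
  shows "f \<in> carrier (poly_ring W)"
  using assms(2) by (induction rule: ideal_span.induct) (use assms(1) in \<open>auto intro!: carr_add
      carr_mult\<close>)

lemma ideal_poly_ringD:
  fixes I :: "('v, 'k::field) vpoly set"
  assumes "ideal I (poly_ring W)"
  shows "0 \<in> I" "f \<in> I \<Longrightarrow> g \<in> I \<Longrightarrow> f + g \<in> I" "f \<in> I \<Longrightarrow> r \<in> carrier (poly_ring W) \<Longrightarrow> r * f \<in> I"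
    "f \<in> I \<Longrightarrow> f \<in> carrier (poly_ring W)"
proof -
  interpret ideal I "poly_ring W" by fact
  show "0 \<in> I" using additive_subgroup.zero_closed[OF is_additive_subgroup] by (simp add: poly_ring_ops)
  show "f + g \<in> I" if "f \<in> I" "g \<in> I" using additive_subgroup.a_closed[OF is_additive_subgroup that]
    by (simp add: poly_ring_ops)
  show "r * f \<in> I" if "f \<in> I" "r \<in> carrier (poly_ring W)"
    using I_l_closed[OF that] by (simp add: poly_ring_ops)
  show "f \<in> carrier (poly_ring W)" if "f \<in> I" using that by (rule a_Hcarr)
qed

lemma ideal_poly_ringI:
  fixes I :: "('v, 'k::field) vpoly set"
  assumes "I \<subseteq> carrier (poly_ring W)" "0 \<in> I" "\<And>f g. f \<in> I \<Longrightarrow> g \<in> I \<Longrightarrow> f + g \<in> I"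
    "\<And>f r. f \<in> I \<Longrightarrow> r \<in> carrier (poly_ring W) \<Longrightarrow> r * f \<in> I"
  shows "ideal I (poly_ring W)"
proof -
  interpret cring "poly_ring W :: ('v, 'k) vpoly ring" by (rule cring_poly_ring)
  have inv: "\<ominus>\<^bsub>poly_ring W\<^esub> f = - f" if "f \<in> carrier (poly_ring W)" for f :: "('v, 'k) vpoly"
    using that by (intro minus_equality) (simp_all add: poly_ring_ops)
  have neg: "- f \<in> I" if "f \<in> I" for f using assms(4)[OF that, of "- 1"] by simp
  show ?thesis
  proof (rule idealI)
    show "ring (poly_ring W :: ('v, 'k) vpoly ring)" by (rule ring_axioms)
    show "subgroup I (add_monoid (poly_ring W))"
    proof
      show "inv\<^bsub>add_monoid (poly_ring W)\<^esub> f \<in> I" if "f \<in> I" for f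
        using inv[of f] neg[OF that] assms(1) that by (auto simp: a_inv_def)
    qed (use assms in \<open>auto simp: poly_ring_ops\<close>)
  qed (use assms in \<open>auto simp: poly_ring_ops mult.commute\<close>)
qed

text \<open>Membership in a generated ideal comes with an induction over monomial multiples of the
  generators; this is what makes gradings and substitutions easy to follow through an ideal.\<close>

lemma genideal_eq_ideal_span:
  fixes S :: "('v, 'k::field) vpoly set"
  assumes "S \<subseteq> carrier (poly_ring W)"
  shows "Idl\<^bsub>poly_ring W\<^esub> S = ideal_span W S"
proof -
  interpret cring "poly_ring W :: ('v, 'k) vpoly ring" by (rule cring_poly_ring)
  have id: "ideal (ideal_span W S) (poly_ring W)"
    using ideal_span_subset_carrier[OF assms]
    by (intro ideal_poly_ringI) (auto simp: ideal_span_add ideal_span_mult span_zero)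
  have "g \<in> ideal_span W S" if "g \<in> S" for g
    using span_step[OF span_zero that, of 0 W 1] by simp
  then have "Idl\<^bsub>poly_ring W\<^esub> S \<subseteq> ideal_span W S" by (intro genideal_minimal[OF id]) auto
  moreover have "f \<in> Idl\<^bsub>poly_ring W\<^esub> S" if "f \<in> ideal_span W S" for f
    using that
  proof (induction rule: ideal_span.induct)
    case span_zero
    then show ?case using ideal_poly_ringD(1)[OF genideal_ideal[OF assms]] .
  next
    case (span_step f g m c)
    note D = ideal_poly_ringD[OF genideal_ideal[OF assms]]
    show ?case using span_step genideal_self[OF assms] by (intro D(2) D(3)) auto
  qed
  ultimately show ?thesis by blast
qed

section \<open>Evaluation at points over a polynomial domain\<close>

text \<open>
  The coordinates of points. Countably many indeterminates provide as many independent vectors as a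
  graph needs, over every field.
\<close>

type_synonym 'k coord = "(nat \<Rightarrow>\<^sub>0 nat) \<Rightarrow>\<^sub>0 'k"

definition mono_val :: "'v set \<Rightarrow> ('v \<Rightarrow> 'k coord \<times> 'k coord) \<Rightarrow> ('v var \<Rightarrow>\<^sub>0 nat) \<Rightarrow> ('k::field) coord"
    where
  "mono_val V Z m =
     (\<Prod>v\<in>V. fst (Z v) ^ lookup m (XVar v) * snd (Z v) ^ lookup m (YVar v))"

text \<open>
  The point \<open>Z\<close> substitutes \<open>Z v\<close> for \<open>(x\<^sub>v, y\<^sub>v)\<close>. Variables of vertices outside \<open>V\<close> are set to 1, so that
  evaluation is a ring homomorphism on all polynomials.
\<close>

definition ev :: "'v set \<Rightarrow> ('v \<Rightarrow> 'k coord \<times> 'k coord) \<Rightarrow> ('v, 'k::field) vpoly \<Rightarrow> 'k coord" where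
  "ev V Z f = (\<Sum>m\<in>keys f. single 0 (lookup f m) * mono_val V Z m)"

lemma mono_val_zero [simp]: "mono_val V Z 0 = 1"
  by (simp add: mono_val_def)

lemma mono_val_add: "mono_val V Z (m + m') = mono_val V Z m * mono_val V Z m'"
  unfolding mono_val_def prod.distrib[symmetric]
  by (rule prod.cong) (simp_all add: lookup_add power_add mult_ac)

lemma ev_superset:
  assumes "finite A" "keys f \<subseteq> A"
  shows "ev V Z f = (\<Sum>m\<in>A. single 0 (lookup f m) * mono_val V Z m)"
  unfolding ev_def using assms
  by (intro sum.mono_neutral_left) (auto simp: in_keys_iff)

lemma ev_zero [simp]: "ev V Z 0 = 0"
  by (simp add: ev_def)

lemma ev_add: "ev V Z (f + g) = ev V Z f + ev V Z g"
proof -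
  let ?A = "keys f \<union> keys g"
  have "finite ?A" "keys (f + g) \<subseteq> ?A" using Poly_Mapping.keys_add[of f g] by auto
  then show ?thesis
    by (simp add: ev_superset[of ?A] lookup_add single_add distrib_right sum.distrib)
qed

lemma ev_uminus: "ev V Z (- f) = - ev V Z f"
  by (metis add.right_inverse add_eq_0_iff ev_add ev_zero)

lemma ev_diff: "ev V Z (f - g) = ev V Z f - ev V Z g"
  using ev_add[of V Z f "- g"] by (simp add: ev_uminus)

lemma ev_sum: "ev V Z (\<Sum>i\<in>I. f i) = (\<Sum>i\<in>I. ev V Z (f i))"
  by (induction I rule: infinite_finite_induct) (auto simp: ev_add)

lemma ev_single: "ev V Z (single m c) = single 0 c * mono_val V Z m"
  using ev_superset[of "{m}" "single m c" V Z] by simp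

lemma ev_mult: "ev V Z (f * g) = ev V Z f * ev V Z g" for f g :: "('v, 'k::field) vpoly"
proof -
  let ?s = "\<lambda>f m. single m (lookup f m)"
  have *: "ev V Z (?s f m * ?s g m') = ev V Z (?s f m) * ev V Z (?s g m')" for m m'
  proof -
    have "single 0 (c * d) = single 0 c * single (0 :: nat \<Rightarrow>\<^sub>0 nat) d"
      for c d :: 'k
      by (simp add: mult_single)
    then show ?thesis by (simp add: ev_single mult_single mono_val_add mult_ac)
  qed
  have "ev V Z (f * g) =
      ev V Z ((\<Sum>m\<in>keys f. ?s f m) * (\<Sum>m\<in>keys g. ?s g m))"
    using poly_mapping_sum_singles[of f] poly_mapping_sum_singles[of g] by simp
  also have "\<dots> = (\<Sum>m\<in>keys f. \<Sum>m'\<in>keys g. ev V Z (?s f m) * ev V Z (?s g m'))"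
    by (simp add: sum_product ev_sum *)
  also have "\<dots> = ev V Z (\<Sum>m\<in>keys f. ?s f m) * ev V Z (\<Sum>m\<in>keys g. ?s g m)"
    by (simp add: sum_product ev_sum)
  finally show ?thesis
    using poly_mapping_sum_singles[of f] poly_mapping_sum_singles[of g] by simp
qed

lemma mono_val_single_X:
  assumes "finite V" "a \<in> V"
  shows "mono_val V Z (single (XVar a) 1) = fst (Z a)"
    and "mono_val V Z (single (YVar a) 1) = snd (Z a)"
  using assms
  by (simp_all add: mono_val_def lookup_single when_def if_distrib[of "\<lambda>k. _ ^ k"] prod.delta'
      cong: if_cong)

lemma ev_xv: "finite V \<Longrightarrow> a \<in> V \<Longrightarrow> ev V Z (xv a) = fst (Z a)"
  and ev_yv: "finite V \<Longrightarrow> a \<in> V \<Longrightarrow> ev V Z (yv a) = snd (Z a)"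
  using mono_val_single_X[of V a Z] by (simp_all add: xv_def yv_def ev_single)

definition br :: "'v \<Rightarrow> 'v \<Rightarrow> ('v, 'k::field) vpoly" where
  "br a b = xv a * yv b - xv b * yv a"

definition det2 :: "'r \<times> 'r \<Rightarrow> 'r \<times> 'r \<Rightarrow> 'r::comm_ring_1" where
  "det2 p q = fst p * snd q - fst q * snd p"

lemma det2_self [simp]: "det2 p p = 0"
  by (simp add: det2_def)

lemma det2_zero [simp]: "det2 p (0, 0) = 0" "det2 (0, 0) p = 0"
  by (simp_all add: det2_def)

lemma br_self [simp]: "br a a = 0"
  by (simp add: br_def)

lemma br_swap: "br b a = - br a b"
  by (simp add: br_def)

lemma br_carr [simp]: "a \<in> W \<Longrightarrow> b \<in> W \<Longrightarrow> br a b \<in> carrier (poly_ring W)"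
  by (simp add: br_def)

lemma ev_br: "finite V \<Longrightarrow> a \<in> V \<Longrightarrow> b \<in> V \<Longrightarrow> ev V Z (br a b) = det2 (Z a) (Z b)"
  by (simp add: br_def det2_def ev_diff ev_mult ev_xv ev_yv)

lemma br_plucker_x: "xv k * br a b = xv a * br k b + xv b * br a k"
  and br_plucker_y: "yv k * br a b = yv a * br k b + yv b * br a k"
  by (simp_all add: br_def algebra_simps)

section \<open>The fine grading by vertices\<close>

definition mdeg :: "('v var \<Rightarrow>\<^sub>0 nat) \<Rightarrow> 'v \<Rightarrow> nat" where
  "mdeg m v = lookup m (XVar v) + lookup m (YVar v)"

definition mhom :: "('v \<Rightarrow> nat) \<Rightarrow> ('v, 'k::field) vpoly \<Rightarrow> bool" where
  "mhom \<alpha> f \<longleftrightarrow> (\<forall>m\<in>keys f. mdeg m = \<alpha>)"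

text \<open>
  The component of multidegree \<open>\<alpha>\<close>, where \<open>x\<^sub>v\<close> and \<open>y\<^sub>v\<close> both have the unit vector of \<open>v\<close> as their degree.
\<close>

definition mpart :: "('v \<Rightarrow> nat) \<Rightarrow> ('v, 'k::field) vpoly \<Rightarrow> ('v, 'k) vpoly" where
  "mpart \<alpha> f = (\<Sum>m\<in>{m\<in>keys f. mdeg m = \<alpha>}. single m (lookup f m))"

lemma mdeg_add: "mdeg (m + m') = (\<lambda>v. mdeg m v + mdeg m' v)"
  by (auto simp: mdeg_def lookup_add)

lemma lookup_mpart: "lookup (mpart \<alpha> f) m = (if mdeg m = \<alpha> then lookup f m else 0)"
proof -
  have "lookup (mpart \<alpha> f) m =
      (\<Sum>m'\<in>{m\<in>keys f. mdeg m = \<alpha>}. if m' = m then lookup f m' else 0)"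
    by (simp add: mpart_def lookup_sum lookup_single when_def)
  then show ?thesis by (auto simp: sum.delta' in_keys_iff)
qed

lemma keys_mpart: "keys (mpart \<alpha> f) = {m \<in> keys f. mdeg m = \<alpha>}"
  by (auto simp: in_keys_iff lookup_mpart split: if_splits)

lemma mhom_mpart: "mhom \<alpha> (mpart \<alpha> f)"
  by (simp add: mhom_def keys_mpart)

lemma mpart_carr: "f \<in> carrier (poly_ring W) \<Longrightarrow> mpart \<alpha> f \<in> carrier (poly_ring W)"
  by (simp add: carrier_poly_ring keys_mpart)

lemma mpart_add: "mpart \<alpha> (f + g) = mpart \<alpha> f + mpart \<alpha> g"
  by (rule poly_mapping_eqI) (simp add: lookup_mpart lookup_add)

lemma mpart_zero [simp]: "mpart \<alpha> 0 = 0"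
  by (rule poly_mapping_eqI) (simp add: lookup_mpart)

lemma mpart_mhom: "mhom \<beta> f \<Longrightarrow> mpart \<alpha> f = (if \<alpha> = \<beta> then f else 0)"
  by (rule poly_mapping_eqI) (auto simp: lookup_mpart mhom_def in_keys_iff)

lemma mhom_mult: "mhom \<alpha> f \<Longrightarrow> mhom \<beta> g \<Longrightarrow> mhom (\<lambda>v. \<alpha> v + \<beta> v) (f * g)"
  unfolding mhom_def using Poly_Mapping.keys_mult[of f g] by (fastforce simp: mdeg_add)

lemma mhom_single: "mhom (mdeg m) (single m c)"
  by (simp add: mhom_def)

lemma sum_mpart:
  "f = (\<Sum>\<alpha>\<in>mdeg ` keys f. mpart \<alpha> f)"
proof (rule poly_mapping_eqI)
  fix k
  have "lookup (\<Sum>\<alpha>\<in>mdeg ` keys f. mpart \<alpha> f) k =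
    (\<Sum>\<alpha>\<in>mdeg ` keys f. if \<alpha> = mdeg k then lookup f k else 0)"
    by (simp add: lookup_sum lookup_mpart eq_commute)
  also have "\<dots> = lookup f k"
    by (auto simp: sum.delta in_keys_iff image_iff)
  finally show "lookup f k = lookup (\<Sum>\<alpha>\<in>mdeg ` keys f. mpart \<alpha> f) k"
    by simp
qed

lemma mpart_mult_mhom:
  assumes "mhom \<beta> g"
  shows "mpart (\<lambda>v. \<alpha> v + \<beta> v) (f * g) = mpart \<alpha> f * g"
proof -
  have "f * g = (\<Sum>\<gamma>\<in>mdeg ` keys f. mpart \<gamma> f * g)"
    using sum_mpart[of f] by (metis sum_distrib_right)
  moreover have "mpart \<delta> (sum h A) = (\<Sum>i\<in>A. mpart \<delta> (h i))" for \<delta> h and A :: "('a \<Rightarrow> nat) set"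
    by (induction A rule: infinite_finite_induct) (auto simp: mpart_add)
  ultimately have "mpart (\<lambda>v. \<alpha> v + \<beta> v) (f * g) =
      (\<Sum>\<gamma>\<in>mdeg ` keys f. mpart (\<lambda>v. \<alpha> v + \<beta> v) (mpart \<gamma> f * g))"
    by simp
  also have "\<dots> = (\<Sum>\<gamma>\<in>mdeg ` keys f. if \<gamma> = \<alpha> then mpart \<alpha> f * g else 0)"
  proof (rule sum.cong)
    fix \<gamma>
    have "(\<lambda>v. \<alpha> v + \<beta> v) = (\<lambda>v. \<gamma> v + \<beta> v) \<longleftrightarrow> \<gamma> = \<alpha>" by (auto simp: fun_eq_iff)
    then show "mpart (\<lambda>v. \<alpha> v + \<beta> v) (mpart \<gamma> f * g) = (if \<gamma> = \<alpha> then mpart \<alpha> f * g else 0)"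
      unfolding mpart_mhom[OF mhom_mult[OF mhom_mpart assms]] by auto
  qed simp
  also have "\<dots> = mpart \<alpha> f * g"
  proof (cases "\<alpha> \<in> mdeg ` keys f")
    case False
    then have "keys (mpart \<alpha> f) = {}" by (auto simp: keys_mpart)
    then have "mpart \<alpha> f = 0" by simp
    then show ?thesis by (simp add: sum.delta)
  qed (simp add: sum.delta)
  finally show ?thesis .
qed

lemma mdeg_single: "mdeg (single (XVar a) 1) = (\<lambda>v. if v = a then 1 else 0)"
  "mdeg (single (YVar a) 1) = (\<lambda>v. if v = a then 1 else 0)"
  by (auto simp: mdeg_def lookup_single when_def)

lemma mhom_xv: "mhom (\<lambda>v. if v = a then 1 else 0) (xv a)"
  and mhom_yv: "mhom (\<lambda>v. if v = a then 1 else 0) (yv a)"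
  using mhom_single[of "single (XVar a) 1"] mhom_single[of "single (YVar a) 1"]
  unfolding xv_def yv_def mdeg_single by blast+

lemma mhom_diff: "mhom \<alpha> f \<Longrightarrow> mhom \<alpha> g \<Longrightarrow> mhom \<alpha> (f - g)"
  unfolding mhom_def using keys_diff[of f g] by blast

lemma mhom_br: "mhom (\<lambda>v. (if v = a then 1 else 0) + (if v = b then 1 else 0)) (br a b)"
proof -
  have "mhom (\<lambda>v. (if v = b then 1 else 0) + (if v = a then 1 else 0)) (xv b * yv a)"
    by (intro mhom_mult mhom_xv mhom_yv)
  then have "mhom (\<lambda>v. (if v = a then 1 else 0) + (if v = b then 1 else 0)) (xv b * yv a)"
    by (simp add: add.commute)
  then show ?thesis
    unfolding br_def by (intro mhom_diff) (intro mhom_mult mhom_xv mhom_yv)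
qed

text \<open>
  Each monomial multiple of a multihomogeneous generator lies in a single degree, so the ideal
  contains the components of its elements.
\<close>

lemma ideal_span_mpart:
  assumes "\<And>g. g \<in> S \<Longrightarrow> \<exists>\<beta>. mhom \<beta> g" "f \<in> ideal_span W S"
  shows "mpart \<alpha> f \<in> ideal_span W S"
  using assms(2)
proof (induction rule: ideal_span.induct)
  case (span_step f g m c)
  obtain \<beta> where "mhom \<beta> g" using assms(1) span_step by blast
  note mpart_mhom[OF mhom_mult[OF mhom_single[of m c] this], of \<alpha>]
  then have "mpart \<alpha> (single m c * g) \<in> {0, single m c * g}" by simp
  then show ?case using span_step ideal_span.span_step[OF span_step(4,2,3), of c]
    by (auto simp: mpart_add)
qed (simp add: span_zero)

text \<open>The Pluecker relation among three vectors of the plane, carried to a form that is linear in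
  the coordinates of one vertex.\<close>

lemma ev_plucker:
  assumes V: "finite V" "a \<in> V" and f: "mhom \<alpha> f" "\<alpha> a = 1"
  shows "det2 p q * ev V (Z(a := r)) f = det2 r q * ev V (Z(a := p)) f + det2 p r * ev V (Z(a := q)) f"
proof -
  have "det2 p q * mono_val V (Z(a := r)) m =
      det2 r q * mono_val V (Z(a := p)) m + det2 p r * mono_val V (Z(a := q)) m"
    if "m \<in> keys f" for m
  proof -
    define R where "R = (\<Prod>v\<in>V - {a}. fst (Z v) ^ lookup m (XVar v) * snd (Z v) ^ lookup m (YVar v))"
    have split: "mono_val V (Z(a := s)) m = (fst s ^ lookup m (XVar a) * snd s ^ lookup m (YVar a)) * R"
      for s
      unfolding mono_val_def R_def prod.remove[OF V] by simp
    have "lookup m (XVar a) + lookup m (YVar a) = 1"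
      using f that by (auto simp: mhom_def mdeg_def)
    then consider "lookup m (XVar a) = 1" "lookup m (YVar a) = 0"
      | "lookup m (XVar a) = 0" "lookup m (YVar a) = 1" by linarith
    then show ?thesis unfolding split det2_def by cases (simp_all add: algebra_simps)
  qed
  then have "det2 p q * (c * mono_val V (Z(a := r)) m) =
      det2 r q * (c * mono_val V (Z(a := p)) m) + det2 p r * (c * mono_val V (Z(a := q)) m)"
    if "m \<in> keys f" for m c
    unfolding mult.left_commute[of _ c] distrib_left[symmetric] using that by simp
  then show ?thesis
    unfolding ev_def by (simp add: sum_distrib_left sum.distrib[symmetric])
qed

lemma ev_cong:
  assumes "mhom \<alpha> f" "\<And>v. v \<in> V \<Longrightarrow> \<alpha> v \<noteq> 0 \<Longrightarrow> Z v = Z' v"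
  shows "ev V Z f = ev V Z' f"
proof -
  have "mono_val V Z m = mono_val V Z' m" if "m \<in> keys f" for m
    unfolding mono_val_def
  proof (rule prod.cong)
    fix v assume v: "v \<in> V"
    show "fst (Z v) ^ lookup m (XVar v) * snd (Z v) ^ lookup m (YVar v) =
      fst (Z' v) ^ lookup m (XVar v) * snd (Z' v) ^ lookup m (YVar v)"
    proof (cases "\<alpha> v = 0")
      case True
      then have "lookup m (XVar v) = 0" "lookup m (YVar v) = 0"
        using assms(1) that by (auto simp: mhom_def mdeg_def)
      then show ?thesis by simp
    qed (use assms(2) v in auto)
  qed simp
  then show ?thesis by (simp add: ev_def)
qed

text \<open>
  A polynomial of degree at most one in the vertex \<open>a\<close> is determined by its values at two independent
  vectors in place of \<open>a\<close>.
\<close>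

lemma ev_linear_zero:
  assumes "finite V" "a \<in> V" "mhom \<alpha> f" "\<alpha> a \<le> 1" "det2 p q \<noteq> 0"
    "ev V (Z(a := p)) f = 0" "ev V (Z(a := q)) f = 0"
  shows "ev V (Z(a := r)) f = 0"
proof (cases "\<alpha> a = 0")
  case True
  then have "ev V (Z(a := r)) f = ev V (Z(a := p)) f" by (intro ev_cong[OF assms(3)]) auto
  then show ?thesis using assms by simp
next
  case False
  then have "det2 p q * ev V (Z(a := r)) f = 0"
    using ev_plucker[OF assms(1-3), of p q Z r] assms by simp
  then show ?thesis using assms(5) by simp
qed

text \<open>
  The torus that scales the vectors of the vertices acts on the component of multidegree \<open>\<alpha>\<close> by a
  character.
\<close>

lemma ev_scale:
  assumes "mhom \<alpha> f"
  shows "ev V (\<lambda>v. (s v * fst (Z v), s v * snd (Z v))) f = (\<Prod>v\<in>V. s v ^ \<alpha> v) * ev V Z f"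
proof -
  have "mono_val V (\<lambda>v. (s v * fst (Z v), s v * snd (Z v))) m = (\<Prod>v\<in>V. s v ^ \<alpha> v) * mono_val V Z m"
    if "m \<in> keys f" for m
  proof -
    have "\<alpha> = mdeg m" using assms that by (auto simp: mhom_def)
    then show ?thesis
      unfolding mono_val_def prod.distrib[symmetric]
      by (intro prod.cong) (auto simp: mdeg_def power_mult_distrib power_add mult_ac)
  qed
  then show ?thesis unfolding ev_def by (simp add: sum_distrib_left mult_ac)
qed

lemma homogeneous_degree_mhom:
  fixes f :: "('v, 'k::field) vpoly"
  assumes "f \<in> carrier (poly_ring V)" "finite V" "mhom \<alpha> f" "homogeneous d f" "f \<noteq> 0"
  shows "(\<Sum>v\<in>V. \<alpha> v) = d"
proof -
  have "keys f \<noteq> {}" using assms(5) by simp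
  then obtain m where m: "m \<in> keys f" by blast
  have k: "keys m \<subseteq> XVar ` V \<union> YVar ` V" using m assms(1) by (auto simp: carrier_poly_ring)
  have "d = (\<Sum>z\<in>keys m. lookup m z)"
    using assms(4) m by (auto simp: homogeneous_def)
  also have "\<dots> = (\<Sum>z\<in>XVar ` V \<union> YVar ` V. lookup m z)"
    using k assms(2) by (intro sum.mono_neutral_left) (auto simp: in_keys_iff)
  also have "\<dots> = (\<Sum>z\<in>XVar ` V. lookup m z) + (\<Sum>z\<in>YVar ` V. lookup m z)"
    using assms(2) by (intro sum.union_disjoint) auto
  also have "\<dots> = (\<Sum>v\<in>V. mdeg m v)"
    by (simp add: sum.reindex inj_on_def mdeg_def sum.distrib)
  finally show ?thesis using assms(3) m by (auto simp: mhom_def)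
qed

lemma homogeneous_mult:
  fixes f g :: "('v, 'k::field) vpoly"
  assumes "homogeneous d f" "homogeneous e g"
  shows "homogeneous (d + e) (f * g)"
  unfolding homogeneous_def
proof
  fix m assume "m \<in> keys (f * g)"
  then obtain a b where ab: "a \<in> keys f" "b \<in> keys g" "m = a + b"
    using Poly_Mapping.keys_mult[of f g] by blast
  let ?A = "keys a \<union> keys b"
  have *: "(\<Sum>z\<in>keys c. lookup c z) = (\<Sum>z\<in>?A. lookup c z)"
    if "keys c \<subseteq> ?A" for c
    using that by (intro sum.mono_neutral_left) (auto simp: in_keys_iff)
  have "(\<Sum>z\<in>keys m. lookup m z) = (\<Sum>z\<in>?A. lookup m z)"
    using Poly_Mapping.keys_add[of a b] ab by (intro *) auto
  also have "\<dots> = (\<Sum>z\<in>?A. lookup a z) + (\<Sum>z\<in>?A. lookup b z)"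
    by (simp add: ab lookup_add sum.distrib)
  also have "\<dots> = d + e"
    using *[of a] *[of b] ab assms by (auto simp: homogeneous_def)
  finally show "(\<Sum>z\<in>keys m. lookup m z) = d + e" .
qed

lemma homogeneous_xv: "homogeneous 1 (xv a)" and homogeneous_yv: "homogeneous 1 (yv a)"
  by (simp_all add: homogeneous_def xv_def yv_def)

lemma homogeneous_br: "homogeneous 2 (br a b :: ('v, 'k::field) vpoly)"
proof -
  have "homogeneous 2 (xv a * yv b :: ('v, 'k) vpoly)" for a b :: 'v
    using homogeneous_mult[OF homogeneous_xv homogeneous_yv, of a b] by (simp add: numeral_2_eq_2)
  from this[of a b] this[of b a] show ?thesis
    unfolding br_def homogeneous_def
    using keys_diff[of "xv a * yv b :: ('v, 'k) vpoly" "xv b * yv a"] by blast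
qed

lemma homogeneous_mpart: "homogeneous d f \<Longrightarrow> homogeneous d (mpart \<alpha> f)"
  by (simp add: homogeneous_def keys_mpart)

lemma homogeneous_one: "homogeneous 0 1"
  by (simp add: homogeneous_def)

section \<open>The primes attached to vertex sets as kernels of generic points\<close>

definition indet :: "nat \<Rightarrow> ('k::field) coord" where
  "indet i = single (single i 1) 1"

text \<open>
  Pairwise independent vectors. The indeterminates with index \<open>2\<close> modulo \<open>3\<close> stay free; they serve as
  scalars of the vertices in generic points.
\<close>

definition label_vec :: "nat \<Rightarrow> ('k::field) coord \<times> 'k coord" where
  "label_vec l = (indet (3 * l), indet (3 * l + 1))"

lemma indet_power: "indet i ^ k = (single (single i k) 1 :: ('k::field) coord)"
  by (induction k) (simp_all add: indet_def mult_single single_add[symmetric])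

lemma indet_nonzero [simp]: "indet i \<noteq> (0 :: ('k::field) coord)"
  by (metis keys_eq_empty keys_single insert_not_empty indet_def zero_neq_one)

lemma label_vec_nonzero: "fst (label_vec l) \<noteq> (0 :: ('k::field) coord)"
  by (simp add: label_vec_def)

lemma det2_label_vec:
  assumes "p \<noteq> q"
  shows "det2 (label_vec p) (label_vec q) \<noteq> (0 :: ('k::field) coord)"
proof
  assume "det2 (label_vec p) (label_vec q) = (0 :: 'k coord)"
  then have "(single (single (3 * p) 1 + single (3 * q + 1) 1) 1 :: 'k coord) =
      single (single (3 * q) 1 + single (3 * p + 1) 1) 1"
    by (simp add: det2_def label_vec_def indet_def mult_single)
  then have "single (3 * q) (1::nat) + single (3 * p + 1) 1 =
      single (3 * p) 1 + single (3 * q + 1) 1"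
    by (metis (no_types, lifting) keys_single singleton_inject zero_neq_one)
  then have "lookup (single (3 * q) (1::nat) + single (3 * p + 1) 1) (3 * p) =
      lookup (single (3 * p) 1 + single (3 * q + 1) 1) (3 * p)"
    by simp
  moreover have "3 * p \<noteq> 3 * q + 1" by presburger
  ultimately show False
    using assms by (simp add: lookup_add lookup_single when_def)
qed

lemma ev_span_zero:
  assumes "f \<in> ideal_span W S" "\<And>g. g \<in> S \<Longrightarrow> ev V Z g = 0"
  shows "ev V Z f = 0"
  using assms(1) by (induction rule: ideal_span.induct) (simp_all add: ev_add ev_mult assms(2))

locale fin_graph =
  fixes G :: "'v::countable ugraph"
  assumes simple: "simple_graph G"
begin

abbreviation V :: "'v set" where "V \<equiv> verts G"

definition adj :: "'v \<Rightarrow> 'v \<Rightarrow> bool" where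
  "adj a b \<longleftrightarrow> {a, b} \<in> edges G"

definition conn :: "'v set \<Rightarrow> 'v \<Rightarrow> 'v \<Rightarrow> bool" where
  "conn U = (\<lambda>a b. adj a b \<and> a \<in> U \<and> b \<in> U)\<^sup>*\<^sup>*"

lemma finV [simp]: "finite V"
  using simple by (simp add: simple_graph_def)

lemma adj_sym: "adj a b \<longleftrightarrow> adj b a"
  by (simp add: adj_def insert_commute)

lemma adj_V: "adj a b \<Longrightarrow> a \<in> V \<and> b \<in> V \<and> a \<noteq> b"
  using simple by (fastforce simp: simple_graph_def adj_def)

lemma conn_refl [simp]: "conn U a a"
  by (simp add: conn_def)

lemma conn_trans: "conn U a b \<Longrightarrow> conn U b c \<Longrightarrow> conn U a c"
  unfolding conn_def by (rule rtranclp_trans)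

lemma conn_adj: "adj a b \<Longrightarrow> a \<in> U \<Longrightarrow> b \<in> U \<Longrightarrow> conn U a b"
  by (auto simp: conn_def)

lemma conn_induct [consumes 1, case_names base step]:
  assumes "conn U a b" "Q a" "\<And>b c. conn U a b \<Longrightarrow> Q b \<Longrightarrow> adj b c \<Longrightarrow> b \<in> U \<Longrightarrow> c \<in> U \<Longrightarrow> Q c"
  shows "Q b"
  using assms(1) unfolding conn_def
  by (induction rule: rtranclp_induct) (use assms(2,3) in \<open>auto simp: conn_def\<close>)

lemma conn_sym: "conn U a b \<Longrightarrow> conn U b a"
proof (induction rule: conn_induct)
  case (step b c)
  then have "conn U c b" using adj_sym conn_adj by blast
  then show ?case using step conn_trans by blast
qed simp

lemma conn_in: "conn U a b \<Longrightarrow> a = b \<or> (a \<in> U \<and> b \<in> U)"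
  by (induction rule: conn_induct) auto

lemma conn_closed:
  assumes "conn U a b" "a \<in> A" "\<And>x y. x \<in> A \<Longrightarrow> adj x y \<Longrightarrow> y \<in> U \<Longrightarrow> y \<in> A"
  shows "b \<in> A"
  using assms(1) by (induction rule: conn_induct) (use assms in auto)

abbreviation JG :: "('v, 'k::field) vpoly set" where
  "JG \<equiv> binomial_edge_ideal G"

text \<open>
  The generators of \<open>P\<^sub>T\<close>, with the components expressed by connectedness in \<open>V - T\<close>.
\<close>

definition cut_gens :: "'v set \<Rightarrow> ('v, 'k::field) vpoly set" where
  "cut_gens T = xv ` T \<union> yv ` T \<union>
     {br a b | a b. a \<in> V - T \<and> b \<in> V - T \<and> a \<noteq> b \<and> conn (V - T) a b}"

lemma cut_gens_carr: "T \<subseteq> V \<Longrightarrow> cut_gens T \<subseteq> carrier (poly_ring V)"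
  by (auto simp: cut_gens_def)

lemma rtrancl_induced:
  "(a, b) \<in> {(s, t). {s, t} \<in> edges (induced G U)}\<^sup>* \<longleftrightarrow> conn U a b"
proof -
  have "(\<lambda>x y. (x, y) \<in> {(s, t). {s, t} \<in> edges (induced G U)}) = (\<lambda>a b. adj a b \<and> a \<in> U \<and> b \<in> U)"
    by (auto simp: induced_def adj_def fun_eq_iff)
  then show ?thesis
    unfolding conn_def rtranclp_rtrancl_eq[symmetric] by simp
qed

lemma components_induced: "components (induced G (V - T)) = {{b. conn (V - T) a b} | a. a \<in> V - T}"
  unfolding components_def rtrancl_induced by (auto simp: induced_def)

lemma edge_binomials_complete:
  "edge_binomials (complete_graph C) = {br a b | a b. a \<in> C \<and> b \<in> C \<and> a \<noteq> b}"
  unfolding edge_binomials_def complete_graph_def br_def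
  by (auto simp: doubleton_eq_iff)

lemma P_ideal_span:
  assumes "T \<subseteq> V"
  shows "(P_ideal G T :: ('v, 'k::field) vpoly set) = ideal_span V (cut_gens T)"
proof -
  have "(\<Union>C\<in>components (induced G (V - T)). edge_binomials (complete_graph C) :: ('v, 'k) vpoly set) =
      {br a b | a b. a \<in> V - T \<and> b \<in> V - T \<and> a \<noteq> b \<and> conn (V - T) a b}" (is "?A = ?B")
  proof (intro subset_antisym subsetI)
    fix p :: "('v, 'k) vpoly" assume "p \<in> ?A"
    then obtain c a b where c: "c \<in> V - T" "conn (V - T) c a" "conn (V - T) c b"
        "a \<noteq> b" and p: "p = br a b"
      by (auto simp: components_induced edge_binomials_complete)
    then have "a \<in> V - T" "b \<in> V - T" "conn (V - T) a b"
      using conn_in[of "V - T" c a] conn_in[of "V - T" c b] conn_trans[OF conn_sym] by blast+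
    then show "p \<in> ?B" using c p by blast
  next
    fix p :: "('v, 'k) vpoly" assume "p \<in> ?B"
    then obtain a b where "a \<in> V - T" "a \<noteq> b" "conn (V - T) a b" "p = br a b" by blast
    then show "p \<in> ?A"
      unfolding components_induced edge_binomials_complete
      by (intro UN_I[of "{b. conn (V - T) a b}"]) (use conn_refl in blast)+
  qed
  then have "(P_ideal G T :: ('v, 'k) vpoly set) = Idl\<^bsub>poly_ring V\<^esub> (cut_gens T)"
    by (simp add: P_ideal_def cut_gens_def)
  then show ?thesis
    using genideal_eq_ideal_span[OF cut_gens_carr[OF assms]] by simp
qed

lemma JG_gens: "edge_binomials G = {br a b | a b. adj a b}"
  by (auto simp: edge_binomials_def br_def adj_def)

lemma JG_span: "(JG :: ('v, 'k::field) vpoly set) = ideal_span V {br a b | a b. adj a b}"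
  unfolding binomial_edge_ideal_def JG_gens
  by (rule genideal_eq_ideal_span) (auto dest: adj_V)

lemma ideal_JG: "ideal (JG :: ('v, 'k::field) vpoly set) (poly_ring V)"
proof -
  interpret cring "poly_ring V :: ('v, 'k) vpoly ring" by (rule cring_poly_ring)
  show ?thesis
    unfolding binomial_edge_ideal_def JG_gens by (rule genideal_ideal) (auto dest: adj_V)
qed

lemma ideal_P:
  assumes "T \<subseteq> V"
  shows "ideal (P_ideal G T :: ('v, 'k::field) vpoly set) (poly_ring V)"
proof -
  interpret cring "poly_ring V :: ('v, 'k) vpoly ring" by (rule cring_poly_ring)
  show ?thesis
    unfolding P_ideal_span[OF assms] genideal_eq_ideal_span[OF cut_gens_carr[OF assms], symmetric]
    by (rule genideal_ideal) (rule cut_gens_carr[OF assms])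
qed

lemmas JG_zero = ideal_poly_ringD(1)[OF ideal_JG] and JG_add = ideal_poly_ringD(2)[OF ideal_JG]
  and JG_mult = ideal_poly_ringD(3)[OF ideal_JG] and JG_carr = ideal_poly_ringD(4)[OF ideal_JG]

lemmas P_zero = ideal_poly_ringD(1)[OF ideal_P] and P_add = ideal_poly_ringD(2)[OF ideal_P]
  and P_mult = ideal_poly_ringD(3)[OF ideal_P] and P_carr = ideal_poly_ringD(4)[OF ideal_P]

lemma ideal_span_self: "g \<in> S \<Longrightarrow> g \<in> ideal_span W S"
  using span_step[OF span_zero, of g S 0 W 1] by simp

lemma P_gen: "T \<subseteq> V \<Longrightarrow> g \<in> cut_gens T \<Longrightarrow> g \<in> P_ideal G T"
  by (simp add: P_ideal_span ideal_span_self)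

lemma JG_edge: "adj a b \<Longrightarrow> br a b \<in> JG"
  unfolding JG_span by (rule ideal_span_self) blast

lemma P_sum:
  assumes "T \<subseteq> V" "\<And>i. i \<in> I \<Longrightarrow> f i \<in> P_ideal G T"
  shows "(\<Sum>i\<in>I. f i) \<in> P_ideal G T"
  using assms(2) by (induction I rule: infinite_finite_induct) (auto simp: P_zero[OF assms(1)]
      P_add[OF assms(1)])

lemma JG_subset_P:
  assumes "T \<subseteq> V"
  shows "JG \<subseteq> (P_ideal G T :: ('v, 'k::field) vpoly set)"
proof -
  have gen: "br a b \<in> (P_ideal G T :: ('v, 'k::field) vpoly set)" if ab: "adj a b" for a b
  proof -
    have V: "a \<in> V" "b \<in> V" "a \<noteq> b" using adj_V[OF ab] by auto
    consider "a \<in> T" | "b \<in> T" | "a \<in> V - T" "b \<in> V - T" using V by blast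
    then show ?thesis
    proof cases
      case 1
      then have "xv a \<in> cut_gens T" "yv a \<in> (cut_gens T :: ('v, 'k) vpoly set)"
        by (auto simp: cut_gens_def)
      then have "yv b * xv a + (- xv b) * yv a \<in> (P_ideal G T :: ('v, 'k) vpoly set)"
        using V assms by (intro P_add P_mult P_gen) auto
      then show ?thesis by (simp add: br_def mult_ac)
    next
      case 2
      then have "xv b \<in> cut_gens T" "yv b \<in> (cut_gens T :: ('v, 'k) vpoly set)"
        by (auto simp: cut_gens_def)
      then have "(- yv a) * xv b + xv a * yv b \<in> (P_ideal G T :: ('v, 'k) vpoly set)"
        using V assms by (intro P_add P_mult P_gen) auto
      then show ?thesis by (simp add: br_def mult_ac)
    next
      case 3
      then have "br a b \<in> (cut_gens T :: ('v, 'k) vpoly set)" using ab V(3) conn_adj[OF ab 3]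
        unfolding cut_gens_def by blast
      then show ?thesis using assms P_gen by blast
    qed
  qed
  show ?thesis
  proof
    fix f :: "('v, 'k) vpoly" assume "f \<in> JG"
    then have "f \<in> ideal_span V {br a b | a b. adj a b}" by (simp add: JG_span)
    then show "f \<in> P_ideal G T"
      by (induction rule: ideal_span.induct)
        (auto simp: gen P_zero[OF assms] intro!: P_add[OF assms] P_mult[OF assms])
  qed
qed

text \<open>
  A number for the component of \<open>v\<close> in \<open>V - T\<close>: all vertices of a component have the same set of
  reachable vertices, so \<open>SOME\<close> picks the same one for them.
\<close>

definition comp_label :: "'v set \<Rightarrow> 'v \<Rightarrow> nat" where
  "comp_label T v = to_nat (SOME w. conn (V - T) v w)"

lemma comp_label_eq_iff: "comp_label T a = comp_label T b \<longleftrightarrow> conn (V - T) a b"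
proof
  assume "comp_label T a = comp_label T b"
  then have "(SOME w. conn (V - T) a w) = (SOME w. conn (V - T) b w)" by (simp add: comp_label_def)
  moreover have "conn (V - T) a (SOME w. conn (V - T) a w)" "conn (V - T) b (SOME w. conn (V - T) b w)"
    by (rule someI, rule conn_refl)+
  ultimately show "conn (V - T) a b" using conn_trans conn_sym by metis
next
  assume "conn (V - T) a b"
  then have "conn (V - T) a = conn (V - T) b" using conn_trans conn_sym by blast
  then show "comp_label T a = comp_label T b" by (simp add: comp_label_def)
qed

definition generic_point :: "'v set \<Rightarrow> 'v \<Rightarrow> ('k::field) coord \<times> 'k coord" where
  "generic_point T v = (if v \<in> T then (0, 0) else
     (indet (3 * to_nat v + 2) * fst (label_vec (comp_label T v)), indet (3 * to_nat v +
         2) * snd (label_vec (comp_label T v))))"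

lemma ev_generic_point_cut_gens:
  fixes p :: "('v, 'k::field) vpoly"
  assumes "T \<subseteq> V" "p \<in> cut_gens T"
  shows "ev V (generic_point T) p = 0"
proof -
  have "det2 (generic_point T a) (generic_point T b) = (0 :: 'k coord)" if "conn (V - T) a b" for a b
    using that by (auto simp: generic_point_def det2_def comp_label_eq_iff[symmetric] algebra_simps)
  moreover have "generic_point T a = (0 :: 'k coord, 0 :: 'k coord)" if "a \<in> T" for a using that
    by (simp add: generic_point_def)
  ultimately show ?thesis
    using assms unfolding cut_gens_def by (auto simp: ev_xv ev_yv ev_br subset_iff)
qed

lemma ev_generic_point_P: "T \<subseteq> V \<Longrightarrow> f \<in> P_ideal G T \<Longrightarrow> ev V (generic_point T) f = 0"
  using ev_span_zero[of f V "cut_gens T" V "generic_point T"] ev_generic_point_cut_gens[of T]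
    by (auto simp: P_ideal_span)

text \<open>Two monomials with the same vertex degrees and the same number of \<open>y\<close>-variables on every
  component are congruent: as long as they differ, some component has a vertex with too many and
  a vertex with too few \<open>y\<close>, and one exchange along the generator of this pair brings them closer.\<close>

lemma monomials_congruent:
  assumes T: "T \<subseteq> V"
    and "keys m \<subseteq> XVar ` V \<union> YVar ` V"
    and "mdeg m = mdeg m'" "\<And>v. v \<in> T \<Longrightarrow> mdeg m v = 0"
    and "\<And>v. (\<Sum>w | w \<in> V \<and> comp_label T w = comp_label T v. lookup m (YVar w)) =
             (\<Sum>w | w \<in> V \<and> comp_label T w = comp_label T v. lookup m' (YVar w))"
  shows "single m c - single m' c \<in> (P_ideal G T :: ('v, 'k::field) vpoly set)"
  using assms(2-)
proof (induction "\<Sum>v\<in>V. lookup m (YVar v) - lookup m' (YVar v)" arbitrary: m rule: less_induct)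
  case (less m)
  let ?y = "\<lambda>m v. lookup m (YVar v)" and ?x = "\<lambda>m v. lookup m (XVar v)"
  let ?C = "\<lambda>v. {w. w \<in> V \<and> comp_label T w = comp_label T v}"
  have xy: "?x m v + ?y m v = ?x m' v + ?y m' v" for v
    using less.prems(2) by (auto simp: mdeg_def fun_eq_iff)
  have out: "?y m v = 0" and outx: "?x m v = 0" if "v \<notin> V" for v
  proof -
    have "YVar v \<notin> XVar ` V \<union> YVar ` V" "XVar v \<notin> XVar ` V \<union> YVar ` V" using that by auto
    then have "YVar v \<notin> keys m" "XVar v \<notin> keys m" using less.prems(1) by auto
    then show "?y m v = 0" "?x m v = 0" by (simp_all add: in_keys_iff)
  qed
  show ?case
  proof (cases "\<exists>v\<in>V. ?y m v > ?y m' v")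
    case False
    have y: "?y m v = ?y m' v" for v
    proof (cases "v \<in> V")
      case True
      show ?thesis
      proof (rule ccontr)
        assume "?y m v \<noteq> ?y m' v"
        then have "(\<Sum>w\<in>?C v. ?y m w) < (\<Sum>w\<in>?C v. ?y m' w)"
          using False True by (intro sum_strict_mono_ex1) (auto simp: not_less le_neq_implies_less)
        then show False using less.prems(4)[of v] by simp
      qed
    next
      case False
      then show ?thesis using out[OF False] outx[OF False] xy[of v] by simp
    qed
    have "m = m'"
    proof (rule poly_mapping_eqI)
      fix z show "lookup m z = lookup m' z"
        using xy y by (cases z) (metis add_right_cancel)+
    qed
    then show ?thesis using P_zero[OF T] by simp
  next
    case True
    then obtain v where v: "v \<in> V" "?y m v > ?y m' v" by blast
    have "\<exists>w\<in>?C v. ?y m w < ?y m' w"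
    proof (rule ccontr)
      assume "\<not> ?thesis"
      then have "(\<Sum>w\<in>?C v. ?y m' w) < (\<Sum>w\<in>?C v. ?y m w)"
        using v by (intro sum_strict_mono_ex1) (auto simp: not_less)
      then show False using less.prems(4)[of v] by simp
    qed
    then obtain w where w: "w \<in> V" "comp_label T w = comp_label T v" "?y m w < ?y m' w" by blast
    have wv: "w \<noteq> v" using v w by auto
    have "mdeg m v > 0" "mdeg m w > 0" using v w xy[of w] by (auto simp: mdeg_def)
    then have vT: "v \<notin> T" "w \<notin> T" using less.prems(3) by fastforce+
    define m0 where "m0 = m - single (YVar v) 1 - single (XVar w) 1"
    have xw: "?x m w > 0" using w(3) xy[of w] by linarith
    have m: "m = m0 + (single (YVar v) 1 + single (XVar w) 1)"
      by (rule poly_mapping_eqI) (use v xw in \<open>auto simp: m0_def lookup_add lookup_minus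
          lookup_single when_def\<close>)
    define m1 where "m1 = m0 + (single (XVar v) 1 + single (YVar w) 1)"
    have y1: "?y m1 u = (if u = v then ?y m u - 1 else if u = w then ?y m u + 1 else ?y m u)" for u
      using wv by (auto simp: m1_def m0_def lookup_add lookup_minus lookup_single when_def)
    have keys0: "keys m0 \<subseteq> XVar ` V \<union> YVar ` V"
    proof
      fix z assume "z \<in> keys m0"
      then have "lookup m z \<noteq> 0" by (subst m) (simp add: in_keys_iff lookup_add)
      then show "z \<in> XVar ` V \<union> YVar ` V" using less.prems(1) by (auto simp: in_keys_iff subset_iff)
    qed
    have keys1: "keys m1 \<subseteq> XVar ` V \<union> YVar ` V"
    proof
      fix z assume "z \<in> keys m1"
      then have "z \<in> keys m0 \<or> z = XVar v \<or> z = YVar w"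
        by (auto simp: m1_def in_keys_iff lookup_add lookup_single when_def split: if_splits)
      then show "z \<in> XVar ` V \<union> YVar ` V" using keys0 v w by blast
    qed
    have deg1: "mdeg m1 = mdeg m"
      unfolding m m1_def by (auto simp: mdeg_def lookup_add lookup_single when_def fun_eq_iff)
    have "(\<Sum>u\<in>V. ?y m1 u - ?y m' u) < (\<Sum>u\<in>V. ?y m u - ?y m' u)"
      using v w(3) by (intro sum_strict_mono_ex1) (auto simp: y1 intro!: bexI[of _ v])
    moreover have "(\<Sum>u\<in>?C a. ?y m1 u) = (\<Sum>u\<in>?C a. ?y m u)" for a
    proof (cases "comp_label T a = comp_label T v")
      case True
      have in': "v \<in> ?C a" "w \<in> ?C a - {v}" using True v w wv by auto
      have "(\<Sum>u\<in>?C a. g u) = g v + (g w + (\<Sum>u\<in>?C a - {v} - {w}. g u))" for g :: "'v \<Rightarrow> nat"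
        using in' by (simp add: sum.remove[of "?C a" v] sum.remove[of "?C a - {v}" w])
      then show ?thesis using v wv by (simp add: y1)
    next
      case False
      then show ?thesis using w by (intro sum.cong) (auto simp: y1)
    qed
    ultimately have IH: "single m1 c - single m' c \<in> (P_ideal G T :: ('v, 'k) vpoly set)"
      using less.prems keys1 deg1 by (intro less.hyps) auto
    have "single m c - single m1 c = single m0 c * br w v"
      unfolding m m1_def br_def xv_def yv_def
      by (simp add: right_diff_distrib mult_single add_ac)
    moreover have "br w v \<in> (cut_gens T :: ('v, 'k) vpoly set)"
      using v w vT wv comp_label_eq_iff by (auto simp: cut_gens_def)
    ultimately have "single m c - single m1 c \<in> (P_ideal G T :: ('v, 'k) vpoly set)"
      using T keys0 by (simp add: P_mult P_gen)
    from P_add[OF T this IH] show ?thesis by simp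
  qed
qed

lemma monomial_in_P:
  assumes T: "T \<subseteq> V" and m: "keys m \<subseteq> XVar ` V \<union> YVar ` V" and v: "v \<in> T" "mdeg m v > 0"
  shows "single m c \<in> (P_ideal G T :: ('v, 'k::field) vpoly set)"
proof -
  obtain z where z: "z = XVar v \<or> z = YVar v" "lookup m z > 0"
    using v by (auto simp: mdeg_def)
  define m0 where "m0 = m - single z 1"
  have eq: "m = m0 + single z 1"
    by (rule poly_mapping_eqI) (use z in \<open>auto simp: m0_def lookup_add lookup_minus lookup_single
        when_def\<close>)
  have "keys m0 \<subseteq> XVar ` V \<union> YVar ` V"
  proof
    fix u assume "u \<in> keys m0"
    then have "lookup m u \<noteq> 0" by (subst eq) (simp add: in_keys_iff lookup_add)
    then show "u \<in> XVar ` V \<union> YVar ` V" using m by (auto simp: in_keys_iff subset_iff)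
  qed
  then have c: "single m0 c \<in> carrier (poly_ring V)" by simp
  have "single (single z 1) 1 \<in> (cut_gens T :: ('v, 'k) vpoly set)"
    using z v unfolding cut_gens_def xv_def yv_def by auto
  then have "single m0 c * single (single z 1) 1 \<in> (P_ideal G T :: ('v, 'k) vpoly set)"
    using T c by (intro P_mult P_gen) auto
  then show ?thesis by (simp add: eq mult_single)
qed

text \<open>
  The exponent of the monomial to which the generic point sends the monomial with exponent \<open>m\<close>.
\<close>

definition generic_exp :: "'v set \<Rightarrow> ('v var \<Rightarrow>\<^sub>0 nat) \<Rightarrow> nat \<Rightarrow>\<^sub>0 nat" where
  "generic_exp T m = (\<Sum>v\<in>V. single (3 * to_nat v + 2) (mdeg m v) +
     (single (3 * comp_label T v) (lookup m (XVar v)) +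
      single (3 * comp_label T v + 1) (lookup m (YVar v))))"

lemma mono_val_generic_point:
  assumes "\<And>v. v \<in> T \<Longrightarrow> mdeg m v = 0"
  shows "mono_val V (generic_point T) m = (single (generic_exp T m) 1 :: ('k::field) coord)"
proof -
  have prod: "(\<Prod>v\<in>A. single (e v) (1::'k)) = single (\<Sum>v\<in>A. e v) 1"
    if "finite A" for A and e :: "'v \<Rightarrow> nat \<Rightarrow>\<^sub>0 nat"
    using that by (induction A) (auto simp: mult_single)
  have "mono_val V (generic_point T) m = (\<Prod>v\<in>V. single (single (3 * to_nat v + 2) (mdeg m v) +
     (single (3 * comp_label T v) (lookup m (XVar v)) +
      single (3 * comp_label T v + 1) (lookup m (YVar v)))) (1::'k))"
    unfolding mono_val_def
  proof (rule prod.cong)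
    fix v
    show "fst (generic_point T v) ^ lookup m (XVar v) * snd (generic_point T v) ^ lookup m (YVar v) =
      single (single (3 * to_nat v + 2) (mdeg m v) +
     (single (3 * comp_label T v) (lookup m (XVar v)) +
      single (3 * comp_label T v + 1) (lookup m (YVar v)))) (1::'k)"
    proof (cases "v \<in> T")
      case True
      then have "lookup m (XVar v) = 0" "lookup m (YVar v) = 0"
        using assms[of v] by (auto simp: mdeg_def)
      then show ?thesis by (simp add: mdeg_def)
    next
      case False
      have "single (a + (b + c)) (1::'k) = single a 1 * (single b 1 * single c 1)"
        for a b c :: "nat \<Rightarrow>\<^sub>0 nat"
        by (simp add: mult_single)
      then show ?thesis
        using False by (simp add: generic_point_def label_vec_def indet_power[symmetric] mdeg_def
            power_add power_mult_distrib mult_ac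
            del: One_nat_def)
    qed
  qed simp
  also have "\<dots> = single (generic_exp T m) 1"
    by (simp add: prod generic_exp_def)
  finally show ?thesis .
qed

lemma lookup_generic_exp:
  "v \<in> V \<Longrightarrow> lookup (generic_exp T m) (3 * to_nat v + 2) = mdeg m v"
  "lookup (generic_exp T m) (3 * l + 1) = (\<Sum>w | w \<in> V \<and> comp_label T w = l. lookup m (YVar w))"
proof -
  have a: "3 * x \<noteq> Suc (Suc (3 * y))" "Suc (Suc (3 * x)) \<noteq> 3 * y" "Suc (3 * x) \<noteq> 3 * y"
      "3 * x \<noteq> Suc (3 * y)"
    for x y :: nat
    by presburger+
  show "lookup (generic_exp T m) (3 * to_nat v + 2) = mdeg m v" if "v \<in> V"
    unfolding generic_exp_def using that a
    by (simp add: lookup_sum lookup_add lookup_single when_def sum.delta')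
  show "lookup (generic_exp T m) (3 * l + 1) = (\<Sum>w | w \<in> V \<and> comp_label T w = l. lookup m (YVar w))"
    unfolding generic_exp_def using a
    by (simp add: lookup_sum lookup_add lookup_single when_def sum.inter_filter[symmetric])
qed

text \<open>The generic point of \<open>T\<close> sends \<open>(x\<^sub>v, y\<^sub>v)\<close> to \<open>a\<^sub>v (s, t)\<close>, with one pair \<open>(s, t)\<close> of
  indeterminates for every component. It maps monomials to monomials, so a relation among the
  images is a combination of coincidences of two monomials, and these are the congruences above.\<close>

theorem P_ideal_kernel:
  assumes T: "T \<subseteq> V" and f: "f \<in> carrier (poly_ring V)"
  shows "f \<in> (P_ideal G T :: ('v, 'k::field) vpoly set) \<longleftrightarrow> ev V (generic_point T) f = 0"
proof
  assume ev0: "ev V (generic_point T) f = 0"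
  let ?c = "lookup f"
  define A where "A = {m \<in> keys f. \<forall>v\<in>T. mdeg m v = 0}"
  define \<mu> where "\<mu> = generic_exp T"
  define r where "r = (\<lambda>\<nu>. SOME m. m \<in> A \<and> \<mu> m = \<nu>)"
  have r: "r (\<mu> m) \<in> A \<and> \<mu> (r (\<mu> m)) = \<mu> m" if "m \<in> A" for m
    unfolding r_def using that by (intro someI[of "\<lambda>x. x \<in> A \<and> \<mu> x = \<mu> m" m]) simp
  have finA: "finite A" by (simp add: A_def)
  have keys: "keys m \<subseteq> XVar ` V \<union> YVar ` V" if "m \<in> keys f" for m
    using f that by (auto simp: carrier_poly_ring)
  have zero: "mono_val V (generic_point T) m = (0 :: 'k coord)" if m: "m \<in> keys f - A" for m
  proof -
    obtain v where v: "v \<in> T" "mdeg m v \<noteq> 0" using m by (auto simp: A_def)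
    then have "fst (generic_point T v) ^ lookup m (XVar v) * snd (generic_point T v) ^ lookup m
        (YVar v) = (0 :: 'k coord)"
      by (auto simp: mdeg_def generic_point_def zero_power)
    then show ?thesis unfolding mono_val_def using v T by (intro prod_zero) auto
  qed
  have "ev V (generic_point T) f = (\<Sum>m\<in>A. single 0 (?c m) * mono_val V (generic_point T) m)"
    unfolding ev_def using zero by (intro sum.mono_neutral_right) (auto simp: A_def)
  also have "\<dots> = (\<Sum>m\<in>A. single (\<mu> m) (?c m))"
    by (rule sum.cong) (auto simp: A_def mono_val_generic_point mult_single \<mu>_def)
  finally have sum0: "(\<Sum>m\<in>A. single (\<mu> m) (?c m)) = 0" using ev0 by simp
  have fib: "(\<Sum>m | m \<in> A \<and> \<mu> m = \<nu>. ?c m) = 0" for \<nu>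
  proof -
    have "(\<Sum>m | m \<in> A \<and> \<mu> m = \<nu>. ?c m) = (\<Sum>m\<in>A. ?c m when \<mu> m = \<nu>)"
      using finA by (simp add: when_def sum.inter_filter[symmetric])
    also have "\<dots> = lookup (\<Sum>m\<in>A. single (\<mu> m) (?c m)) \<nu>"
      by (simp add: lookup_sum lookup_single)
    finally show ?thesis using sum0 by simp
  qed
  have "(\<Sum>m\<in>A. single (r (\<mu> m)) (?c m)) =
      (\<Sum>\<nu>\<in>\<mu> ` A. \<Sum>m | m \<in> A \<and> \<mu> m = \<nu>. single (r (\<mu> m)) (?c m))"
    by (rule sum.image_gen[OF finA])
  also have "\<dots> = (\<Sum>\<nu>\<in>\<mu> ` A. single (r \<nu>) (\<Sum>m | m \<in> A \<and> \<mu> m = \<nu>. ?c m))"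
  proof (rule sum.cong)
    fix \<nu>
    have add: "(\<Sum>m\<in>B. single (r \<nu>) (?c m)) = single (r \<nu>) (\<Sum>m\<in>B. ?c m)" for B
      by (induction B rule: infinite_finite_induct) (auto simp: single_add)
    have "(\<Sum>m | m \<in> A \<and> \<mu> m = \<nu>. single (r (\<mu> m)) (?c m)) =
      (\<Sum>m | m \<in> A \<and> \<mu> m = \<nu>. single (r \<nu>) (?c m))"
      by (rule sum.cong) auto
    then show "(\<Sum>m | m \<in> A \<and> \<mu> m = \<nu>. single (r (\<mu> m)) (?c m)) =
      single (r \<nu>) (\<Sum>m | m \<in> A \<and> \<mu> m = \<nu>. ?c m)"
      unfolding add .
  qed simp
  also have "\<dots> = 0" by (simp add: fib)
  finally have rep0: "(\<Sum>m\<in>A. single (r (\<mu> m)) (?c m)) = 0" .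
  have cong: "single m (?c m) - single (r (\<mu> m)) (?c m) \<in> (P_ideal G T :: ('v, 'k) vpoly set)"
    if m: "m \<in> A" for m
  proof (rule monomials_congruent[OF T])
    have g: "generic_exp T m = generic_exp T (r (\<mu> m))" using r[OF m] by (simp add: \<mu>_def)
    have in_f: "m \<in> keys f" "r (\<mu> m) \<in> keys f" using r[OF m] m by (auto simp: A_def)
    show "mdeg m = mdeg (r (\<mu> m))"
    proof
      fix v show "mdeg m v = mdeg (r (\<mu> m)) v"
      proof (cases "v \<in> V")
        case True
        then show ?thesis using g by (metis lookup_generic_exp(1))
      next
        case False
        then have "XVar v \<notin> keys x \<and> YVar v \<notin> keys x" if "x \<in> keys f" for x
          using keys[OF that] by auto
        then show ?thesis using in_f by (simp add: mdeg_def in_keys_iff)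
      qed
    qed
    show "(\<Sum>w | w \<in> V \<and> comp_label T w = comp_label T v. lookup m (YVar w)) =
             (\<Sum>w | w \<in> V \<and> comp_label T w = comp_label T v. lookup (r (\<mu> m)) (YVar w))" for v
      using g lookup_generic_exp(2) by metis
  qed (use m keys in \<open>auto simp: A_def\<close>)
  have "f = (\<Sum>m\<in>keys f. single m (?c m))" by (rule poly_mapping_sum_singles)
  also have "\<dots> = (\<Sum>m\<in>keys f - A. single m (?c m)) + (\<Sum>m\<in>A. single m (?c m))"
    by (rule sum.subset_diff) (auto simp: A_def)
  also have "(\<Sum>m\<in>A. single m (?c m)) =
      (\<Sum>m\<in>A. single m (?c m) - single (r (\<mu> m)) (?c m))"
    by (simp add: sum_subtractf rep0)
  finally have f_eq: "f = (\<Sum>m\<in>keys f - A. single m (?c m)) +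
      (\<Sum>m\<in>A. single m (?c m) - single (r (\<mu> m)) (?c m))" .
  have "(\<Sum>m\<in>keys f - A. single m (?c m)) \<in> (P_ideal G T :: ('v, 'k) vpoly set)"
  proof (rule P_sum[OF T])
    fix m assume m: "m \<in> keys f - A"
    then obtain v where "v \<in> T" "mdeg m v > 0" by (auto simp: A_def)
    then show "single m (?c m) \<in> (P_ideal G T :: ('v, 'k) vpoly set)"
      using m keys by (intro monomial_in_P[OF T]) auto
  qed
  moreover have "(\<Sum>m\<in>A. single m (?c m) - single (r (\<mu> m)) (?c m)) \<in> (P_ideal G T :: ('v,
      'k) vpoly set)"
    by (rule P_sum[OF T cong])
  ultimately show "f \<in> P_ideal G T" by (subst f_eq) (rule P_add[OF T])
qed (use ev_generic_point_P[OF T] in blast)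

lemma xv_notin_P: "T \<subseteq> V \<Longrightarrow> a \<in> V - T \<Longrightarrow> xv a \<notin> P_ideal G T"
  by (simp add: P_ideal_kernel ev_xv generic_point_def label_vec_nonzero)

lemma br_notin_P:
  assumes "T \<subseteq> V" "a \<in> V - T" "b \<in> V - T" "\<not> conn (V - T) a b"
  shows "br a b \<notin> (P_ideal G T :: ('v, 'k::field) vpoly set)"
proof -
  have "det2 (generic_point T a) (generic_point T b) =
    indet (3 * to_nat a + 2) * indet (3 * to_nat b +
        2) * det2 (label_vec (comp_label T a)) (label_vec (comp_label T b) :: 'k coord \<times> 'k coord)"
    using assms by (simp add: det2_def generic_point_def algebra_simps)
  moreover have "det2 (label_vec (comp_label T a)) (label_vec (comp_label T b)) \<noteq> (0 :: 'k coord)"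
    using assms by (intro det2_label_vec) (simp add: comp_label_eq_iff)
  ultimately show ?thesis
    using assms by (simp add: P_ideal_kernel ev_br)
qed

lemma P_ideal_mult_iff:
  assumes "T \<subseteq> V" "f \<in> carrier (poly_ring V)" "g \<in> carrier (poly_ring V)"
  shows "f * g \<in> P_ideal G T \<longleftrightarrow> f \<in> P_ideal G T \<or> g \<in> P_ideal G T"
  using assms by (simp add: P_ideal_kernel ev_mult)

lemma one_notin_P: "T \<subseteq> V \<Longrightarrow> 1 \<notin> (P_ideal G T :: ('v, 'k::field) vpoly set)"
proof -
  have "ev V (generic_point T) (1 :: ('v, 'k) vpoly) = 1"
    using ev_single[of V "generic_point T" 0 "1 :: 'k"] by simp
  then show "T \<subseteq> V \<Longrightarrow> 1 \<notin> (P_ideal G T :: ('v, 'k::field) vpoly set)" by (simp add: P_ideal_kernel)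
qed

lemma prime_P:
  assumes "T \<subseteq> V"
  shows "primeideal (P_ideal G T :: ('v, 'k::field) vpoly set) (poly_ring V)"
proof (rule primeidealI)
  show "ideal (P_ideal G T :: ('v, 'k) vpoly set) (poly_ring V)" by (rule ideal_P[OF assms])
  show "cring (poly_ring V :: ('v, 'k) vpoly ring)" by (rule cring_poly_ring)
  show "carrier (poly_ring V) \<noteq> (P_ideal G T :: ('v, 'k) vpoly set)"
    using one_notin_P[OF assms] carr_one by blast
qed (simp add: poly_ring_ops P_ideal_mult_iff[OF assms])


section \<open>Certificates and witnesses for local v-numbers\<close>

text \<open>
  A certificate realizes \<open>P\<^sub>T\<close> as a colon ideal of \<open>J\<close>; this is the source of all upper bounds.
\<close>

definition certificate :: "'v set \<Rightarrow> nat \<Rightarrow> ('v, 'k::field) vpoly \<Rightarrow> bool" where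
  "certificate T d g \<longleftrightarrow> g \<in> carrier (poly_ring V) \<and> homogeneous d g \<and> g \<notin> P_ideal G T \<and>
     (\<forall>p\<in>cut_gens T. g * p \<in> JG)"

text \<open>
  The part of the condition \<open>J : f = P\<^sub>T\<close> that passes to a component of \<open>f\<close> in the grading by vertices;
  this is the source of all lower bounds.
\<close>

definition witness :: "'v set \<Rightarrow> ('v \<Rightarrow> nat) \<Rightarrow> ('v, 'k::field) vpoly \<Rightarrow> bool" where
  "witness T \<alpha> f \<longleftrightarrow> f \<in> carrier (poly_ring V) \<and> mhom \<alpha> f \<and> f \<notin> P_ideal G T \<and>
     (\<forall>p\<in>cut_gens T. f * p \<in> JG)"

lemma mult_P_subset_JG:
  fixes f q :: "('v, 'k::field) vpoly"
  assumes "T \<subseteq> V" "f \<in> carrier (poly_ring V)" "\<forall>p\<in>cut_gens T. f * p \<in> JG" "q \<in> P_ideal G T"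
  shows "f * q \<in> JG"
  using assms(4) unfolding P_ideal_span[OF assms(1)]
proof (induction rule: ideal_span.induct)
  case span_zero
  then show ?case by (simp add: JG_zero)
next
  case (span_step h g m c)
  have "f * (h + single m c * g) = f * h + single m c * (f * g)"
    by (simp add: distrib_left mult.left_commute)
  also have "\<dots> \<in> JG"
  proof (rule JG_add)
    show "f * h \<in> JG" using span_step by simp
    show "single m c * (f * g) \<in> JG"
      by (rule JG_mult) (use span_step assms(3) in auto)
  qed
  finally show ?case .
qed

text \<open>
  As \<open>J \<subseteq> P\<^sub>T\<close> and \<open>P\<^sub>T\<close> is prime, \<open>h g \<in> J\<close> forces \<open>h \<in> P\<^sub>T\<close>.
\<close>

lemma colon_certificate:
  fixes g :: "('v, 'k::field) vpoly"
  assumes T: "T \<subseteq> V" and g: "certificate T d g"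
  shows "colon (poly_ring V) JG g = P_ideal G T"
proof (intro subset_antisym subsetI)
  fix h :: "('v, 'k) vpoly" assume h: "h \<in> colon (poly_ring V) JG g"
  then have "h * g \<in> P_ideal G T" using JG_subset_P[OF T] by (auto simp: colon_def poly_ring_ops)
  then show "h \<in> P_ideal G T" using h g P_ideal_mult_iff[OF T] by (auto simp: colon_def certificate_def)
next
  fix h :: "('v, 'k) vpoly" assume h: "h \<in> P_ideal G T"
  then have "g * h \<in> JG" using g mult_P_subset_JG[OF T] by (auto simp: certificate_def)
  then show "h \<in> colon (poly_ring V) JG g"
    using P_carr[OF T h] by (simp add: colon_def poly_ring_ops mult.commute)
qed

text \<open>If \<open>J : f = P\<^sub>T\<close>, then \<open>f\<close> lies outside \<open>P\<^sub>T\<close>: otherwise a certificate \<open>g\<close> would satisfy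
  \<open>g f \<in> J\<close>, hence \<open>g \<in> J : f = P\<^sub>T\<close>. Then some component of \<open>f\<close> in the
  grading by vertices lies outside \<open>P\<^sub>T\<close> too, and it still multiplies \<open>P\<^sub>T\<close> into the multigraded
  ideal \<open>J\<close>.\<close>

lemma witness_of_colon:
  fixes f g :: "('v, 'k::field) vpoly"
  assumes T: "T \<subseteq> V" and g: "certificate T e g"
    and f: "f \<in> carrier (poly_ring V)" "homogeneous d f" "colon (poly_ring V) JG f = P_ideal G T"
  obtains \<alpha> h where "witness T \<alpha> (h :: ('v, 'k) vpoly)" "(\<Sum>v\<in>V. \<alpha> v) = d"
proof -
  have fP: "f \<notin> P_ideal G T"
  proof
    assume "f \<in> P_ideal G T"
    then have "g * f \<in> JG" using g mult_P_subset_JG[OF T] by (auto simp: certificate_def)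
    then have "g \<in> colon (poly_ring V) JG f" using g
      by (simp add: colon_def certificate_def poly_ring_ops)
    then show False using f(3) g by (simp add: certificate_def)
  qed
  have "\<exists>\<alpha>. mpart \<alpha> f \<notin> P_ideal G T"
  proof (rule ccontr)
    assume "\<not> ?thesis"
    then have "(\<Sum>\<alpha>\<in>mdeg ` keys f. mpart \<alpha> f) \<in> P_ideal G T" by (intro P_sum[OF T]) auto
    then show False using fP sum_mpart[of f] by simp
  qed
  then obtain \<alpha> where \<alpha>: "mpart \<alpha> f \<notin> P_ideal G T" by blast
  have mult: "mpart \<alpha> f * p \<in> JG" if p: "p \<in> cut_gens T" for p
  proof -
    have "\<exists>\<beta>. mhom \<beta> p" using p unfolding cut_gens_def by (auto intro: mhom_xv mhom_yv mhom_br)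
    then obtain \<beta> where \<beta>: "mhom \<beta> p" by blast
    have "p \<in> colon (poly_ring V) JG f" using p P_gen[OF T] f(3) by blast
    then have "f * p \<in> JG" by (simp add: colon_def poly_ring_ops mult.commute)
    then have "mpart (\<lambda>v. \<alpha> v + \<beta> v) (f * p) \<in> JG"
      unfolding JG_span by (rule ideal_span_mpart[rotated]) (auto intro: mhom_br)
    then show ?thesis by (simp add: mpart_mult_mhom[OF \<beta>])
  qed
  have "mpart \<alpha> f \<noteq> 0" using \<alpha> P_zero[OF T] by auto
  then have "(\<Sum>v\<in>V. \<alpha> v) = d"
    using f by (intro homogeneous_degree_mhom[of "mpart \<alpha> f"] mpart_carr mhom_mpart
        homogeneous_mpart) auto
  moreover have "witness T \<alpha> (mpart \<alpha> f)"
    using \<alpha> mult f by (simp add: witness_def mpart_carr mhom_mpart)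
  ultimately show ?thesis using that by blast
qed

lemma v_local_eqI:
  fixes g :: "('v, 'k::field) vpoly"
  assumes T: "T \<subseteq> V" and g: "certificate T d g" and lower: "\<And>\<alpha> f. witness T \<alpha> (f :: ('v,
      'k) vpoly) \<Longrightarrow> d \<le> (\<Sum>v\<in>V. \<alpha> v)"
  shows "v_local V (JG :: ('v, 'k) vpoly set) (P_ideal G T) = d"
  unfolding v_local_def
proof (rule cInf_eq_minimum)
  show "d \<in> {d. \<exists>f\<in>carrier (poly_ring V). homogeneous d f \<and>
      colon (poly_ring V) (JG :: ('v, 'k) vpoly set) f = P_ideal G T}"
    using g colon_certificate[OF T g] by (auto simp: certificate_def)
next
  fix e assume "e \<in> {d. \<exists>f\<in>carrier (poly_ring V). homogeneous d f \<and>
      colon (poly_ring V) (JG :: ('v, 'k) vpoly set) f = P_ideal G T}"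
  then obtain f :: "('v, 'k) vpoly" where "f \<in> carrier (poly_ring V)" "homogeneous e f"
      "colon (poly_ring V) JG f = P_ideal G T"
    by blast
  then show "d \<le> e" using witness_of_colon[OF T g] lower by metis
qed

lemma v_local_geI:
  fixes g :: "('v, 'k::field) vpoly"
  assumes T: "T \<subseteq> V" and g: "certificate T d g" and lower: "\<And>\<alpha> f. witness T \<alpha> (f :: ('v,
      'k) vpoly) \<Longrightarrow> e \<le> (\<Sum>v\<in>V. \<alpha> v)"
  shows "e \<le> v_local V (JG :: ('v, 'k) vpoly set) (P_ideal G T)"
  unfolding v_local_def
proof (rule cInf_greatest)
  show "{d. \<exists>f\<in>carrier (poly_ring V). homogeneous d f \<and>
      colon (poly_ring V) (JG :: ('v, 'k) vpoly set) f = P_ideal G T} \<noteq> {}"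
    using g colon_certificate[OF T g] by (auto simp: certificate_def)
next
  fix c assume "c \<in> {d. \<exists>f\<in>carrier (poly_ring V). homogeneous d f \<and>
      colon (poly_ring V) (JG :: ('v, 'k) vpoly set) f = P_ideal G T}"
  then obtain f :: "('v, 'k) vpoly" where "f \<in> carrier (poly_ring V)" "homogeneous c f"
      "colon (poly_ring V) JG f = P_ideal G T"
    by blast
  then show "e \<le> c" using witness_of_colon[OF T g] lower by metis
qed

section \<open>What a witness must satisfy\<close>

text \<open>
  A monomial that involves a vertex of \<open>T\<close> lies in \<open>P\<^sub>T\<close>.
\<close>

lemma witness_outside:
  fixes f :: "('v, 'k::field) vpoly"
  assumes T: "T \<subseteq> V" and w: "witness T \<alpha> f" and v: "v \<in> T"
  shows "\<alpha> v = 0"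
proof (rule ccontr)
  assume a: "\<alpha> v \<noteq> 0"
  have "ev V (generic_point T) f = 0"
    unfolding ev_def
  proof (rule sum.neutral, rule ballI)
    fix m assume "m \<in> keys f"
    then have "mdeg m v \<noteq> 0" using w a by (auto simp: witness_def mhom_def)
    then have "fst (generic_point T v) ^ lookup m (XVar v) * snd (generic_point T v) ^ lookup m
        (YVar v) = (0 :: 'k coord)"
      using v by (auto simp: mdeg_def generic_point_def zero_power)
    then have "mono_val V (generic_point T) m = (0 :: 'k coord)"
      unfolding mono_val_def using v T by (intro prod_zero) auto
    then show "single 0 (lookup f m) * mono_val V (generic_point T) m = 0" by simp
  qed
  then show False using w T P_ideal_kernel by (auto simp: witness_def)
qed

text \<open>
  The scalars of the vertices in the generic point of \<open>T\<close> factor out of a multihomogeneous polynomial,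
  so its nonvanishing is already visible at the point that only records the components.
\<close>

lemma witness_nonzero:
  fixes f :: "('v, 'k::field) vpoly"
  assumes T: "T \<subseteq> V" and w: "witness T \<alpha> f"
  shows "ev V (\<lambda>v. label_vec (comp_label T v)) f \<noteq> 0"
proof
  assume "ev V (\<lambda>v. label_vec (comp_label T v)) f = 0"
  then have "ev V (\<lambda>v. (indet (3 * to_nat v + 2) * fst (label_vec (comp_label T v)),
      indet (3 * to_nat v + 2) * snd (label_vec (comp_label T v)))) f = 0"
    using w ev_scale[of \<alpha> f V "\<lambda>v. indet (3 * to_nat v + 2)" "\<lambda>v. label_vec (comp_label T v)"]
      by (simp add: witness_def)
  moreover have "ev V (generic_point T) f = ev V (\<lambda>v. (indet (3 * to_nat v +
      2) * fst (label_vec (comp_label T v)), indet (3 * to_nat v +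
          2) * snd (label_vec (comp_label T v)))) f"
    using w witness_outside[OF T w] by (intro ev_cong[of \<alpha>]) (auto simp: witness_def generic_point_def)
  ultimately show False using w T P_ideal_kernel by (auto simp: witness_def)
qed

text \<open>A vertex set \<open>U\<close> that contains a vertex of \<open>T\<close>, or that separates two vertices of one
  component of \<open>V - T\<close>, defines a prime that does not contain \<open>P\<^sub>T\<close>. A witness then lies in that
  prime: it vanishes at all points that are constant on the components of \<open>U\<close>.\<close>

lemma witness_vanishes:
  fixes f :: "('v, 'k::field) vpoly"
  assumes T: "T \<subseteq> V" and w: "witness T \<alpha> f" and U: "U \<subseteq> V" and supp: "\<And>v. v \<in> V \<Longrightarrow> \<alpha> v \<noteq> 0 \<Longrightarrow> v \<in> U"
    and sep: "T \<inter> U \<noteq> {} \<or> (\<exists>a\<in>U - T. \<exists>b\<in>U - T. conn (V - T) a b \<and> \<not> conn U a b)"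
    and Z: "\<And>a b. a \<in> U \<Longrightarrow> b \<in> U \<Longrightarrow> adj a b \<Longrightarrow> Z a = Z b"
  shows "ev V Z f = 0"
proof -
  have compl: "V - (V - U) = U" and VU: "V - U \<subseteq> V" using U by auto
  obtain p where p: "p \<in> (cut_gens T :: ('v, 'k) vpoly set)" "p \<notin> P_ideal G (V - U)"
  proof (cases "T \<inter> U = {}")
    case False
    then obtain k where k: "k \<in> T" "k \<in> U" by blast
    have "xv k \<in> (cut_gens T :: ('v, 'k) vpoly set)" using k by (simp add: cut_gens_def)
    moreover have "xv k \<notin> (P_ideal G (V - U) :: ('v, 'k) vpoly set)"
      using xv_notin_P[OF VU, of k] k U by auto
    ultimately show ?thesis using that by blast
  next
    case True
    then obtain a b where ab: "a \<in> U - T" "b \<in> U - T" "conn (V - T) a b" "\<not> conn U a b" using sep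
      by blast
    have "br a b \<in> (cut_gens T :: ('v, 'k) vpoly set)"
      using ab U unfolding cut_gens_def by (intro UnI2 CollectI exI[of _ a] exI[of _ b]) auto
    moreover have "br a b \<notin> (P_ideal G (V - U) :: ('v, 'k) vpoly set)"
      using br_notin_P[OF VU, of a b] ab compl by auto
    ultimately show ?thesis using that by blast
  qed
  have "f * p \<in> P_ideal G (V - U)"
    using w p JG_subset_P[OF VU] by (auto simp: witness_def)
  moreover have "p \<in> carrier (poly_ring V)" "f \<in> carrier (poly_ring V)"
    using p cut_gens_carr[OF T] w by (auto simp: witness_def)
  ultimately have fP: "f \<in> ideal_span V (cut_gens (V - U))"
    using P_ideal_mult_iff[OF VU] p P_ideal_span[OF VU] by blast
  define Z' where "Z' = (\<lambda>v. if v \<in> U then Z v else (0, 0))"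
  have Zc: "Z b = Z a" if "conn U a b" for a b
    using that by (induction rule: conn_induct) (use Z in auto)
  have "ev V Z' p = 0" if "p \<in> cut_gens (V - U)" for p
  proof -
    have "det2 (Z' a) (Z' b) = 0" if "a \<in> U" "b \<in> U" "conn U a b" for a b
      using Zc[OF that(3)] that by (simp add: Z'_def)
    moreover have "Z' a = (0, 0)" if "a \<notin> U" for a using that by (simp add: Z'_def)
    ultimately show ?thesis
      using \<open>p \<in> cut_gens (V - U)\<close> U unfolding cut_gens_def compl
      by (auto simp: ev_xv ev_yv ev_br subset_iff)
  qed
  then have "ev V Z' f = 0" using ev_span_zero[OF fP] by blast
  moreover have "ev V Z' f = ev V Z f"
    using w supp by (intro ev_cong[of \<alpha>]) (auto simp: witness_def Z'_def)
  ultimately show ?thesis by simp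
qed

text \<open>If the neighbours of \<open>k\<close> in the support of the degree belonged to one component of \<open>V - T\<close>, the
  point that is constant on the components would extend over \<open>k\<close>, and the witness would vanish at it.\<close>

lemma witness_two_neighbours:
  assumes T: "T \<subseteq> V" and w: "witness T \<alpha> (f :: ('v, 'k::field) vpoly)" and k: "k \<in> T"
  obtains a b where "adj k a" "adj k b" "\<alpha> a \<noteq> 0" "\<alpha> b \<noteq> 0" "\<not> conn (V - T) a b"
proof (rule ccontr)
  note found = that
  assume no: "\<not> thesis"
  have same: "conn (V - T) a b" if "adj k a" "adj k b" "\<alpha> a \<noteq> 0" "\<alpha> b \<noteq> 0" for a b
    using no found[of a b] that by blast
  let ?S = "{v \<in> V. \<alpha> v \<noteq> 0}"
  have ST: "v \<in> V - T" if "v \<in> ?S" for v using that witness_outside[OF T w] by auto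
  define c where "c = (if \<exists>a\<in>?S. adj k a then comp_label T (SOME a. a \<in> ?S \<and> adj k a) else 0)"
  have c: "comp_label T a = c" if a: "a \<in> ?S" "adj k a" for a
  proof -
    let ?b = "SOME a. a \<in> ?S \<and> adj k a"
    have "?b \<in> ?S \<and> adj k ?b" by (rule someI[of "\<lambda>a. a \<in> ?S \<and> adj k a" a]) (use a in auto)
    then have "comp_label T a = comp_label T ?b" using same a comp_label_eq_iff by auto
    then show ?thesis using a by (auto simp: c_def)
  qed
  define Z where "Z = (\<lambda>v.
      if v = k then label_vec c else (label_vec (comp_label T v) :: 'k coord \<times> 'k coord))"
  have kS: "k \<notin> ?S" using ST k by blast
  have "ev V Z f = 0"
  proof (rule witness_vanishes[OF T w, of "insert k ?S"])
    fix a b assume ab: "a \<in> insert k ?S" "b \<in> insert k ?S" "adj a b"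
    show "Z a = Z b"
    proof (cases "a = k \<or> b = k")
      case True
      then show ?thesis using ab c adj_sym adj_V[OF ab(3)] by (auto simp: Z_def)
    next
      case False
      then have "conn (V - T) a b" using ab ST conn_adj by blast
      then have "comp_label T a = comp_label T b" by (simp add: comp_label_eq_iff)
      then show ?thesis using False by (simp add: Z_def)
    qed
  qed (use k T in auto)
  moreover have "ev V Z f = ev V (\<lambda>v. label_vec (comp_label T v)) f"
    using w kS by (intro ev_cong[of \<alpha>]) (auto simp: witness_def Z_def)
  ultimately show False using witness_nonzero[OF T w] by simp
qed

text \<open>
  If \<open>a\<close> were isolated in \<open>U\<close>, then \<open>U\<close> would separate \<open>a\<close> from \<open>b\<close>, and the witness would vanish at
  all points constant along the edges inside \<open>U\<close>. The point that is constant on the components of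
  \<open>V - T\<close> is one of them, but there the witness is nonzero.
\<close>

lemma witness_not_isolated:
  assumes T: "T \<subseteq> V" and w: "witness T \<alpha> (f :: ('v, 'k::field) vpoly)" and U: "U \<subseteq> V - T"
    and supp: "\<And>v. v \<in> V \<Longrightarrow> \<alpha> v \<noteq> 0 \<Longrightarrow> v \<in> U"
    and ab: "a \<in> U" "b \<in> U" "a \<noteq> b" "conn (V - T) a b"
  obtains c where "c \<in> U" "adj a c"
proof (rule ccontr)
  note found = that
  assume no: "\<not> thesis"
  have iso: "\<not> adj a c" if "c \<in> U" for c using no found[of c] that by blast
  have "\<not> conn U a b"
    using conn_closed[of U a b "{a}"] iso ab by blast
  then have sep: "\<exists>a\<in>U - T. \<exists>b\<in>U - T. conn (V - T) a b \<and> \<not> conn U a b" using ab U by blast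
  have "comp_label T x = comp_label T y" if "x \<in> U" "y \<in> U" "adj x y" for x y
    unfolding comp_label_eq_iff using that U by (intro conn_adj) auto
  then have "ev V (\<lambda>v. label_vec (comp_label T v)) f = 0"
    using U supp sep by (intro witness_vanishes[OF T w, of U]) auto
  then show False using witness_nonzero[OF T w] by simp
qed

lemma witness_linear_zero:
  assumes "witness T \<alpha> f" "a \<in> V" "\<alpha> a \<le> 1" "det2 p q \<noteq> 0" "ev V (Z(a := p)) f = 0"
      "ev V (Z(a := q)) f = 0"
  shows "ev V Z f = 0"
  using ev_linear_zero[of V a \<alpha> f p q Z "Z a"] assms by (simp add: witness_def)

lemma witness_cong:
  assumes "witness T \<alpha> f" "\<And>v. v \<in> V \<Longrightarrow> \<alpha> v \<noteq> 0 \<Longrightarrow> Z v = Z' v"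
  shows "ev V Z f = ev V Z' f"
  using assms(1) ev_cong[of \<alpha> f V Z Z', OF _ assms(2)] by (auto simp: witness_def)

section \<open>Multiplying brackets into the binomial edge ideal\<close>

text \<open>
  The condition on a certificate \<open>g\<close> that comes from a vertex \<open>k \<in> T\<close>.
\<close>

definition kill :: "('v, 'k::field) vpoly \<Rightarrow> 'v \<Rightarrow> bool" where
  "kill g k \<longleftrightarrow> xv k * g \<in> JG \<and> yv k * g \<in> JG"

lemma kill_br:
  assumes "adj k a" "adj k b"
  shows "kill (br a b) k"
proof -
  have V: "a \<in> V" "b \<in> V" "k \<in> V" using assms adj_V by auto
  have "br k b \<in> JG" "br a k \<in> JG" using assms JG_edge adj_sym by blast+
  then show ?thesis
    unfolding kill_def br_plucker_x[of k a b] br_plucker_y[of k a b]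
    by (intro conjI JG_add JG_mult) (use V in auto)
qed

lemma kill_mult: "kill g k \<Longrightarrow> r \<in> carrier (poly_ring V) \<Longrightarrow> kill (r * g) k"
  unfolding kill_def mult.left_commute[of _ r] using JG_mult[of _ r] by auto

text \<open>A vertex \<open>k\<close> that misses \<open>a\<close> is handled by exchanging \<open>a\<close> with \<open>b\<close>, which costs a connection
  of \<open>a\<close> and \<open>b\<close> through \<open>c\<close>.\<close>

lemma kill_exchange:
  assumes "adj k o'" "adj k b" "adj c a" "adj c b"
  shows "kill (xv c * (xv b * br o' a) :: ('v, 'k::field) vpoly) k"
proof -
  have V: "a \<in> V" "b \<in> V" "k \<in> V" "c \<in> V" "o' \<in> V" using assms adj_V by auto
  have "kill (br b a :: ('v, 'k) vpoly) c" using kill_br assms by blast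
  then have "xv c * br b a \<in> (JG :: ('v, 'k) vpoly set)" by (simp add: kill_def)
  then have 1: "r * (xv c * br b a) \<in> (JG :: ('v, 'k) vpoly set)" if "r \<in> carrier (poly_ring V)" for r
    using that JG_mult by blast
  have "kill (br o' b :: ('v, 'k) vpoly) k" using kill_br assms by blast
  then have 2: "r * (xv k * br o' b) \<in> (JG :: ('v, 'k) vpoly set)"
      "r * (yv k * br o' b) \<in> (JG :: ('v, 'k) vpoly set)"
    if "r \<in> carrier (poly_ring V)" for r
    using that JG_mult by (auto simp: kill_def)
  have "xv k * (xv c * (xv b * br o' a :: ('v, 'k) vpoly)) = (xv k * xv o') * (xv c * br b a) +
      (xv c * xv a) * (xv k * br o' b)"
    "yv k * (xv c * (xv b * br o' a :: ('v, 'k) vpoly)) = (yv k * xv o') * (xv c * br b a) +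
        (xv c * xv a) * (yv k * br o' b)"
    by (simp_all add: br_def algebra_simps)
  then show ?thesis
    unfolding kill_def by (auto intro!: JG_add 1 2 simp: V)
qed

text \<open>
  If a path meets \<open>s\<close>, then its part after the last visit to \<open>s\<close> avoids \<open>s\<close>.
\<close>

lemma conn_avoid:
  assumes "conn S x y" "s \<noteq> y"
  shows "conn (S - {s}) x y \<or> (\<exists>t\<in>S - {s}. adj s t \<and> conn (S - {s}) t y)"
proof -
  have "conn S y x" using assms conn_sym by blast
  then have "conn (S - {s}) x y \<or> (\<exists>t\<in>S - {s}. adj s t \<and> conn (S - {s}) t y)"
  proof (induction rule: conn_induct)
    case (step b c)
    show ?case
    proof (cases "\<exists>t\<in>S - {s}. adj s t \<and> conn (S - {s}) t y")
      case False
      then have b: "conn (S - {s}) b y" using step by blast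
      then have bs: "b \<noteq> s" using conn_in[OF b] assms by auto
      show ?thesis
      proof (cases "c = s")
        case True
        then have "adj s b" "b \<in> S - {s}" using bs step adj_sym[of b c] by auto
        then show ?thesis using b by blast
      next
        case False
        then have "conn (S - {s}) c b" using step bs adj_sym[of b c] by (intro conn_adj) auto
        then show ?thesis using b conn_trans by blast
      qed
    qed blast
  qed simp
  then show ?thesis .
qed

text \<open>A connected set \<open>S\<close> adjacent to \<open>a\<close> and \<open>b\<close> connects them by a simple path with interior in \<open>S\<close>,
  and the Pluecker relation shortens the path by one vertex at the cost of the factor \<open>x\<^sub>s\<close>.\<close>

lemma prod_br_in_JG:
  assumes "S \<subseteq> V" "s \<in> S" "adj a s" "adj b s'" "conn S s s'"
  shows "(\<Prod>u\<in>S. xv u) * br a b \<in> (JG :: ('v, 'k::field) vpoly set)"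
  using assms
proof (induction "card S" arbitrary: S s a rule: less_induct)
  case less
  have fin: "finite S" using less.prems finite_subset finV by blast
  have V: "a \<in> V" "b \<in> V" "s \<in> V" using less.prems adj_V by auto
  have prod: "(\<Prod>u\<in>S. xv u) = xv s * (\<Prod>u\<in>S - {s}. xv u :: ('v, 'k) vpoly)"
    using fin less.prems by (simp add: prod.remove)
  have carr: "(\<Prod>u\<in>S - {s}. xv u :: ('v, 'k) vpoly) \<in> carrier (poly_ring V)"
    using less.prems by (intro carr_prod carr_xv) auto
  show ?case
  proof (cases "s = s'")
    case True
    have "kill (br a b :: ('v, 'k) vpoly) s" using less.prems True adj_sym by (intro kill_br) auto
    then have "(\<Prod>u\<in>S - {s}. xv u) * (xv s * br a b :: ('v, 'k) vpoly) \<in> JG"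
      using carr JG_mult by (auto simp: kill_def)
    then show ?thesis by (simp add: prod mult_ac)
  next
    case False
    then obtain t where t: "t \<in> S - {s}" "adj s t" "conn (S - {s}) t s'"
      using conn_avoid[OF less.prems(5) False] conn_in[of "S - {s}" s s'] by blast
    have "(\<Prod>u\<in>S - {s}. xv u) * br s b \<in> (JG :: ('v, 'k) vpoly set)"
      using less.prems t card_Diff1_less[OF fin less.prems(2)]
      by (intro less.hyps[of "S - {s}" t s]) auto
    then have 1: "xv a * ((\<Prod>u\<in>S - {s}. xv u) * br s b) \<in> (JG :: ('v, 'k) vpoly set)"
      by (rule JG_mult) (use V in auto)
    have "br a s \<in> (JG :: ('v, 'k) vpoly set)" using less.prems JG_edge by blast
    then have 2: "((\<Prod>u\<in>S - {s}. xv u) * xv b) * br a s \<in> (JG :: ('v, 'k) vpoly set)"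
      using V carr by (intro JG_mult) auto
    have "(\<Prod>u\<in>S. xv u) * br a b = (\<Prod>u\<in>S - {s}. xv u) * (xv s * br a b :: ('v, 'k) vpoly)"
      by (simp add: prod mult_ac)
    also have "\<dots> = xv a * ((\<Prod>u\<in>S - {s}. xv u) * br s b) + ((\<Prod>u\<in>S - {s}. xv u) * xv b) * br a s"
      unfolding br_plucker_x[of s a b] by (simp add: algebra_simps)
    finally show ?thesis using JG_add[OF 1 2] by simp
  qed
qed

section \<open>Minimal primes\<close>

text \<open>
  Every step of a path from \<open>a\<close> to \<open>b\<close> multiplies by the variable \<open>x\<close> of the vertex that is left, which
  lies outside the prime of \<open>V - U\<close>.
\<close>

lemma conn_monomial:
  assumes "conn U a b" "U \<subseteq> V" "a \<in> U"
  shows "\<exists>d g. g \<in> carrier (poly_ring V) \<and> homogeneous d g \<and> g \<notin> P_ideal G (V - U) \<and>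
    g * br a b \<in> (JG :: ('v, 'k::field) vpoly set)"
  using assms(1)
proof (induction rule: conn_induct)
  case base
  have "1 \<notin> (P_ideal G (V - U) :: ('v, 'k) vpoly set)" by (rule one_notin_P) auto
  then show ?case using homogeneous_one by (intro exI[of _ 0] exI[of _ 1]) (auto simp: JG_zero)
next
  case (step b c)
  then obtain d g where g: "(g :: ('v, 'k) vpoly) \<in> carrier (poly_ring V)" "homogeneous d g"
      "g \<notin> P_ideal G (V - U)"
      "g * br a b \<in> JG" by blast
  have V: "a \<in> V" "b \<in> V" "c \<in> V" using assms step by auto
  have "(g * xv b) * br a c = (g * xv a) * br b c + xv c * (g * br a b)"
    by (simp add: br_def algebra_simps)
  then have "(g * xv b) * br a c \<in> JG"
    using g V JG_edge[OF step.hyps(2)] by (auto intro!: JG_add JG_mult)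
  moreover have "g * xv b \<notin> P_ideal G (V - U)"
    using g V step xv_notin_P[of "V - U" b] by (subst P_ideal_mult_iff) auto
  ultimately show ?case
    using g V homogeneous_mult[OF g(2) homogeneous_xv[of b]]
    by (intro exI[of _ "d + 1"] exI[of _ "g * xv b"]) auto
qed

text \<open>
  The form in which the cut point property is used: returning \<open>i\<close> to the graph merges components.
\<close>

definition joins_components :: "'v set \<Rightarrow> bool" where
  "joins_components T \<longleftrightarrow> (\<forall>i\<in>T. \<exists>a\<in>V - T. \<exists>b\<in>V - T. adj i a \<and> adj i b \<and> \<not> conn (V - T) a b)"

lemma finite_cut_gens: "T \<subseteq> V \<Longrightarrow> finite (cut_gens T :: ('v, 'k::field) vpoly set)"
proof -
  assume T: "T \<subseteq> V"
  have "cut_gens T \<subseteq> xv ` V \<union> yv ` V \<union> (\<lambda>(a, b). br a b) ` (V \<times> V)"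
    using T unfolding cut_gens_def by auto
  then show ?thesis by (rule finite_subset) simp
qed

text \<open>
  Every generator has a factor that moves it into \<open>J\<close>: for \<open>x\<^sub>i\<close> and \<open>y\<^sub>i\<close> the bracket of two neighbours of
  \<open>i\<close> in different components, for a bracket inside a component the variables along a path. The
  factors lie outside the prime \<open>P\<^sub>T\<close>, hence so does their product.
\<close>

lemma certificate_exists:
  assumes T: "T \<subseteq> V" and cut: "joins_components T"
  shows "\<exists>d (g :: ('v, 'k::field) vpoly). certificate T d g"
proof -
  let ?ok = "\<lambda>d (g :: ('v, 'k) vpoly). g \<in> carrier (poly_ring V) \<and> homogeneous d g \<and> g \<notin> P_ideal G T"
  have one: "\<exists>d g. ?ok d g \<and> g * p \<in> JG" if p: "p \<in> cut_gens T" for p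
  proof -
    consider i where "i \<in> T" "p = xv i \<or> p = yv i"
      | a b where "a \<in> V - T" "conn (V - T) a b" "p = br a b"
      using p unfolding cut_gens_def by blast
    then show ?thesis
    proof cases
      case 1
      then obtain a b where ab: "a \<in> V - T" "b \<in> V - T" "adj i a" "adj i b" "\<not> conn (V - T) a b"
        using cut unfolding joins_components_def by blast
      have "br a b * p \<in> JG" using kill_br[OF ab(3,4)] 1 by (auto simp: kill_def mult.commute)
      moreover have "?ok 2 (br a b)" using ab br_notin_P[OF T] homogeneous_br by auto
      ultimately show ?thesis by blast
    next
      case 2
      have "V - (V - T) = T" using T by blast
      then show ?thesis using conn_monomial[OF 2(2), where ?'k = 'k] 2 by auto
    qed
  qed
  have "\<exists>d g. ?ok d g \<and> (\<forall>p\<in>A. g * p \<in> JG)" if "finite A" "A \<subseteq> cut_gens T" for A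
    using that
  proof (induction A)
    case empty
    then show ?case using one_notin_P[OF T] homogeneous_one by (intro exI[of _ 0] exI[of _ 1]) auto
  next
    case (insert p A)
    then obtain d g where g: "?ok d g" "\<forall>p\<in>A. g * p \<in> JG" by auto
    obtain e h where h: "?ok e h" "h * p \<in> JG" using one insert by blast
    have "(g * h) * q \<in> JG" if "q \<in> insert p A" for q
    proof (cases "q = p")
      case True
      then show ?thesis using JG_mult[of "h * p" g] g h by (simp add: mult.assoc)
    next
      case False
      then have "h * (g * q) \<in> JG" using JG_mult g h that by blast
      then show ?thesis by (simp add: mult_ac)
    qed
    moreover have "?ok (d + e) (g * h)"
      using g h P_ideal_mult_iff[OF T] homogeneous_mult by auto
    ultimately show ?case by blast
  qed
  from this[OF finite_cut_gens[OF T] subset_refl] show ?thesis by (auto simp: certificate_def)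
qed

text \<open>A prime \<open>P \<supseteq> J\<close> contains \<open>P\<^sub>T\<close> for \<open>T = {i. x\<^sub>i, y\<^sub>i \<in> P}\<close>: along a path that avoids \<open>T\<close> the
  Pluecker relation can be divided by \<open>x\<^sub>b\<close> or \<open>y\<^sub>b\<close>. If the neighbours of some \<open>i \<in> T\<close> outside \<open>T\<close> lie
  in one component, then \<open>P\<^bsub>T - {i}\<^esub>\<close> is a smaller prime.\<close>

lemma min_prime_is_P_ideal:
  fixes P :: "('v, 'k::field) vpoly set"
  assumes P: "P \<in> min_primes (poly_ring V) JG"
  obtains T where "T \<subseteq> V" "P = P_ideal G T" "joins_components T"
proof -
  have prime: "primeideal P (poly_ring V)" and JP: "JG \<subseteq> P"
    and minimal: "\<And>Q. primeideal Q (poly_ring V) \<Longrightarrow> JG \<subseteq> Q \<Longrightarrow> Q \<subseteq> P \<Longrightarrow> Q = P"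
    using P by (auto simp: min_primes_def)
  have idl: "ideal P (poly_ring V)" using prime primeideal.axioms(1) by blast
  note D = ideal_poly_ringD[OF idl]
  have pr: "f \<in> P \<or> g \<in> P" if "f * g \<in> P" "f \<in> carrier (poly_ring V)" "g \<in> carrier (poly_ring V)"
      for f g
    using primeideal.I_prime[OF prime that(2,3)] that(1) by (simp add: poly_ring_ops)
  define T where "T = {i \<in> V. xv i \<in> P \<and> yv i \<in> P}"
  have T: "T \<subseteq> V" by (auto simp: T_def)
  have br_in: "br a b \<in> P" if "conn (V - T) a b" "a \<in> V - T" for a b
    using that(1)
  proof (induction rule: conn_induct)
    case base
    then show ?case using D(1) by simp
  next
    case (step b c)
    have V: "a \<in> V" "b \<in> V" "c \<in> V" "b \<notin> T" using step that by auto
    have bc: "br b c \<in> P" using JG_edge[OF step.hyps(2)] JP by blast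
    have "xv b * br a c \<in> P" "yv b * br a c \<in> P"
      unfolding br_plucker_x[of b a c] br_plucker_y[of b a c]
      using bc step V by (intro D(2) D(3); auto)+
    then show ?case using pr[of "xv b" "br a c"] pr[of "yv b" "br a c"] V by (auto simp: T_def)
  qed
  have gens: "p \<in> P" if "p \<in> cut_gens T" for p
    using that br_in unfolding cut_gens_def by (auto simp: T_def)
  have "P_ideal G T \<subseteq> P"
  proof
    fix f :: "('v, 'k) vpoly" assume "f \<in> P_ideal G T"
    then have "f \<in> ideal_span V (cut_gens T)" by (simp add: P_ideal_span[OF T])
    then show "f \<in> P"
      by (induction rule: ideal_span.induct) (auto intro!: D(1-3) intro: gens)
  qed
  then have PT: "P = P_ideal G T" using minimal[OF prime_P[OF T] JG_subset_P[OF T]] by simp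
  have "\<exists>a\<in>V - T. \<exists>b\<in>V - T. adj i a \<and> adj i b \<and> \<not> conn (V - T) a b" if i: "i \<in> T" for i
  proof (rule ccontr)
    assume "\<not> ?thesis"
    then have nb: "conn (V - T) a b" if "a \<in> V - T" "b \<in> V - T" "adj i a" "adj i b" for a b
      using that by blast
    let ?T = "T - {i}"
    have T': "?T \<subseteq> V" and VT': "V - ?T = insert i (V - T)" using T i by auto
    have reach: "(x \<noteq> i \<longrightarrow> conn (V - T) a x) \<and> (x = i \<longrightarrow> (\<exists>t\<in>V - T. adj i t \<and> conn (V - T) a t))"
      if "conn (insert i (V - T)) a x" "a \<in> V - T" for a x
      using that(1)
    proof (induction rule: conn_induct)
      case base
      then show ?case using that(2) i by auto
    next
      case (step b c)
      consider "b = i" "c \<in> V - T" "c \<noteq> i" | "b \<in> V - T" "b \<noteq> i" "c = i" | "b \<in> V - T" "c \<in> V - T"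
          "b \<noteq> i" "c \<noteq> i"
        using step adj_V[OF step.hyps(2)] i by auto
      then show ?case
      proof cases
        case 1
        then obtain t where t: "t \<in> V - T" "adj i t" "conn (V - T) a t" using step by blast
        then have "conn (V - T) t c" using nb 1 step by blast
        then show ?thesis using t 1 conn_trans by blast
      next
        case 2
        then show ?thesis using step adj_sym by blast
      next
        case 3
        then have "conn (V - T) b c" using step conn_adj by blast
        then show ?thesis using 3 step conn_trans by blast
      qed
    qed
    have xi: "xv i \<in> (P_ideal G T :: ('v, 'k) vpoly set)" "yv i \<in> (P_ideal G T :: ('v, 'k) vpoly set)"
      using i by (auto intro!: P_gen[OF T] simp: cut_gens_def)
    have "p \<in> P_ideal G T" if p: "p \<in> cut_gens ?T" for p :: "('v, 'k) vpoly"
    proof -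
      consider j where "j \<in> T" "p = xv j \<or> p = yv j"
        | a b where "a \<in> V - ?T" "b \<in> V - ?T" "a \<noteq> b" "conn (V - ?T) a b" "p = br a b"
        using p unfolding cut_gens_def by blast
      then show ?thesis
      proof cases
        case 1
        then show ?thesis using P_gen[OF T] by (auto simp: cut_gens_def)
      next
        case 2
        have V: "a \<in> V" "b \<in> V" using 2 by auto
        show ?thesis
        proof (cases "a = i \<or> b = i")
          case True
          have "xv a * yv b - xv b * yv a \<in> (P_ideal G T :: ('v, 'k) vpoly set)"
          proof (cases "a = i")
            case True
            have "yv b * xv i + (- xv b) * yv i \<in> (P_ideal G T :: ('v, 'k) vpoly set)"
              by (intro P_add[OF T] P_mult[OF T]) (use xi V in auto)
            then show ?thesis using True by (simp add: mult_ac)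
          next
            case False
            then have "(- yv a) * xv i + xv a * yv i \<in> (P_ideal G T :: ('v, 'k) vpoly set)"
              using xi V by (intro P_add[OF T] P_mult[OF T]) auto
            then show ?thesis using False True by (simp add: mult_ac)
          qed
          then show ?thesis using 2 by (simp add: br_def)
        next
          case False
          then have ab: "a \<in> V - T" "b \<in> V - T" using 2 by auto
          then have "conn (V - T) a b" using reach[of a b] 2 VT' False by auto
          then have "br a b \<in> (cut_gens T :: ('v, 'k) vpoly set)" using ab 2 unfolding cut_gens_def
            by blast
          then show ?thesis using 2 P_gen[OF T] by blast
        qed
      qed
    qed
    note gens' = this
    have "P_ideal G ?T \<subseteq> P"
    proof
      fix f :: "('v, 'k) vpoly" assume "f \<in> P_ideal G ?T"
      then have "f \<in> ideal_span V (cut_gens ?T)" by (simp add: P_ideal_span[OF T'])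
      then show "f \<in> P"
        unfolding PT by (induction rule: ideal_span.induct)
          (auto intro!: P_zero[OF T] P_add[OF T] P_mult[OF T] intro: gens')
    qed
    then have "P_ideal G ?T = P" using minimal[OF prime_P[OF T'] JG_subset_P[OF T']] by simp
    then have "xv i \<in> (P_ideal G ?T :: ('v, 'k) vpoly set)" using xi PT by simp
    then show False using xv_notin_P[OF T', of i] i T by auto
  qed
  then have "joins_components T" unfolding joins_components_def by blast
  then show ?thesis using that T PT by blast
qed

text \<open>
  A prime \<open>Q\<close> with \<open>J \<subseteq> Q \<subseteq> P\<^sub>T\<close> does not contain the certificate \<open>g\<close>, so \<open>g P\<^sub>T \<subseteq> J \<subseteq> Q\<close> gives \<open>P\<^sub>T \<subseteq> Q\<close>.
\<close>

lemma P_ideal_min_prime: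
  fixes g :: "('v, 'k::field) vpoly"
  assumes T: "T \<subseteq> V" and g: "certificate T d g"
  shows "(P_ideal G T :: ('v, 'k) vpoly set) \<in> min_primes (poly_ring V) JG"
  unfolding min_primes_def
proof (intro CollectI conjI allI impI)
  show "primeideal (P_ideal G T :: ('v, 'k) vpoly set) (poly_ring V)" by (rule prime_P[OF T])
  show "JG \<subseteq> (P_ideal G T :: ('v, 'k) vpoly set)" by (rule JG_subset_P[OF T])
  fix Q :: "('v, 'k) vpoly set"
  assume Q: "primeideal Q (poly_ring V) \<and> JG \<subseteq> Q \<and> Q \<subseteq> P_ideal G T"
  have "f \<in> Q" if f: "f \<in> P_ideal G T" for f
  proof -
    have "g * f \<in> Q" using mult_P_subset_JG[OF T] g f Q by (auto simp: certificate_def)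
    then have "g \<in> Q \<or> f \<in> Q"
      using primeideal.I_prime[of Q "poly_ring V" g f] Q g P_carr[OF T f]
        by (auto simp: certificate_def poly_ring_ops)
    then show ?thesis using g Q by (auto simp: certificate_def)
  qed
  then show "Q = P_ideal G T" using Q by blast
qed

end

section \<open>Positions on the Hamiltonian cycle\<close>

instance vertex :: countable by countable_datatype

locale cycle_complement =
  fixes n :: nat
  assumes n5: "n \<ge> 5"

sublocale cycle_complement \<subseteq> fin_graph "G_graph n"
  by standard (rule simple_graph_G_graph)

context cycle_complement
begin

text \<open>
  The number of vertices, which is the period of the positions on the cycle.
\<close>

definition M :: int where "M = 2 * int n"

text \<open>
  The vertices in their order around the cycle \<open>F\<^sub>n\<close>: \<open>u\<^sub>0, v\<^sub>0, u\<^sub>1, v\<^sub>1, \<dots>\<close>, with positions modulo \<open>M\<close>.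
  Integers as positions allow both directions from a given vertex.
\<close>

definition vert :: "int \<Rightarrow> vertex" where
  "vert k = (if even k then Uv (nat (k mod M) div 2) else Vv (nat (k mod M) div 2))"

text \<open>
  Positions relative to a base \<open>p\<close>. All statements below hold for every base; a base of the other
  parity exchanges the two sides of the graph.
\<close>

definition w :: "int \<Rightarrow> int \<Rightarrow> vertex" where
  "w p k = vert (p + k)"

lemma M_ge: "M \<ge> 10" using n5 by (simp add: M_def)

lemma M_even: "M dvd d \<Longrightarrow> even d"
  by (auto simp: M_def)

lemma not_M_dvd: "d \<noteq> 0 \<Longrightarrow> \<bar>d\<bar> < 10 \<Longrightarrow> \<not> M dvd d"
  using M_ge zdvd_imp_le[of M "\<bar>d\<bar>"] by fastforce

lemma M_dvd_num [simp]: "numeral c < (10 :: int) \<Longrightarrow> \<not> M dvd numeral c" "\<not> M dvd 1"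
  by (rule not_M_dvd; simp)+

lemma M_abs [simp]: "\<bar>M\<bar> \<noteq> 1" "M \<noteq> 0"
  using M_ge by auto

lemma M_dvd_trans: "M dvd x \<Longrightarrow> M dvd y \<Longrightarrow> x \<noteq> y \<Longrightarrow> \<bar>x - y\<bar> < 10 \<Longrightarrow> False"
  using not_M_dvd[of "x - y"] dvd_diff by auto

lemma vert_Uv: "i < n \<Longrightarrow> vert (2 * int i) = Uv i"
  by (simp add: vert_def M_def)

lemma vert_Vv: "i < n \<Longrightarrow> vert (2 * int i + 1) = Vv i"
  by (simp add: vert_def M_def)

lemma vert_cong: "M dvd (a - b) \<Longrightarrow> vert a = vert b"
proof -
  assume "M dvd (a - b)"
  then have "a mod M = b mod M" "even a \<longleftrightarrow> even b"
    using M_even[of "a - b"] by (auto simp: mod_eq_dvd_iff)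
  then show ?thesis by (simp add: vert_def)
qed

lemma position_cases:
  obtains i where "i < n" "M dvd (k - 2 * int i)" | i where "i < n" "M dvd (k - (2 * int i + 1))"
proof -
  define r where "r = k mod M"
  have r: "0 \<le> r" "r < M" using M_ge by (simp_all add: r_def)
  have d: "M dvd (k - r)" by (simp add: r_def)
  show ?thesis
  proof (cases "even r")
    case True
    then have "r = 2 * int (nat (r div 2))" "nat (r div 2) < n" using r by (auto simp: M_def)
    then show ?thesis using that(1)[of "nat (r div 2)"] d by simp
  next
    case False
    then have "r = 2 * int (nat (r div 2)) + 1" using r by (auto elim!: oddE)
    moreover have "nat (r div 2) < n" using r by (auto simp: M_def)
    ultimately show ?thesis using that(2)[of "nat (r div 2)"] d by simp
  qed
qed

lemma vertsG: "V = partX n \<union> partY n"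
  by (simp add: G_graph_def)

lemma vert_cases:
  assumes "v \<in> V"
  obtains k where "v = vert k"
  using assms vert_Uv vert_Vv unfolding vertsG partX_def partY_def by (metis UnE imageE lessThan_iff)

lemma vert_in: "vert k \<in> V"
proof (cases k rule: position_cases)
  case (1 i)
  then show ?thesis using vert_cong[of k "2 * int i"] vert_Uv[of i] by (auto simp: vertsG partX_def)
next
  case (2 i)
  then show ?thesis using vert_cong[of k "2 * int i + 1"] vert_Vv[of i] by (auto simp: vertsG partY_def)
qed

lemma dvd_range: "M dvd d \<Longrightarrow> \<bar>d\<bar> < M \<Longrightarrow> d = 0"
  using zdvd_imp_le[of M "\<bar>d\<bar>"] by fastforce

lemma vert_eq: "vert a = vert b \<longleftrightarrow> M dvd (a - b)"
proof
  assume eq: "vert a = vert b"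
  have par: "even a \<longleftrightarrow> even b" using eq by (simp add: vert_def split: if_splits)
  then have "nat (a mod M) div 2 = nat (b mod M) div 2" using eq
    by (simp add: vert_def split: if_splits)
  moreover have "even (a mod M) \<longleftrightarrow> even a" "even (b mod M) \<longleftrightarrow> even b"
    by (simp_all add: M_def dvd_mod_iff)
  moreover have "0 \<le> a mod M" "0 \<le> b mod M" using M_ge by simp_all
  moreover have "r = s" if "nat r div 2 = nat s div 2" "even r = even s" "0 \<le> r" "0 \<le> s" for r s :: int
    using that by (auto elim!: nonneg_int_cases) presburger+
  ultimately have "a mod M = b mod M" using par by blast
  then show "M dvd (a - b)" by (simp add: mod_eq_dvd_iff)
qed (rule vert_cong)

lemma not_adj_same_part: "\<not> adj (Uv i) (Uv j)" "\<not> adj (Vv i) (Vv j)"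
  unfolding adj_def by (auto simp: G_graph_def partX_def partY_def doubleton_eq_iff)

lemma adj_Uv_Vv:
  assumes "i < n" "j < n"
  shows "adj (Uv i) (Vv j) \<longleftrightarrow> \<not> M dvd (2 * int i - (2 * int j + 1) - 1) \<and>
      \<not> M dvd (2 * int i - (2 * int j + 1) + 1)"
proof -
  have "2 * int n dvd (2 * int i - (2 * int j + 1) + 1) \<longleftrightarrow> int n dvd (int i - int j)"
    using dvd_mult_cancel_left[of 2 "int n" "int i - int j"] by (simp add: algebra_simps)
  also have "\<dots> \<longleftrightarrow> j = i"
  proof
    assume "int n dvd (int i - int j)"
    then have "int n \<le> \<bar>int i - int j\<bar> \<or> int i - int j = 0"
      using zdvd_imp_le[of "int n" "\<bar>int i - int j\<bar>"] by fastforce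
    then show "j = i" using assms by linarith
  qed simp
  finally have 1: "M dvd (2 * int i - (2 * int j + 1) + 1) \<longleftrightarrow> j = i" by (simp add: M_def)
  have "2 * int n dvd (2 * int i - (2 * int j + 1) - 1) \<longleftrightarrow> int n dvd (int i - int j - 1)"
    using dvd_mult_cancel_left[of 2 "int n" "int i - int j - 1"] by (simp add: algebra_simps)
  also have "\<dots> \<longleftrightarrow> j = (i + n - 1) mod n"
  proof (cases "i = 0")
    case True
    have "int n dvd (int i - int j - 1) \<longleftrightarrow> int n dvd (int j + 1)"
      using True by (metis add.commute diff_0 diff_diff_eq dvd_minus_iff of_nat_0)
    also have "\<dots> \<longleftrightarrow> int j + 1 = int n"
      using assms zdvd_imp_le[of "int n" "int j + 1"] by fastforce
    finally show ?thesis using True assms by auto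
  next
    case False
    have "(i + n - 1) mod n = i - 1" using False assms by (simp add: mod_if)
    moreover have "int n dvd (int i - int j - 1) \<longleftrightarrow> int i - int j - 1 = 0"
    proof
      assume "int n dvd (int i - int j - 1)"
      then have "int n \<le> \<bar>int i - int j - 1\<bar> \<or> int i - int j - 1 = 0"
        using zdvd_imp_le[of "int n" "\<bar>int i - int j - 1\<bar>"] by fastforce
      then show "int i - int j - 1 = 0" using assms False by linarith
    qed simp
    ultimately show ?thesis using False by auto
  qed
  finally have 2: "M dvd (2 * int i - (2 * int j + 1) - 1) \<longleftrightarrow> j = (i + n - 1) mod n" by (simp add: M_def)
  show ?thesis unfolding adj_def edge_G_graph_iff[OF assms] 1 2 by blast
qed

text \<open>
  In terms of positions the graph is invariant under rotation, including the rotations that exchange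
  the two sides.
\<close>

lemma adj_vert: "adj (vert a) (vert b) \<longleftrightarrow> odd (a - b) \<and> \<not> M dvd (a - b - 1) \<and> \<not> M dvd (a - b + 1)"
proof -
  have shift: "(M dvd (x - y + c)) = (M dvd (x' - y' + c))" if "M dvd (x - x')" "M dvd (y - y')"
      for x y x' y' c
  proof -
    have "M dvd ((x - x') - (y - y'))" using that by (rule dvd_diff)
    then have "M dvd ((x - y + c) - (x' - y' + c))" by (simp add: algebra_simps)
    then show ?thesis by (metis dvd_add_right_iff diff_add_cancel)
  qed
  have shift': "(M dvd (x - y - c)) = (M dvd (x' - y' - c))" if "M dvd (x - x')" "M dvd (y - y')"
      for x y x' y' c
    using shift[OF that, of "- c"] by simp
  have par: "even x \<longleftrightarrow> even y" if "M dvd (x - y)" for x y using M_even[OF that] by simp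
  have symm: "M dvd (x - y - 1) \<longleftrightarrow> M dvd (y - x + 1)" for x y
    using dvd_minus_iff[of M "x - y - 1"] by (simp add: algebra_simps)
  show ?thesis
  proof (cases a rule: position_cases)
    case (1 i)
    note a = 1
    show ?thesis
    proof (cases b rule: position_cases)
      case (1 j)
      then have "even (a - b)" using par[OF a(2)] par[OF 1(2)] by simp
      then show ?thesis
        using not_adj_same_part(1)[of i j] vert_cong[OF a(2)] vert_cong[OF 1(2)] a 1
          by (simp add: vert_Uv)
    next
      case (2 j)
      have "odd (a - b)" using par[OF a(2)] par[OF 2(2)] by simp
      then show ?thesis
        using adj_Uv_Vv[OF a(1) 2(1)] vert_cong[OF a(2)] vert_cong[OF 2(2)] a 2
          shift[OF a(2) 2(2)] shift'[OF a(2) 2(2)] by (simp add: vert_Uv vert_Vv)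
    qed
  next
    case (2 i)
    note a = 2
    show ?thesis
    proof (cases b rule: position_cases)
      case (2 j)
      then have "even (a - b)" using par[OF a(2)] par[OF 2(2)] by simp
      then show ?thesis
        using not_adj_same_part(2)[of i j] vert_cong[OF a(2)] vert_cong[OF 2(2)] a 2
          by (simp add: vert_Vv)
    next
      case (1 j)
      have "odd (a - b)" using par[OF a(2)] par[OF 1(2)] by simp
      moreover have "adj (vert a) (vert b) \<longleftrightarrow> \<not> M dvd (b - a - 1) \<and> \<not> M dvd (b - a + 1)"
        using adj_Uv_Vv[OF 1(1) a(1)] vert_cong[OF a(2)] vert_cong[OF 1(2)] a 1 adj_sym[of "vert a"
            "vert b"]
          shift[OF 1(2) a(2)] shift'[OF 1(2) a(2)] by (simp add: vert_Uv vert_Vv)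
      ultimately show ?thesis using symm[of a b] symm[of b a] by auto
    qed
  qed
qed

lemma w_in [simp]: "w p k \<in> V"
  by (simp add: w_def vert_in)

lemma w_eq: "w p a = w p b \<longleftrightarrow> M dvd (a - b)"
  by (simp add: w_def vert_eq)

lemma w_adj: "adj (w p a) (w p b) \<longleftrightarrow> odd (a - b) \<and> \<not> M dvd (a - b - 1) \<and> \<not> M dvd (a - b + 1)"
  by (simp add: w_def adj_vert)

lemma w_cases:
  assumes "v \<in> V"
  obtains k where "v = w p k"
proof -
  obtain k where "v = vert k" using assms vert_cases by blast
  then show ?thesis using that[of "k - p"] by (simp add: w_def)
qed

lemma w_shift: "w p (a + k) = w (p + a) k"
  by (simp add: w_def add.assoc)

section \<open>Witnesses have degree at least four\<close>

lemma sum_ge_card: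
  assumes "A \<subseteq> V" "\<And>a. a \<in> A \<Longrightarrow> \<alpha> a \<noteq> (0 :: nat)"
  shows "card A \<le> (\<Sum>v\<in>V. \<alpha> v)"
proof -
  have "card A = (\<Sum>a\<in>A. 1)" by simp
  also have "\<dots> \<le> (\<Sum>a\<in>A. \<alpha> a)" using assms(2) by (intro sum_mono) (simp add: Suc_le_eq)
  also have "\<dots> \<le> (\<Sum>v\<in>V. \<alpha> v)" using assms(1) by (intro sum_mono2) auto
  finally show ?thesis .
qed

lemma sum_le_card:
  assumes "A \<subseteq> V" "\<And>a. a \<in> A \<Longrightarrow> \<alpha> a \<noteq> (0 :: nat)" "(\<Sum>v\<in>V. \<alpha> v) \<le> card A"
  shows "\<And>a. a \<in> A \<Longrightarrow> \<alpha> a = 1" "\<And>v. v \<in> V \<Longrightarrow> \<alpha> v \<noteq> 0 \<Longrightarrow> v \<in> A"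
proof -
  have fin: "finite A" using assms(1) finite_subset finV by blast
  have split: "(\<Sum>v\<in>V. \<alpha> v) = (\<Sum>v\<in>V - A. \<alpha> v) + (\<Sum>v\<in>A. \<alpha> v)"
    using assms(1) by (intro sum.subset_diff) auto
  have card: "card A \<le> (\<Sum>v\<in>A. \<alpha> v)"
    using sum_mono[of A "\<lambda>_. 1" \<alpha>] assms(2) by (simp add: Suc_le_eq)
  show "\<alpha> a = 1" if a: "a \<in> A" for a
  proof (rule ccontr)
    assume "\<alpha> a \<noteq> 1"
    then have "1 < \<alpha> a" using assms(2)[OF a] by linarith
    then have "(\<Sum>v\<in>A. 1) < (\<Sum>v\<in>A. \<alpha> v)"
      using assms(2) a fin by (intro sum_strict_mono_ex1) (auto simp: Suc_le_eq)
    then show False using split assms(3) by simp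
  qed
  show "v \<in> A" if v: "v \<in> V" "\<alpha> v \<noteq> 0" for v
  proof (rule ccontr)
    assume "v \<notin> A"
    then have "\<alpha> v \<le> (\<Sum>v\<in>V - A. \<alpha> v)" using v by (intro member_le_sum) auto
    then show False using split card assms(3) v by linarith
  qed
qed

lemma conn_path2: "adj a b \<Longrightarrow> adj b c \<Longrightarrow> a \<in> U \<Longrightarrow> b \<in> U \<Longrightarrow> c \<in> U \<Longrightarrow> conn U a c"
  by (rule conn_trans[OF conn_adj conn_adj])

lemma conn_path3: "adj a b \<Longrightarrow> adj b c \<Longrightarrow> adj c d \<Longrightarrow> a \<in> U \<Longrightarrow> b \<in> U \<Longrightarrow> c \<in> U \<Longrightarrow> d \<in> U \<Longrightarrow> conn U a d"
  by (rule conn_trans[OF conn_path2 conn_adj])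

lemma w_neighbours:
  assumes T: "T \<subseteq> V" and f: "witness T \<alpha> (f :: (vertex, 'k::field) vpoly)" and k: "w p k \<in> T"
  obtains i j where "adj (w p k) (w p i)" "adj (w p k) (w p j)" "\<alpha> (w p i) \<noteq> 0" "\<alpha> (w p j) \<noteq> 0"
    "\<not> conn (V - T) (w p i) (w p j)"
proof -
  obtain a b where ab: "adj (w p k) a" "adj (w p k) b" "\<alpha> a \<noteq> 0" "\<alpha> b \<noteq> 0" "\<not> conn (V - T) a b"
    using witness_two_neighbours[OF T f k] by blast
  then have "a \<in> V" "b \<in> V" using adj_V by blast+
  then obtain i j where "a = w p i" "b = w p j" using w_cases by metis
  then show ?thesis using that ab by blast
qed

text \<open>
  If the degree were at most 3, one side of the graph would contain at most one vertex of the support,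
  say \<open>w(0)\<close>. Adding \<open>w(0)\<close> and its cycle neighbour \<open>w(1)\<close> to the support leaves \<open>w(1)\<close> isolated, although the
  graph is connected.
\<close>

lemma witness_deg_empty:
  assumes f: "witness {} \<alpha> (f :: (vertex, 'k::field) vpoly)"
  shows "4 \<le> (\<Sum>v\<in>V. \<alpha> v)"
proof (rule ccontr)
  assume less: "\<not> ?thesis"
  have "\<exists>p. \<forall>k. even k \<longrightarrow> \<alpha> (w p k) \<noteq> 0 \<longrightarrow> M dvd k"
  proof (rule ccontr)
    assume "\<not> ?thesis"
    then have no: "\<exists>k. even k \<and> \<alpha> (w p k) \<noteq> 0 \<and> \<not> M dvd k" for p by blast
    have two: "\<exists>i j. even i \<and> even j \<and> \<not> M dvd (i - j) \<and> \<alpha> (w p i) \<noteq> 0 \<and> \<alpha> (w p j) \<noteq> 0" for p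
    proof -
      obtain i where i: "even i" "\<alpha> (w p i) \<noteq> 0" using no[of p] by blast
      obtain j where j: "even j" "\<alpha> (w (p + i) j) \<noteq> 0" "\<not> M dvd j" using no[of "p + i"] by blast
      then have "\<alpha> (w p (i + j)) \<noteq> 0" "even (i + j)" "\<not> M dvd (i + j - i)" using i
        by (simp_all add: w_shift)
      then show ?thesis using i by blast
    qed
    obtain i j where ij: "even i" "even j" "\<not> M dvd (i - j)" "\<alpha> (w 0 i) \<noteq> 0" "\<alpha> (w 0 j) \<noteq> 0"
      using two by blast
    obtain k l where kl: "even k" "even l" "\<not> M dvd (k - l)" "\<alpha> (w 1 k) \<noteq> 0" "\<alpha> (w 1 l) \<noteq> 0"
      using two by blast
    have w1: "w 1 x = w 0 (1 + x)" for x by (simp add: w_def)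
    have d: "\<not> M dvd (x - (1 + y))" if "even x" "even y" for x y using M_even that by fastforce
    have "card {w 0 i, w 0 j, w 0 (1 + k), w 0 (1 + l)} = 4"
      using ij kl d by (simp add: w_eq)
    moreover have "card {w 0 i, w 0 j, w 0 (1 + k), w 0 (1 + l)} \<le> (\<Sum>v\<in>V. \<alpha> v)"
      using ij kl by (intro sum_ge_card) (auto simp: w1)
    ultimately show False using less by simp
  qed
  then obtain p where p: "\<And>k. even k \<Longrightarrow> \<alpha> (w p k) \<noteq> 0 \<Longrightarrow> M dvd k" by blast
  let ?U = "{v \<in> V. \<alpha> v \<noteq> 0} \<union> {w p 0, w p 1}"
  have "conn V (w p 1) (w p 0)"
    by (rule conn_path3[of _ "w p 6" "w p 3"]) (simp_all add: w_adj)
  then obtain c where c: "c \<in> ?U" "adj (w p 1) c"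
    using witness_not_isolated[of "{}" \<alpha> f ?U "w p 1" "w p 0"] f by (auto simp: w_eq)
  then obtain k where k: "c = w p k" using w_cases[of c p] by auto
  then have "even k" "\<not> M dvd k" using c dvd_minus_iff[of M k] by (auto simp: w_adj)
  then show False using c k p[of k] M_even[of "k - 1"] by (auto simp: w_eq)
qed

text \<open>
  An even position misses only two odd ones, so it is adjacent to one of the three; and two odd
  positions have a common even neighbour, since there are at least five even positions.
\<close>

lemma conn_of_three_odds:
  assumes odd: "odd x" "odd y" "odd z"
    and U: "w p x \<in> U" "w p y \<in> U" "w p z \<in> U" and even: "\<And>k. even k \<Longrightarrow> w p k \<in> U"
    and ne: "\<not> M dvd (x - y)" "\<not> M dvd (x - z)" "\<not> M dvd (y - z)"
    and ij: "even i" "even j"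
  shows "conn U (w p i) (w p j)"
proof -
  have nb: "\<exists>o'\<in>{x, y, z}. adj (w p i) (w p o')" if i: "even i" for i
  proof (rule ccontr)
    assume "\<not> ?thesis"
    then have "M dvd (i - o' - 1) \<or> M dvd (i - o' + 1)" if "o' \<in> {x, y, z}" for o'
      using that odd i by (auto simp: w_adj)
    then have c: "M dvd (i - x - 1) \<or> M dvd (i - x + 1)" "M dvd (i - y - 1) \<or> M dvd (i - y + 1)"
      "M dvd (i - z - 1) \<or> M dvd (i - z + 1)" by simp_all
    have d: "M dvd (b - a)" if "M dvd (i - a + e)" "M dvd (i - b + e)" for a b e
      using dvd_diff[OF that] by simp
    have d': "M dvd (b - a)" if "M dvd (i - a - e)" "M dvd (i - b - e)" for a b e
      using dvd_diff[OF that] by simp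
    have s: "M dvd (a - b) \<longleftrightarrow> M dvd (b - a)" for a b by (rule dvd_diff_commute)
    show False using c d[of _ 1] d'[of _ 1] ne s by meson
  qed
  obtain a where a: "a \<in> {x, y, z}" "adj (w p i) (w p a)" using nb ij by blast
  obtain b where b: "b \<in> {x, y, z}" "adj (w p j) (w p b)" using nb ij by blast
  have odds: "odd a" "odd b" using a b odd by auto
  have "\<exists>e\<in>{a + 3, a + 5, a + 7}. adj (w p b) (w p e)"
  proof (rule ccontr)
    assume "\<not> ?thesis"
    then have c: "M dvd (b - (a + 3) - 1) \<or> M dvd (b - (a + 3) + 1)"
      "M dvd (b - (a + 5) - 1) \<or> M dvd (b - (a + 5) + 1)"
      "M dvd (b - (a + 7) - 1) \<or> M dvd (b - (a + 7) + 1)"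
      using odds by (auto simp: w_adj)
    show False
      using c by (elim disjE) (drule (1) M_dvd_trans; simp; fail | (drule (1) M_dvd_trans[rotated];
          simp; fail))+
  qed
  then obtain e where e: "e \<in> {a + 3, a + 5, a + 7}" "adj (w p b) (w p e)" by blast
  have ae: "adj (w p a) (w p e)" and "even e" using e odds by (auto simp: w_adj)
  have in_U: "w p a \<in> U" "w p b \<in> U" "w p e \<in> U" "w p i \<in> U" "w p j \<in> U"
    using a b U even ij \<open>even e\<close> by auto
  have "conn U (w p i) (w p a)" using a in_U by (intro conn_adj) auto
  moreover have "conn U (w p a) (w p b)"
    using ae e(2) in_U adj_sym[of "w p b"] by (intro conn_path2[of _ "w p e"]) auto
  moreover have "conn U (w p b) (w p j)" using b in_U adj_sym[of "w p b"] by (intro conn_adj) auto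
  ultimately have "conn U (w p i) (w p a)" "conn U (w p a) (w p b)" "conn U (w p b) (w p j)" .
  then show ?thesis using conn_trans by blast
qed

text \<open>
  Suppose that the degree is at most 3. Every \<open>t \<in> T\<close> has two neighbours in the support, so \<open>T\<close> lies on
  one side, say at odd positions, and the even ones are all left. Call an even position good if some
  \<open>t \<in> T\<close> misses it. Two bad positions would leave three odd vertices outside \<open>T\<close>, and the rest of the
  graph would be connected. A good position is missed by a vertex of \<open>T\<close> that has two neighbours in the
  support, so the support consists of three even vertices. The witness is linear in each of them and
  vanishes whenever the two vertices other than a good one carry the same vector. As two of the three
  are good, it vanishes identically.
\<close>

lemma witness_deg_nonempty:
  assumes T: "T \<subseteq> V" "T \<noteq> {}" and f: "witness T \<alpha> (f :: (vertex, 'k::field) vpoly)"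
  shows "4 \<le> (\<Sum>v\<in>V. \<alpha> v)"
proof (rule ccontr)
  assume less: "\<not> ?thesis"
  obtain t p where t: "t \<in> T" "t = w p 1"
  proof -
    obtain t where "t \<in> T" using T by blast
    moreover then obtain k where "t = w 0 k" using T w_cases by blast
    ultimately show ?thesis using that[of t "k - 1"] by (simp add: w_def)
  qed
  note nbrs = w_neighbours[OF T(1) f]
  obtain i j where ij: "adj (w p 1) (w p i)" "adj (w p 1) (w p j)" "\<alpha> (w p i) \<noteq> 0" "\<alpha> (w p j) \<noteq> 0"
    "\<not> conn (V - T) (w p i) (w p j)" using nbrs t by blast
  have ij_even: "even i" "even j" using ij by (auto simp: w_adj)
  have ij_ne: "w p i \<noteq> w p j" using ij(5) by auto
  have T_odd: "odd k" if k: "w p k \<in> T" for k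
  proof (rule ccontr)
    assume "\<not> odd k"
    obtain i' j' where ij': "adj (w p k) (w p i')" "adj (w p k) (w p j')" "\<alpha> (w p i') \<noteq> 0"
        "\<alpha> (w p j') \<noteq> 0"
      "\<not> conn (V - T) (w p i') (w p j')" using nbrs k by blast
    then have odd: "odd i'" "odd j'" using \<open>\<not> odd k\<close> by (auto simp: w_adj)
    have "w p i' \<noteq> w p j'" using ij'(5) by auto
    moreover have "w p x \<noteq> w p y" if "even x" "odd y" for x y using M_even[of "x - y"] that
      by (auto simp: w_eq)
    ultimately have "card {w p i, w p j, w p i', w p j'} = 4"
      using ij_ne ij_even odd by simp
    moreover have "card {w p i, w p j, w p i', w p j'} \<le> (\<Sum>v\<in>V. \<alpha> v)"
      using ij ij' by (intro sum_ge_card) auto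
    ultimately show False using less by simp
  qed
  have even_out: "w p k \<in> V - T" if "even k" for k using T_odd that by auto
  have three: False if "odd x" "odd y" "odd z" "w p x \<notin> T" "w p y \<notin> T" "w p z \<notin> T"
    "\<not> M dvd (x - y)" "\<not> M dvd (x - z)" "\<not> M dvd (y - z)" for x y z
    using conn_of_three_odds[of x y z p "V - T" i j] that even_out ij ij_even by auto
  define good where "good s \<longleftrightarrow> (w p (s + 1) \<in> T \<or> w p (s - 1) \<in> T)" for s
  have bad2: False if s: "even s" "even s'" "\<not> good s" "\<not> good s'" "\<not> M dvd (s - s')" for s s'
  proof (cases "M dvd (s - 1 - (s' + 1))")
    case False
    have "\<not> M dvd (s + 1 - (s' + 1))" "\<not> M dvd (s + 1 - (s - 1))" using s by simp_all
    then show False using three[of "s + 1" "s - 1" "s' + 1"] s False by (auto simp: good_def)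
  next
    case True
    have "\<not> M dvd (s + 1 - (s' - 1))"
      using M_dvd_trans[OF True, of "s + 1 - (s' - 1)"] by auto
    moreover have "\<not> M dvd (s - 1 - (s' - 1))" "\<not> M dvd (s + 1 - (s - 1))" using s by simp_all
    ultimately show False using three[of "s + 1" "s - 1" "s' - 1"] s by (auto simp: good_def)
  qed
  have good_nbrs: "\<exists>k a b. w p k \<in> T \<and> \<not> adj (w p k) (w p s) \<and> adj (w p k) (w p a) \<and>
      adj (w p k) (w p b) \<and>
      \<alpha> (w p a) \<noteq> 0 \<and> \<alpha> (w p b) \<noteq> 0 \<and> w p a \<noteq> w p b \<and> even a \<and> even b" if s: "good s" "even s" for s
  proof -
    obtain k where k: "w p k \<in> T" "k = s + 1 \<or> k = s - 1" using s by (auto simp: good_def)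
    obtain a b where ab: "adj (w p k) (w p a)" "adj (w p k) (w p b)" "\<alpha> (w p a) \<noteq> 0" "\<alpha> (w p b) \<noteq> 0"
      "\<not> conn (V - T) (w p a) (w p b)" using nbrs k by blast
    have "even a" "even b" using ab k s by (auto simp: w_adj)
    moreover have "\<not> adj (w p k) (w p s)" using k by (auto simp: w_adj)
    moreover have "w p a \<noteq> w p b" using ab(5) by auto
    ultimately show ?thesis using k ab by blast
  qed
  have "\<not> M dvd (i - j)" using ij_ne by (simp add: w_eq)
  then have "good i \<or> good j" using bad2 ij_even by blast
  then obtain l where l: "\<alpha> (w p l) \<noteq> 0" "w p l \<noteq> w p i" "w p l \<noteq> w p j" "even l"
    using good_nbrs ij_even by metis
  let ?S = "{w p i, w p j, w p l}"
  have card: "card ?S = 3" using l ij_ne by simp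
  have "(\<Sum>v\<in>V. \<alpha> v) \<le> card ?S" using less card by simp
  then have one: "\<And>a. a \<in> ?S \<Longrightarrow> \<alpha> a = 1" and supp: "\<And>v. v \<in> V \<Longrightarrow> \<alpha> v \<noteq> 0 \<Longrightarrow> v \<in> ?S"
    using sum_le_card[of ?S \<alpha>] ij l by auto
  have nadj: "\<not> adj a b" if "a \<in> ?S" "b \<in> ?S" for a b
    using that ij_even l by (auto simp: w_adj)
  have van: "ev V Z f = 0" if xyz: "?S = {w p x, w p y, w p z}" "good x" "even x"
      "Z (w p y) = Z (w p z)"
    for x y z and Z :: "vertex \<Rightarrow> 'k coord \<times> 'k coord"
  proof -
    obtain k a b where k: "w p k \<in> T" "\<not> adj (w p k) (w p x)" "adj (w p k) (w p a)"
        "adj (w p k) (w p b)"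
      "\<alpha> (w p a) \<noteq> 0" "\<alpha> (w p b) \<noteq> 0" "w p a \<noteq> w p b" using good_nbrs xyz by blast
    have kS: "w p k \<notin> ?S" using k witness_outside[OF T(1) f k(1)] one by fastforce
    have "ev V (Z(w p k := Z (w p y))) f = 0"
    proof (rule witness_vanishes[OF T(1) f, of "insert (w p k) ?S"])
      fix a b assume ab: "a \<in> insert (w p k) ?S" "b \<in> insert (w p k) ?S" "adj a b"
      have nk: "c = w p y \<or> c = w p z" if "c \<in> ?S" "adj (w p k) c" for c using that xyz k by auto
      show "(Z(w p k := Z (w p y))) a = (Z(w p k := Z (w p y))) b"
      proof (cases "a = w p k \<or> b = w p k")
        case True
        then show ?thesis using ab nk[of a] nk[of b] adj_sym[of a b] xyz(4)
          by (metis fun_upd_apply insertE)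
      next
        case False
        then show ?thesis using ab nadj by blast
      qed
    qed (use supp k T in auto)
    moreover have "ev V (Z(w p k := Z (w p y))) f = ev V Z f"
      using supp kS by (intro witness_cong[OF f]) auto
    ultimately show ?thesis by simp
  qed
  obtain x y z where xyz: "?S = {w p x, w p y, w p z}" "good x" "good y" "even x" "even y" "even z"
    "w p x \<noteq> w p y" "w p x \<noteq> w p z" "w p y \<noteq> w p z"
  proof -
    have "good i \<or> good l" "good j \<or> good l" using bad2[of i l] bad2[of j l] ij_even l
      by (auto simp: w_eq dvd_diff_commute)
    with \<open>good i \<or> good j\<close> consider "good i" "good j" | "good i" "good l" | "good j" "good l" by blast
    then show ?thesis
    proof cases
      case 1
      then show ?thesis using that[of i j l] ij_even ij_ne l by auto
    next
      case 2
      then show ?thesis using that[of i l j] ij_even ij_ne l by auto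
    next
      case 3
      then show ?thesis using that[of j l i] ij_even ij_ne l by auto
    qed
  qed
  have ones: "\<alpha> (w p x) = 1" "\<alpha> (w p y) = 1" "\<alpha> (w p z) = 1" using one xyz(1) by blast+
  \<comment> \<open>The vectors at \<open>x\<close> and \<open>y\<close> are the two independent values for the vector at \<open>z\<close>.\<close>
  have indep: "ev V Z f = 0" if "det2 (Z (w p x)) (Z (w p y)) \<noteq> 0"
      for Z :: "vertex \<Rightarrow> 'k coord \<times> 'k coord"
  proof (rule witness_linear_zero[OF f, of "w p z" "Z (w p x)" "Z (w p y)"])
    show "ev V (Z(w p z := Z (w p x))) f = 0"
      using van[of y x z "Z(w p z := Z (w p x))"] xyz by (auto simp: insert_commute)
    show "ev V (Z(w p z := Z (w p y))) f = 0"
      using van[of x y z "Z(w p z := Z (w p y))"] xyz by auto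
  qed (use ones that in auto)
  let ?Z = "\<lambda>v. label_vec (comp_label T v) :: 'k coord \<times> 'k coord"
  \<comment> \<open>At this point the vectors at \<open>x\<close> and \<open>y\<close> may coincide; the one at \<open>x\<close> is therefore moved to two
    fresh labels.\<close>
  have "ev V ?Z f = 0"
  proof (rule witness_linear_zero[OF f, of "w p x" "label_vec (comp_label T (w p y) + 1)"
      "label_vec (comp_label T (w p y) + 2)"])
    show "ev V (?Z(w p x := label_vec (comp_label T (w p y) + 1))) f = 0"
        "ev V (?Z(w p x := label_vec (comp_label T (w p y) + 2))) f = 0"
      using xyz(7) by (auto intro!: indep simp: det2_label_vec)
  qed (simp_all add: ones det2_label_vec)
  then show False using witness_nonzero[OF T(1) f] by simp
qed

lemma witness_deg_ge_4:
  assumes "T \<subseteq> V" "witness T \<alpha> (f :: (vertex, 'k::field) vpoly)"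
  shows "4 \<le> (\<Sum>v\<in>V. \<alpha> v)"
  using witness_deg_empty witness_deg_nonempty assms by (cases "T = {}") blast+


section \<open>Certificates for the types of cut sets\<close>

lemma kill_br2:
  fixes a b c d k :: vertex
  assumes "adj k a \<and> adj k b \<or> adj k c \<and> adj k d" "a \<in> V" "b \<in> V" "c \<in> V" "d \<in> V"
  shows "kill (br a b * br c d :: (vertex, 'k::field) vpoly) k"
proof -
  consider "kill (br a b :: (vertex, 'k) vpoly) k" | "kill (br c d :: (vertex, 'k) vpoly) k"
    using assms kill_br by blast
  then show ?thesis
  proof cases
    case 1
    then show ?thesis using kill_mult[OF 1, of "br c d"] assms by (simp add: mult.commute)
  next
    case 2
    then show ?thesis using kill_mult[OF 2, of "br a b"] assms by simp
  qed
qed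

lemma kill_br3:
  fixes a b c d e e' k :: vertex
  assumes "adj k a \<and> adj k b \<or> adj k c \<and> adj k d \<or> adj k e \<and> adj k e'"
    and V: "a \<in> V" "b \<in> V" "c \<in> V" "d \<in> V" "e \<in> V" "e' \<in> V"
  shows "kill (br a b * br c d * br e e' :: (vertex, 'k::field) vpoly) k"
proof -
  consider "kill (br a b * br c d :: (vertex, 'k) vpoly) k" | "kill (br e e' :: (vertex, 'k) vpoly) k"
    using assms kill_br kill_br2 by blast
  then show ?thesis
  proof cases
    case 1
    then show ?thesis using kill_mult[OF 1, of "br e e'"] V by (simp add: mult.commute)
  next
    case 2
    then show ?thesis using kill_mult[OF 2, of "br a b * br c d"] V by simp
  qed
qed

lemma certificateI:
  fixes g :: "(vertex, 'k::field) vpoly"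
  assumes T: "T \<subseteq> V" and g: "g \<in> carrier (poly_ring V)" "homogeneous d g" "g \<notin> P_ideal (G_graph n) T"
    and kill: "\<And>k. w p k \<in> T \<Longrightarrow> kill g (w p k)"
    and comp: "\<And>a b. a \<in> V - T \<Longrightarrow> b \<in> V - T \<Longrightarrow> a \<noteq> b \<Longrightarrow> conn (V - T) a b \<Longrightarrow> \<not> adj a b \<Longrightarrow> g * br a b \<in> JG"
  shows "certificate T d g"
proof -
  have "g * q \<in> JG" if q: "q \<in> cut_gens T" for q
  proof -
    consider v where "v \<in> T" "q = xv v \<or> q = yv v"
      | a b where "a \<in> V - T" "b \<in> V - T" "a \<noteq> b" "conn (V - T) a b" "q = br a b"
      using q unfolding cut_gens_def by blast
    then show ?thesis
    proof cases
      case 1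
      then obtain k where "v = w p k" using T w_cases by blast
      then show ?thesis using kill[of k] 1 by (auto simp: kill_def mult.commute)
    next
      case 2
      then show ?thesis using comp JG_mult[OF JG_edge g(1)] by blast
    qed
  qed
  then show ?thesis using g by (simp add: certificate_def)
qed

lemma in_JG: "h \<in> JG \<Longrightarrow> r \<in> carrier (poly_ring V) \<Longrightarrow> x = r * h \<Longrightarrow> x \<in> JG"
  using JG_mult by blast

lemma xv_br_in_JG: "adj c a \<Longrightarrow> adj c b \<Longrightarrow> xv c * br a b \<in> JG"
  using kill_br by (auto simp: kill_def)

lemma M_sep: "M dvd x \<Longrightarrow> M dvd y \<Longrightarrow> x = y \<or> x - y \<ge> M \<or> y - x \<ge> M"
  using dvd_range[OF dvd_diff, of x y] by linarith

lemma M_dvd_neg: "M dvd (- a - b) \<longleftrightarrow> M dvd (a + b)" "M dvd (- a + b) \<longleftrightarrow> M dvd (a - b)"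
proof -
  have "- a - b = - (a + b)" "- a + b = - (a - b)" by simp_all
  then show "M dvd (- a - b) \<longleftrightarrow> M dvd (a + b)" "M dvd (- a + b) \<longleftrightarrow> M dvd (a - b)"
    by (simp_all only: dvd_minus_iff)
qed

lemma w_rep: "M dvd (k - c) \<Longrightarrow> w p k = w p c"
  by (simp add: w_eq)

text \<open>
  The path \<open>w(0), w(3), w(6), w(9)\<close> is a connected set that dominates the graph: an odd position adjacent
  neither to \<open>0\<close> nor to \<open>6\<close> would be at distance one from both, and similarly for the even ones.
\<close>

lemma certificate_empty: "\<exists>g :: (vertex, 'k::field) vpoly. certificate {} 4 g"
proof -
  let ?S = "{w 0 0, w 0 3, w 0 6, w 0 9}"
  let ?g = "\<Prod>u\<in>?S. xv u :: (vertex, 'k) vpoly"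
  have g: "?g = xv (w 0 0) * (xv (w 0 3) * (xv (w 0 6) * xv (w 0 9)))"
    by (simp add: w_eq)
  have "homogeneous (1 + (1 + (1 + 1))) ?g"
    unfolding g by (intro homogeneous_mult homogeneous_xv)
  then have hom: "homogeneous 4 ?g"
    by (simp only: one_add_one numeral_plus_one add.assoc[symmetric]) simp
  have notin: "?g \<notin> P_ideal (G_graph n) {}"
    unfolding g by (simp add: P_ideal_mult_iff xv_notin_P)
  have S03: "conn ?S (w 0 0) (w 0 3)" and S63: "conn ?S (w 0 6) (w 0 3)"
    by (rule conn_adj; simp add: w_adj)+
  have "conn ?S (w 0 9) (w 0 6)" by (rule conn_adj; simp add: w_adj)
  then have S93: "conn ?S (w 0 9) (w 0 3)" using S63 conn_trans by blast
  have toc: "conn ?S s (w 0 3)" if "s \<in> ?S" for s using that S03 S63 S93 by auto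
  have Sconn: "conn ?S s s'" if "s \<in> ?S" "s' \<in> ?S" for s s'
    using conn_trans[OF toc[OF that(1)] conn_sym[OF toc[OF that(2)]]] .
  have dom: "\<exists>s\<in>?S. adj a s" if aV: "a \<in> V" for a
  proof -
    obtain k where k: "a = w 0 k" using w_cases[OF aV] by blast
    show ?thesis
    proof (cases "even k")
      case True
      have "adj a (w 0 3) \<or> a = w 0 4 \<or> a = w 0 2" using True by (auto simp: k w_adj w_eq)
      then have "adj a (w 0 3) \<or> adj a (w 0 9)" by (auto simp: w_adj)
      then show ?thesis by auto
    next
      case False
      have "adj a (w 0 0) \<or> a = w 0 1 \<or> a = w 0 (-1)" using False by (auto simp: k w_adj w_eq)
      then have "adj a (w 0 0) \<or> adj a (w 0 6)" by (auto simp: w_adj)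
      then show ?thesis by auto
    qed
  qed
  have "certificate {} 4 ?g"
  proof (rule certificateI[where p = 0, OF _ _ hom notin])
    show "?g \<in> carrier (poly_ring V)" by (rule carr_prod) auto
    fix a b assume "a \<in> V - {}" "b \<in> V - {}"
    then obtain s s' where s: "s \<in> ?S" "adj a s" "s' \<in> ?S" "adj b s'" using dom by (metis DiffD1)
    show "?g * br a b \<in> JG"
      by (rule prod_br_in_JG[OF _ s(1,2,4) Sconn[OF s(1,3)]]) auto
  qed simp_all
  then show ?thesis by blast
qed

lemma no_conn_one_part:
  assumes T: "\<And>k. w p k \<in> T \<longleftrightarrow> odd k" and "conn (V - T) a b"
  shows "a = b"
proof -
  have "\<not> adj x y" if xy: "x \<in> V - T" "y \<in> V - T" for x y
  proof -
    obtain i j where "x = w p i" "y = w p j" using xy w_cases by (metis DiffD1)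
    then show ?thesis using xy T by (auto simp: w_adj)
  qed
  then have "b \<in> {a}"
    using assms(2) conn_in[OF assms(2)] conn_closed[OF assms(2), of "{a}"] by blast
  then show ?thesis by simp
qed

text \<open>
  When all odd positions are removed, a product of brackets of even positions is a certificate if every
  odd vertex is adjacent to both ends of one of the brackets. Two disjoint brackets \<open>[0, 2] [6, 8]\<close>
  suffice if no odd position is next to an end of each; for \<open>n = 5\<close> the position \<open>9 \<equiv> -1\<close> is, and a third
  bracket is needed.
\<close>

lemma certificate_part:
  assumes T: "T \<subseteq> V" "\<And>k. w p k \<in> T \<longleftrightarrow> odd k"
  shows "n \<ge> 6 \<Longrightarrow> \<exists>g :: (vertex, 'k::field) vpoly. certificate T 4 g"
    and "\<exists>g :: (vertex, 'k::field) vpoly. certificate T 6 g"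
proof -
  have out: "w p k \<in> V - T" if "even k" for k using T that by auto
  have notin: "br (w p i) (w p j) \<notin> (P_ideal (G_graph n) T :: (vertex, 'k) vpoly set)"
    if "even i" "even j" "\<not> M dvd (i - j)" for i j
  proof (rule br_notin_P[OF T(1) out out])
    show "\<not> conn (V - T) (w p i) (w p j)" using no_conn_one_part[OF T(2), of "w p i" "w p j"] that
      by (auto simp: w_eq)
  qed (use that in auto)
  have comp: "g * br a b \<in> JG" if "a \<noteq> b" "conn (V - T) a b" for a b and g :: "(vertex, 'k) vpoly"
    using no_conn_one_part[OF T(2)] that by blast
  show "\<exists>g :: (vertex, 'k) vpoly. certificate T 4 g" if "n \<ge> 6"
  proof -
    have M12: "M \<ge> 12" using that by (simp add: M_def)
    have h: "homogeneous (2 + 2) (br (w p 0) (w p 2) * br (w p 6) (w p 8) :: (vertex, 'k) vpoly)"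
      by (intro homogeneous_mult homogeneous_br)
    have "certificate T 4 (br (w p 0) (w p 2) * br (w p 6) (w p 8) :: (vertex, 'k) vpoly)"
    proof (rule certificateI[where p = p, OF T(1)])
      show "kill (br (w p 0) (w p 2) * br (w p 6) (w p 8) :: (vertex, 'k) vpoly) (w p k)"
          if k: "w p k \<in> T" for k
      proof (rule kill_br2)
        have "odd k" using k T by simp
        have "\<not> M dvd 10" using M12 zdvd_imp_le[of M 10] by auto
        moreover obtain x where x: "w p k = x" by blast
        moreover have "adj x (w p 0) \<and> adj x (w p 2) \<or> x \<in> {w p (-1), w p 1, w p 3}"
          using \<open>odd k\<close> unfolding x[symmetric] by (auto simp: w_adj w_eq add.commute)
        ultimately show "adj (w p k) (w p 0) \<and> adj (w p k) (w p 2) \<or> adj (w p k) (w p 6) \<and>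
            adj (w p k) (w p 8)"
          unfolding x by (auto simp: w_adj)
      qed simp_all
    qed (use h comp in \<open>simp_all add: P_ideal_mult_iff[OF T(1)] notin\<close>)
    then show ?thesis by blast
  qed
  have h: "homogeneous (2 + 2 + 2) (br (w p 4) (w p 6) * br (w p 0) (w p 2) * br (w p 0) (w p 6) ::
      (vertex, 'k) vpoly)"
    by (intro homogeneous_mult homogeneous_br)
  have "certificate T 6 (br (w p 4) (w p 6) * br (w p 0) (w p 2) * br (w p 0) (w p 6) :: (vertex,
      'k) vpoly)"
  proof (rule certificateI[where p = p, OF T(1)])
    show "kill (br (w p 4) (w p 6) * br (w p 0) (w p 2) * br (w p 0) (w p 6) :: (vertex,
        'k) vpoly) (w p k)"
      if k: "w p k \<in> T" for k
    proof (rule kill_br3)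
      have "odd k" using k T by simp
      obtain x where x: "w p k = x" by blast
      have "adj x (w p 4) \<and> adj x (w p 6) \<or> x \<in> {w p 3, w p 5, w p 7}"
        using \<open>odd k\<close> unfolding x[symmetric] by (auto simp: w_adj w_eq)
      then show "adj (w p k) (w p 4) \<and> adj (w p k) (w p 6) \<or> adj (w p k) (w p 0) \<and> adj (w p k) (w p 2) \<or>
          adj (w p k) (w p 0) \<and> adj (w p k) (w p 6)"
        unfolding x by (auto simp: w_adj)
    qed simp_all
  qed (use h comp in \<open>simp_all add: P_ideal_mult_iff[OF T(1)] notin\<close>)
  then show "\<exists>g :: (vertex, 'k) vpoly. certificate T 6 g" by blast
qed

lemma conn_isolated: "conn U a b \<Longrightarrow> (\<And>x. x \<in> U \<Longrightarrow> \<not> adj a x) \<Longrightarrow> a = b"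
  using conn_closed[of U a b "{a}"] by blast

text \<open>
  \<open>V - T\<close> is one whole side together with a vertex \<open>w(0)\<close> of the other side, which joins all but the
  isolated vertices \<open>w(1)\<close> and \<open>w(-1)\<close>. The factor \<open>x\<^sub>0\<close> takes care of the brackets inside the star. The
  brackets \<open>[-1, -3]\<close> and \<open>[1, 3]\<close> take care of \<open>T\<close>: only \<open>-2\<close> and \<open>-4\<close> miss an end of the first one, and
  only \<open>2\<close> and \<open>4\<close> an end of the second.
\<close>

lemma certificate_star:
  assumes T: "T \<subseteq> V" "\<And>k. w p k \<in> T \<longleftrightarrow> even k \<and> \<not> M dvd k"
  shows "\<exists>g :: (vertex, 'k::field) vpoly. certificate T 5 g"
proof -
  have iso: "x = b" if x: "x = w p 1 \<or> x = w p (-1)" and c: "conn (V - T) x b" for x b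
  proof (rule conn_isolated[OF c])
    fix y assume "y \<in> V - T"
    moreover then obtain j where "y = w p j" using w_cases by blast
    ultimately show "\<not> adj x y" using x T w_rep[of j 0 p] by (auto simp: w_adj)
  qed
  have out: "w p k \<in> V - T" if "odd k \<or> k = 0" for k using that T by auto
  let ?g = "xv (w p 0) * (br (w p (-1)) (w p (-3)) * br (w p 1) (w p 3)) :: (vertex, 'k) vpoly"
  have h: "homogeneous (1 + (2 + 2)) ?g"
    by (intro homogeneous_mult homogeneous_br homogeneous_xv)
  have notin: "br (w p (-1)) (w p (-3)) \<notin> (P_ideal (G_graph n) T :: (vertex, 'k) vpoly set)"
    "br (w p 1) (w p 3) \<notin> (P_ideal (G_graph n) T :: (vertex, 'k) vpoly set)"
  proof -
    have nc: "\<not> conn (V - T) (w p (-1)) (w p (-3))" "\<not> conn (V - T) (w p 1) (w p 3)"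
      using iso[of "w p (-1)" "w p (-3)"] iso[of "w p 1" "w p 3"] by (auto simp: w_eq)
    show "br (w p (-1)) (w p (-3)) \<notin> (P_ideal (G_graph n) T :: (vertex, 'k) vpoly set)"
      by (rule br_notin_P[OF T(1) out out nc(1)]) auto
    show "br (w p 1) (w p 3) \<notin> (P_ideal (G_graph n) T :: (vertex, 'k) vpoly set)"
      by (rule br_notin_P[OF T(1) out out nc(2)]) auto
  qed
  have "certificate T 5 ?g"
  proof (rule certificateI[where p = p, OF T(1)])
    show "kill ?g (w p k)" if k: "w p k \<in> T" for k
    proof (rule kill_mult, rule kill_br2)
      obtain x where x: "w p k = x" by blast
      have "adj x (w p (- 1)) \<and> adj x (w p (- 3)) \<or> x \<in> {w p (-2), w p (-4)}"
        using k T unfolding x[symmetric] by (auto simp: w_adj w_eq add.commute)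
      then show "adj (w p k) (w p (- 1)) \<and> adj (w p k) (w p (- 3)) \<or> adj (w p k) (w p 1) \<and>
          adj (w p k) (w p 3)"
        unfolding x by (auto simp: w_adj)
    qed simp_all
    show "?g * br a b \<in> JG" if ab: "a \<in> V - T" "b \<in> V - T" "a \<noteq> b" "conn (V - T) a b" "\<not> adj a b"
        for a b
    proof -
      have near: "x = w p 0 \<or> adj (w p 0) x" if x: "x \<in> V - T" "y \<noteq> x" "conn (V - T) x y" for x y
      proof -
        obtain i where i: "x = w p i" using x w_cases by blast
        have "x \<noteq> w p 1" "x \<noteq> w p (-1)" using iso x by blast+
        then have "\<not> M dvd (i - 1)" "\<not> M dvd (i + 1)" by (auto simp: i w_eq)
        then have "\<not> M dvd (- i - 1)" "\<not> M dvd (- i + 1)"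
          by (simp_all only: M_dvd_neg not_False_eq_True)
        then show ?thesis using x T by (auto simp: i w_adj w_eq)
      qed
      have "adj (w p 0) a" "adj (w p 0) b"
        using near[of a b] near[of b a] ab conn_sym adj_sym by blast+
      then show ?thesis
        using ab by (intro in_JG[OF xv_br_in_JG[of "w p 0" a b],
            of "br (w p (-1)) (w p (-3)) * br (w p 1) (w p 3)"])
          (simp_all add: mult_ac)
    qed
  qed (use h in \<open>simp_all add: P_ideal_mult_iff[OF T(1)] notin xv_notin_P[OF T(1) out]\<close>)
  then show ?thesis by blast
qed

text \<open>
  \<open>V - T\<close> is the even side together with \<open>w(1)\<close> and \<open>w(-1)\<close>, and \<open>w(0)\<close> is isolated in it. The variables at
  \<open>-1, 1, 4\<close> connect the big component. A vertex of \<open>T\<close> kills the bracket \<open>[0, -2]\<close> unless it misses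
  \<open>-2\<close>; this happens only at \<open>-3\<close>, where \<open>-2\<close> is exchanged for \<open>4\<close>.
\<close>

lemma certificate_double_star:
  assumes T: "T \<subseteq> V" "\<And>k. w p k \<in> T \<longleftrightarrow> odd k \<and> \<not> M dvd (k - 1) \<and> \<not> M dvd (k + 1)"
  shows "\<exists>g :: (vertex, 'k::field) vpoly. certificate T 5 g"
proof -
  have iso: "w p 0 = b" if c: "conn (V - T) (w p 0) b" for b
  proof (rule conn_isolated[OF c])
    fix y assume "y \<in> V - T"
    moreover then obtain j where j: "y = w p j" using w_cases by blast
    ultimately have "even j \<or> y = w p 1 \<or> y = w p (-1)" using T by (auto simp: w_eq)
    then consider "even j" | "y = w p 1" | "y = w p (-1)" by blast
    then show "\<not> adj (w p 0) y"
    proof cases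
      case 1
      then show ?thesis by (simp add: j w_adj)
    qed (simp_all add: w_adj)
  qed
  have out: "w p k \<in> V - T" if "even k \<or> k = 1 \<or> k = -1" for k
  proof -
    have "w p k \<notin> T" unfolding T(2) using that by (elim disjE) simp_all
    then show ?thesis by simp
  qed
  let ?S = "{w p (-1), w p 1, w p 4}"
  let ?g = "xv (w p (-1)) * (xv (w p 1) * (xv (w p 4) * br (w p 0) (w p (-2)))) :: (vertex, 'k) vpoly"
  have "homogeneous (1 + (1 + (1 + 2))) ?g"
    by (intro homogeneous_mult homogeneous_br homogeneous_xv)
  then have h: "homogeneous 5 ?g" by (simp add: eval_nat_numeral)
  have notin: "br (w p 0) (w p (-2)) \<notin> (P_ideal (G_graph n) T :: (vertex, 'k) vpoly set)"
    using iso[of "w p (-2)"] by (intro br_notin_P[OF T(1) out out]) (auto simp: w_eq)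
  have "conn ?S (w p 1) (w p 4)" "conn ?S (w p (-1)) (w p 4)"
    by (rule conn_adj; simp add: w_adj)+
  then have toc: "conn ?S s (w p 4)" if "s \<in> ?S" for s using that by auto
  have Sconn: "conn ?S s s'" if "s \<in> ?S" "s' \<in> ?S" for s s'
    using conn_trans[OF toc[OF that(1)] conn_sym[OF toc[OF that(2)]]] .
  have "certificate T 5 ?g"
  proof (rule certificateI[where p = p, OF T(1) _ h])
    show "kill ?g (w p k)" if k: "w p k \<in> T" for k
    proof (cases "adj (w p k) (w p (-2))")
      case True
      then have "kill (br (w p 0) (w p (-2)) :: (vertex, 'k) vpoly) (w p k)"
        using k T by (intro kill_br) (auto simp: w_adj)
      then show ?thesis by (intro kill_mult) auto
    next
      case False
      then have "M dvd (k + 2 - 1) \<or> M dvd (k + 2 + 1)" "\<not> M dvd (k + 1)" using k T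
        by (auto simp: w_adj)
      then have "w p k = w p (-3)" by (intro w_rep) (auto simp: add.commute)
      moreover have "kill (xv (w p 1) * (xv (w p 4) * br (w p 0) (w p (-2))) :: (vertex,
          'k) vpoly) (w p (-3))"
        by (rule kill_exchange) (simp_all add: w_adj)
      ultimately show ?thesis by (simp add: kill_mult)
    qed
    show "?g * br a b \<in> JG" if ab: "a \<in> V - T" "b \<in> V - T" "a \<noteq> b" "conn (V - T) a b" "\<not> adj a b"
        for a b
    proof -
      have near: "\<exists>s\<in>?S. adj x s" if x: "x \<in> V - T" "y \<noteq> x" "conn (V - T) x y" for x y
      proof -
        obtain i where i: "x = w p i" using x w_cases by blast
        have "x \<noteq> w p 0" using iso x by blast
        then have i0: "\<not> M dvd i" by (auto simp: i w_eq)
        show ?thesis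
        proof (cases "even i")
          case True
          show ?thesis
          proof (cases "M dvd (i - 2)")
            case True
            then have "x = w p 2" using w_rep i by blast
            then show ?thesis by (simp add: w_adj)
          next
            case False
            then show ?thesis using i0 True by (simp add: i w_adj)
          qed
        next
          case False
          then have "x = w p 1 \<or> x = w p (-1)" using x T by (auto simp: i w_eq)
          then show ?thesis by (auto simp: w_adj)
        qed
      qed
      obtain s s' where s: "s \<in> ?S" "adj a s" "s' \<in> ?S" "adj b s'"
        using near[of a b] near[of b a] ab conn_sym by blast
      have "(\<Prod>u\<in>?S. xv u) * br a b \<in> (JG :: (vertex, 'k) vpoly set)"
        by (rule prod_br_in_JG[OF _ s(1,2,4) Sconn[OF s(1,3)]]) auto
      then show ?thesis
        by (rule in_JG[where r = "br (w p 0) (w p (-2))"]) (simp_all add: w_eq mult_ac)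
    qed
  qed (use notin in \<open>simp_all add: P_ideal_mult_iff[OF T(1)] xv_notin_P[OF T(1) out]\<close>)
  then show ?thesis by blast
qed

text \<open>
  The components are the edges \<open>{-2, 1}\<close> and \<open>{-1, 2}\<close> and the vertex \<open>0\<close>. Even vertices of \<open>T\<close> are
  adjacent to \<open>1\<close> and \<open>-1\<close>; an odd one is adjacent to \<open>0\<close> and misses at most one of \<open>2\<close> and \<open>-2\<close>.
\<close>

lemma certificate_P5:
  assumes T: "T \<subseteq> V" "V - T = {w p (-2), w p (-1), w p 0, w p 1, w p 2}"
  shows "\<exists>g :: (vertex, 'k::field) vpoly. certificate T 6 g"
proof -
  have A: "y \<in> {w p (-2), w p 1}" if "conn (V - T) x y" "x \<in> {w p (-2), w p 1}" for x y
    by (rule conn_closed[OF that]) (auto simp: T(2) w_adj)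
  have B: "y \<in> {w p (-1), w p 2}" if "conn (V - T) x y" "x \<in> {w p (-1), w p 2}" for x y
    by (rule conn_closed[OF that]) (auto simp: T(2) w_adj)
  have C: "y = w p 0" if "conn (V - T) (w p 0) y" for y
    by (rule conn_isolated[OF that, symmetric]) (auto simp: T(2) w_adj)
  have C': "y = w p 0" if "conn (V - T) y (w p 0)" for y using C conn_sym that by blast
  let ?g = "br (w p 1) (w p (-1)) * br (w p 0) (w p 2) * br (w p 0) (w p (-2)) :: (vertex, 'k) vpoly"
  have h: "homogeneous (2 + 2 + 2) ?g" by (intro homogeneous_mult homogeneous_br)
  have in': "w p (-2) \<in> V - T" "w p (-1) \<in> V - T" "w p 0 \<in> V - T" "w p 1 \<in> V - T" "w p 2 \<in> V - T"
    by (simp_all add: T(2))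
  have notin: "br (w p 1) (w p (-1)) \<notin> (P_ideal (G_graph n) T :: (vertex, 'k) vpoly set)"
    "br (w p 0) (w p 2) \<notin> (P_ideal (G_graph n) T :: (vertex, 'k) vpoly set)"
    "br (w p 0) (w p (-2)) \<notin> (P_ideal (G_graph n) T :: (vertex, 'k) vpoly set)"
  proof -
    have nc: "\<not> conn (V - T) (w p 1) (w p (-1))" "\<not> conn (V - T) (w p 0) (w p 2)"
        "\<not> conn (V - T) (w p 0) (w p (-2))"
      using A[of "w p 1" "w p (-1)"] C[of "w p 2"] C[of "w p (-2)"] by (auto simp: w_eq)
    show "br (w p 1) (w p (-1)) \<notin> (P_ideal (G_graph n) T :: (vertex, 'k) vpoly set)"
      by (rule br_notin_P[OF T(1) in'(4,2) nc(1)])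
    show "br (w p 0) (w p 2) \<notin> (P_ideal (G_graph n) T :: (vertex, 'k) vpoly set)"
      by (rule br_notin_P[OF T(1) in'(3,5) nc(2)])
    show "br (w p 0) (w p (-2)) \<notin> (P_ideal (G_graph n) T :: (vertex, 'k) vpoly set)"
      by (rule br_notin_P[OF T(1) in'(3,1) nc(3)])
  qed
  have "certificate T 6 ?g"
  proof (rule certificateI[where p = p, OF T(1)])
    show "kill ?g (w p k)" if k: "w p k \<in> T" for k
    proof (rule kill_br3)
      have "w p k \<notin> {w p (-2), w p (-1), w p 0, w p 1, w p 2}" using k T(2) by blast
      then have nk: "\<not> M dvd (k + 2)" "\<not> M dvd (k + 1)" "\<not> M dvd k" "\<not> M dvd (k - 1)" "\<not> M dvd (k - 2)"
        by (auto simp: w_eq)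
      show "adj (w p k) (w p 1) \<and> adj (w p k) (w p (- 1)) \<or> adj (w p k) (w p 0) \<and> adj (w p k) (w p 2) \<or>
          adj (w p k) (w p 0) \<and> adj (w p k) (w p (- 2))"
      proof (cases "even k")
        case True
        then show ?thesis using nk by (simp add: w_adj add.commute)
      next
        case False
        have "\<not> (M dvd (k - 3) \<and> M dvd (k + 3))" using M_sep[of "k - 3" "k + 3"] M_ge by auto
        then show ?thesis using nk False by (auto simp: w_adj add.commute)
      qed
    qed simp_all
    show "?g * br a b \<in> JG" if ab: "a \<in> V - T" "b \<in> V - T" "a \<noteq> b" "conn (V - T) a b" "\<not> adj a b"
        for a b
    proof -
      have "a \<in> {w p (-2), w p 1} \<or> a \<in> {w p (-1), w p 2} \<or> a = w p 0" using ab T(2) by blast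
      then have False
        using A[OF ab(4)] B[OF ab(4)] C[of b] ab by (auto simp: w_adj)
      then show ?thesis ..
    qed
  qed (use h in \<open>simp_all add: P_ideal_mult_iff[OF T(1)] notin\<close>)
  then show ?thesis by blast
qed

text \<open>
  Both terms of a bracket with \<open>c\<close> contain a variable of \<open>c\<close>, so the bracket can replace this variable.
\<close>

lemma br_br_in_JG:
  fixes a b c d :: vertex
  assumes "adj c a" "adj c b" "d \<in> V"
  shows "br c d * br a b \<in> (JG :: (vertex, 'k::field) vpoly set)"
    and "br d c * br a b \<in> (JG :: (vertex, 'k::field) vpoly set)"
proof -
  have k: "xv c * br a b \<in> (JG :: (vertex, 'k) vpoly set)"
      "yv c * br a b \<in> (JG :: (vertex, 'k) vpoly set)"
  proof -
    have "kill (br a b :: (vertex, 'k) vpoly) c" using kill_br assms by blast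
    then show "xv c * br a b \<in> (JG :: (vertex, 'k) vpoly set)"
        "yv c * br a b \<in> (JG :: (vertex, 'k) vpoly set)"
      by (auto simp: kill_def)
  qed
  have "yv d * (xv c * br a b) + (- xv d) * (yv c * br a b) \<in> (JG :: (vertex, 'k) vpoly set)"
    "(- yv d) * (xv c * br a b) + xv d * (yv c * br a b) \<in> (JG :: (vertex, 'k) vpoly set)"
    by (rule JG_add[OF JG_mult[OF k(1)] JG_mult[OF k(2)]]; use assms(3) in simp)+
  then show "br c d * br a b \<in> (JG :: (vertex, 'k::field) vpoly set)"
    "br d c * br a b \<in> (JG :: (vertex, 'k::field) vpoly set)"
    by (simp_all add: br_def algebra_simps)
qed

text \<open>
  The components are the stars with centres \<open>0\<close> and \<open>m\<close> and leaves \<open>m \<plusminus> 1\<close> and \<open>\<plusminus>1\<close>. The bracket \<open>[0, m]\<close>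
  serves for the brackets of leaves and for the odd vertices of \<open>T\<close>. The leaves are paired as \<open>1, m - 1\<close>
  and \<open>-1, m + 1\<close>: an even vertex of \<open>T\<close> that misses an end of the first pair is at \<open>2\<close> or \<open>m - 2\<close>, one that
  misses an end of the second pair at \<open>-2\<close> or \<open>m + 2\<close>, and no vertex does both.
\<close>

lemma certificate_two_P3_even:
  assumes T: "T \<subseteq> V" "V - T = {w p (-1), w p 0, w p 1, w p (m - 1), w p m, w p (m + 1)}"
    and m: "even m" "\<not> M dvd m" "\<not> M dvd (m - 2)" "\<not> M dvd (m + 2)"
  shows "\<exists>g :: (vertex, 'k::field) vpoly. certificate T 6 g"
proof -
  have m': "\<not> M dvd (- m - 2)" "\<not> M dvd (2 - m)"
    "\<not> M dvd (- 2 - m)" "\<not> M dvd (2 + m)"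
    using m M_dvd_neg(1)[of m 2] M_dvd_neg(1)[of 2 m]
      by (simp_all add: dvd_diff_commute[of M 2 m] add.commute)
  note ms = m m'
  have A: "y \<in> {w p 0, w p (m - 1), w p (m + 1)}"
      if "conn (V - T) x y" "x \<in> {w p 0, w p (m - 1), w p (m + 1)}" for x y
    by (rule conn_closed[OF that]) (use ms in \<open>auto simp: T(2) w_adj\<close>)
  have B: "y \<in> {w p m, w p (- 1), w p 1}" if "conn (V - T) x y" "x \<in> {w p m, w p (- 1), w p 1}" for x y
    by (rule conn_closed[OF that]) (use ms in \<open>auto simp: T(2) w_adj\<close>)
  have AB: "\<not> conn (V - T) x y" "\<not> conn (V - T) y x"
    if "x \<in> {w p 0, w p (m - 1), w p (m + 1)}" "y \<in> {w p m, w p (- 1), w p 1}" for x y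
  proof -
    have "{w p 0, w p (m - 1), w p (m + 1)} \<inter> {w p m, w p (- 1), w p 1} = {}"
      using ms M_even[of "m - 1"] M_even[of "m + 1"] by (auto simp: w_eq)
    then show "\<not> conn (V - T) x y" "\<not> conn (V - T) y x" using A[of x y] B[of y x] that by blast+
  qed
  let ?g = "br (w p 0) (w p m) * br (w p 1) (w p (m - 1)) * br (w p (-1)) (w p (m + 1)) :: (vertex,
      'k) vpoly"
  have h: "homogeneous (2 + 2 + 2) ?g" by (intro homogeneous_mult homogeneous_br)
  have in': "w p (-1) \<in> V - T" "w p 0 \<in> V - T" "w p 1 \<in> V - T" "w p (m - 1) \<in> V - T" "w p m \<in> V - T"
    "w p (m + 1) \<in> V - T" by (simp_all add: T(2))
  have notin: "br (w p 0) (w p m) \<notin> (P_ideal (G_graph n) T :: (vertex, 'k) vpoly set)"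
    "br (w p 1) (w p (m - 1)) \<notin> (P_ideal (G_graph n) T :: (vertex, 'k) vpoly set)"
    "br (w p (-1)) (w p (m + 1)) \<notin> (P_ideal (G_graph n) T :: (vertex, 'k) vpoly set)"
  proof -
    show "br (w p 0) (w p m) \<notin> (P_ideal (G_graph n) T :: (vertex, 'k) vpoly set)"
      by (rule br_notin_P[OF T(1) in'(2,5) AB(1)]) auto
    show "br (w p 1) (w p (m - 1)) \<notin> (P_ideal (G_graph n) T :: (vertex, 'k) vpoly set)"
      by (rule br_notin_P[OF T(1) in'(3,4) AB(2)]) auto
    show "br (w p (-1)) (w p (m + 1)) \<notin> (P_ideal (G_graph n) T :: (vertex, 'k) vpoly set)"
      by (rule br_notin_P[OF T(1) in'(1,6) AB(2)]) auto
  qed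
  have "certificate T 6 ?g"
  proof (rule certificateI[where p = p, OF T(1)])
    show "kill ?g (w p k)" if k: "w p k \<in> T" for k
    proof (rule kill_br3)
      have "w p k \<notin> {w p (-1), w p 0, w p 1, w p (m - 1), w p m, w p (m + 1)}" using k T(2) by blast
      then have nk: "\<not> M dvd (k + 1)" "\<not> M dvd k" "\<not> M dvd (k - 1)" "\<not> M dvd (k - m + 1)"
          "\<not> M dvd (k - m)" "\<not> M dvd (k - m - 1)"
        by (auto simp: w_eq algebra_simps)
      show "adj (w p k) (w p 0) \<and> adj (w p k) (w p m) \<or> adj (w p k) (w p 1) \<and>
          adj (w p k) (w p (m - 1)) \<or>
          adj (w p k) (w p (- 1)) \<and> adj (w p k) (w p (m + 1))"
      proof (cases "even k")
        case False
        then show ?thesis using nk m by (simp add: w_adj)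
      next
        case True
        show ?thesis
        proof (rule ccontr)
          assume "\<not> ?thesis"
          then have "M dvd (k - 2) \<or> M dvd (k - m + 2)" "M dvd (k + 2) \<or> M dvd (k - m - 2)"
            using nk m True by (auto simp: w_adj algebra_simps)
          then show False
            using M_sep[of "k - 2" "k + 2"] M_sep[of "k - m + 2" "k - m - 2"] M_ge
              dvd_diff[of M "k - 2" "k - m - 2"] dvd_diff[of M "k + 2" "k - m + 2"] m(2) by auto
        qed
      qed
    qed simp_all
    show "?g * br a b \<in> JG" if ab: "a \<in> V - T" "b \<in> V - T" "a \<noteq> b" "conn (V - T) a b" "\<not> adj a b"
        for a b
    proof -
      have "a \<in> {w p 0, w p (m - 1), w p (m + 1)} \<or> a \<in> {w p m, w p (- 1), w p 1}" using ab T(2)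
        by blast
      then have "a \<in> {w p (m - 1), w p (m + 1)} \<and> b \<in> {w p (m - 1), w p (m + 1)} \<or>
          a \<in> {w p (- 1), w p 1} \<and> b \<in> {w p (- 1), w p 1}"
        using A[OF ab(4)] B[OF ab(4)] ab ms by (auto simp: w_adj)
      then have "br (w p 0) (w p m) * br a b \<in> (JG :: (vertex, 'k) vpoly set)"
      proof
        assume "a \<in> {w p (m - 1), w p (m + 1)} \<and> b \<in> {w p (m - 1), w p (m + 1)}"
        then show ?thesis using ms by (intro br_br_in_JG(1)) (auto simp: w_adj)
      next
        assume "a \<in> {w p (- 1), w p 1} \<and> b \<in> {w p (- 1), w p 1}"
        then show ?thesis using ms by (intro br_br_in_JG(2)) (auto simp: w_adj)
      qed
      then show ?thesis
        by (rule in_JG[where r = "br (w p 1) (w p (m - 1)) * br (w p (-1)) (w p (m +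
            1))"]) (simp_all add: mult_ac)
    qed
  qed (use h in \<open>simp_all add: P_ideal_mult_iff[OF T(1)] notin\<close>)
  then show ?thesis by blast
qed

text \<open>
  The components are the path \<open>3, 0, 5, 2\<close>, which the variables of \<open>0\<close> and \<open>5\<close> connect, and the edge
  \<open>{1, 4}\<close>. All even vertices of \<open>T\<close> kill \<open>[1, 3]\<close> and all odd ones kill \<open>[2, 4]\<close>.
\<close>

lemma certificate_P6:
  assumes T: "T \<subseteq> V" "V - T = {w p 0, w p 1, w p 2, w p 3, w p 4, w p 5}"
  shows "\<exists>g :: (vertex, 'k::field) vpoly. certificate T 6 g"
proof -
  let ?A = "{w p 0, w p 2, w p 3, w p 5}" and ?B = "{w p 1, w p 4}"
  have A: "y \<in> ?A" if "conn (V - T) x y" "x \<in> ?A" for x y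
    by (rule conn_closed[OF that]) (auto simp: T(2) w_adj)
  have B: "y \<in> ?B" if "conn (V - T) x y" "x \<in> ?B" for x y
    by (rule conn_closed[OF that]) (auto simp: T(2) w_adj)
  let ?S = "{w p 0, w p 5}"
  let ?g = "xv (w p 0) * (xv (w p 5) * (br (w p 1) (w p 3) * br (w p 2) (w p 4))) :: (vertex, 'k) vpoly"
  have "homogeneous (1 + (1 + (2 + 2))) ?g"
    by (intro homogeneous_mult homogeneous_br homogeneous_xv)
  then have h: "homogeneous 6 ?g" by (simp add: eval_nat_numeral)
  have in': "w p 0 \<in> V - T" "w p 1 \<in> V - T" "w p 2 \<in> V - T" "w p 3 \<in> V - T" "w p 4 \<in> V - T"
      "w p 5 \<in> V - T"
    by (simp_all add: T(2))
  have notin: "br (w p 1) (w p 3) \<notin> (P_ideal (G_graph n) T :: (vertex, 'k) vpoly set)"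
    "br (w p 2) (w p 4) \<notin> (P_ideal (G_graph n) T :: (vertex, 'k) vpoly set)"
  proof -
    have nc: "\<not> conn (V - T) (w p 1) (w p 3)" "\<not> conn (V - T) (w p 2) (w p 4)"
      using B[of "w p 1" "w p 3"] A[of "w p 2" "w p 4"] by (auto simp: w_eq)
    show "br (w p 1) (w p 3) \<notin> (P_ideal (G_graph n) T :: (vertex, 'k) vpoly set)"
      by (rule br_notin_P[OF T(1) in'(2,4) nc(1)])
    show "br (w p 2) (w p 4) \<notin> (P_ideal (G_graph n) T :: (vertex, 'k) vpoly set)"
      by (rule br_notin_P[OF T(1) in'(3,5) nc(2)])
  qed
  have "conn ?S (w p 0) (w p 5)" by (rule conn_adj; simp add: w_adj)
  then have Sconn: "conn ?S s s'" if "s \<in> ?S" "s' \<in> ?S" for s s'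
    using that conn_sym by auto
  have "certificate T 6 ?g"
  proof (rule certificateI[where p = p, OF T(1) _ h])
    show "kill ?g (w p k)" if k: "w p k \<in> T" for k
    proof (rule kill_mult, rule kill_mult, rule kill_br2)
      have "w p k \<notin> {w p 0, w p 1, w p 2, w p 3, w p 4, w p 5}" using k T(2) by blast
      then have nk: "\<not> M dvd k" "\<not> M dvd (k - 1)" "\<not> M dvd (k - 2)" "\<not> M dvd (k - 3)"
          "\<not> M dvd (k - 4)" "\<not> M dvd (k - 5)"
        by (auto simp: w_eq)
      then show "adj (w p k) (w p 1) \<and> adj (w p k) (w p 3) \<or> adj (w p k) (w p 2) \<and> adj (w p k) (w p 4)"
        by (auto simp: w_adj)
    qed simp_all
    show "?g * br a b \<in> JG" if ab: "a \<in> V - T" "b \<in> V - T" "a \<noteq> b" "conn (V - T) a b" "\<not> adj a b"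
        for a b
    proof -
      have "a \<in> ?A \<or> a \<in> ?B" using ab T(2) by blast
      moreover have "a \<notin> ?B"
      proof
        assume "a \<in> ?B"
        then show False using B[OF ab(4)] ab by (auto simp: w_adj)
      qed
      ultimately have "a \<in> ?A" "b \<in> ?A" using A[OF ab(4)] by blast+
      moreover have near: "\<exists>s\<in>?S. adj x s" if "x \<in> ?A" for x using that by (auto simp: w_adj)
      ultimately obtain s s' where s: "s \<in> ?S" "adj a s" "s' \<in> ?S" "adj b s'" by meson
      have "(\<Prod>u\<in>?S. xv u) * br a b \<in> (JG :: (vertex, 'k) vpoly set)"
        by (rule prod_br_in_JG[OF _ s(1,2,4) Sconn[OF s(1,3)]]) auto
      then show ?thesis
        by (rule in_JG[where r = "br (w p 1) (w p 3) * br (w p 2) (w p 4)"]) (simp_all add: w_eq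
            mult_ac)
    qed
  qed (use notin in \<open>simp_all add: P_ideal_mult_iff[OF T(1)] xv_notin_P[OF T(1) in'(1)]
      xv_notin_P[OF T(1) in'(6)]\<close>)
  then show ?thesis by blast
qed

text \<open>
  The components are the edge \<open>{0, m}\<close> and the four-cycle on \<open>\<plusminus>1\<close> and \<open>m \<plusminus> 1\<close>. The bracket \<open>[m, -1]\<close> is killed by
  the even vertices of \<open>T\<close> except the one at \<open>-2\<close>, which misses \<open>-1\<close>; there \<open>-1\<close> is exchanged for \<open>1\<close>. The
  bracket \<open>[0, m - 1]\<close> serves the odd vertices in the same way, and the variables of \<open>1\<close> and \<open>m + 1\<close> that
  pay for the exchange also connect the four-cycle.
\<close>

lemma certificate_two_P3_odd:
  assumes T: "T \<subseteq> V" "V - T = {w p (-1), w p 0, w p 1, w p (m - 1), w p m, w p (m + 1)}"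
    and m: "odd m" "\<not> M dvd (m - 1)" "\<not> M dvd (m + 1)" "\<not> M dvd (m - 3)" "\<not> M dvd (m + 3)"
  shows "\<exists>g :: (vertex, 'k::field) vpoly. certificate T 6 g"
proof -
  have m': "\<not> M dvd (- m - 1)" "\<not> M dvd (1 - m)" "\<not> M dvd (- m - 3)" "\<not> M dvd (3 - m)"
    "\<not> M dvd (- 1 - m)" "\<not> M dvd (- 3 - m)" "\<not> M dvd (1 + m)" "\<not> M dvd (3 + m)"
    using m M_dvd_neg(1)[of m 1] M_dvd_neg(1)[of 1 m] M_dvd_neg(1)[of m 3] M_dvd_neg(1)[of 3 m]
    by (simp_all add: dvd_diff_commute[of M 1 m] dvd_diff_commute[of M 3 m] add.commute)
  note ms = m m'
  let ?A = "{w p (-1), w p 1, w p (m - 1), w p (m + 1)}" and ?B = "{w p 0, w p m}"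
  have A: "y \<in> ?A" if "conn (V - T) x y" "x \<in> ?A" for x y
    by (rule conn_closed[OF that]) (use ms in \<open>auto simp: T(2) w_adj\<close>)
  have B: "y \<in> ?B" if "conn (V - T) x y" "x \<in> ?B" for x y
    by (rule conn_closed[OF that]) (use ms in \<open>auto simp: T(2) w_adj\<close>)
  have "?A \<inter> ?B = {}"
    using ms M_even[of "m - 2"] M_even[of "m"] by (auto simp: w_eq)
  then have AB: "\<not> conn (V - T) x y" if "x \<in> ?B" "y \<in> ?A" for x y
    using B[of x y] that by blast
  let ?h1 = "xv (w p (m + 1)) * (xv (w p 1) * br (w p m) (w p (-1))) :: (vertex, 'k) vpoly"
  let ?h2 = "xv (w p 1) * (xv (w p (m + 1)) * br (w p 0) (w p (m - 1))) :: (vertex, 'k) vpoly"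
  let ?g = "br (w p 0) (w p (m - 1)) * ?h1"
  \<comment> \<open>The two arrangements of the factors, for the even and for the odd vertices of \<open>T\<close>.\<close>
  have g2: "?g = br (w p m) (w p (-1)) * ?h2" by (simp add: mult_ac)
  have "homogeneous (2 + (1 + (1 + 2))) ?g"
    by (intro homogeneous_mult homogeneous_br homogeneous_xv)
  then have h: "homogeneous 6 ?g" by (simp add: eval_nat_numeral)
  have in': "w p (-1) \<in> V - T" "w p 0 \<in> V - T" "w p 1 \<in> V - T" "w p (m - 1) \<in> V - T" "w p m \<in> V - T"
    "w p (m + 1) \<in> V - T" by (simp_all add: T(2))
  have notin: "br (w p 0) (w p (m - 1)) \<notin> (P_ideal (G_graph n) T :: (vertex, 'k) vpoly set)"
    "br (w p m) (w p (-1)) \<notin> (P_ideal (G_graph n) T :: (vertex, 'k) vpoly set)"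
  proof -
    show "br (w p 0) (w p (m - 1)) \<notin> (P_ideal (G_graph n) T :: (vertex, 'k) vpoly set)"
      by (rule br_notin_P[OF T(1) in'(2,4) AB]) auto
    show "br (w p m) (w p (-1)) \<notin> (P_ideal (G_graph n) T :: (vertex, 'k) vpoly set)"
      by (rule br_notin_P[OF T(1) in'(5,1) AB]) auto
  qed
  have "certificate T 6 ?g"
  proof (rule certificateI[where p = p, OF T(1) _ h])
    show "kill ?g (w p k)" if k: "w p k \<in> T" for k
    proof -
      have "w p k \<notin> {w p (-1), w p 0, w p 1, w p (m - 1), w p m, w p (m + 1)}" using k T(2) by blast
      then have nk: "\<not> M dvd (k + 1)" "\<not> M dvd k" "\<not> M dvd (k - 1)" "\<not> M dvd (k - m + 1)"
          "\<not> M dvd (k - m)" "\<not> M dvd (k - m - 1)"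
        by (auto simp: w_eq algebra_simps)
      show ?thesis
      proof (cases "even k")
        case True
        then have km: "adj (w p k) (w p m)" using nk m by (simp add: w_adj)
        have "kill ?h1 (w p k)"
        proof (cases "adj (w p k) (w p (-1))")
          case True
          then show ?thesis using km by (intro kill_mult kill_br) auto
        next
          case False
          then have "w p k = w p (-2)" using True nk by (intro w_rep) (auto simp: w_adj add.commute)
          then show ?thesis using km ms by (intro kill_exchange) (simp_all add: w_adj)
        qed
        then show ?thesis by (rule kill_mult) auto
      next
        case False
        then have k0: "adj (w p k) (w p 0)" using nk m by (simp add: w_adj)
        have "kill ?h2 (w p k)"
        proof (cases "adj (w p k) (w p (m - 1))")
          case True
          then show ?thesis using k0 by (intro kill_mult kill_br) auto
        next
          case kF: False
          then have "w p k = w p (m - 2)" using False nk m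
            by (intro w_rep) (auto simp: w_adj algebra_simps)
          then show ?thesis using k0 ms by (intro kill_exchange) (simp_all add: w_adj)
        qed
        then show ?thesis unfolding g2 by (rule kill_mult) auto
      qed
    qed
    show "?g * br a b \<in> JG" if ab: "a \<in> V - T" "b \<in> V - T" "a \<noteq> b" "conn (V - T) a b" "\<not> adj a b"
        for a b
    proof -
      have "a \<in> ?A \<or> a \<in> ?B" using ab T(2) by blast
      then consider "a \<in> {w p (-1), w p 1}"
          "b \<in> {w p (-1), w p 1}" | "a \<in> {w p (m - 1), w p (m + 1)}" "b \<in> {w p (m - 1), w p (m + 1)}"
        using A[OF ab(4)] B[OF ab(4)] ab ms by (auto simp: w_adj)
      then show ?thesis
      proof cases
        case 1
        then have "adj (w p (m + 1)) a" "adj (w p (m + 1)) b" using ms by (auto simp: w_adj)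
        from in_JG[OF xv_br_in_JG[OF this],
            of "br (w p 0) (w p (m - 1)) * (xv (w p 1) * br (w p m) (w p (-1)))"]
        show ?thesis by (simp add: mult_ac)
      next
        case 2
        then have "adj (w p 1) a" "adj (w p 1) b" using ms by (auto simp: w_adj)
        from in_JG[OF xv_br_in_JG[OF this], of "br (w p 0) (w p (m - 1)) * (xv (w p (m +
            1)) * br (w p m) (w p (-1)))"]
        show ?thesis by (simp add: mult_ac)
      qed
    qed
  qed (use notin in \<open>simp_all add: P_ideal_mult_iff[OF T(1)] xv_notin_P[OF T(1) in'(3)]
      xv_notin_P[OF T(1) in'(6)]\<close>)
  then show ?thesis by blast
qed


section \<open>Lower bounds for the types of cut sets\<close>

lemma two_neighbours:
  assumes T: "T \<subseteq> V" and f: "witness T \<alpha> (f :: (vertex, 'k::field) vpoly)" and k: "w p k \<in> T"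
  obtains a b where "a \<in> V - T" "b \<in> V - T" "adj (w p k) a" "adj (w p k) b" "\<alpha> a \<noteq> 0" "\<alpha> b \<noteq> 0" "a \<noteq> b"
    "\<not> conn (V - T) a b"
proof -
  obtain a b where ab: "adj (w p k) a" "adj (w p k) b" "\<alpha> a \<noteq> 0" "\<alpha> b \<noteq> 0" "\<not> conn (V - T) a b"
    using witness_two_neighbours[OF T f k] by blast
  moreover have "a \<noteq> b" using ab(5) by auto
  moreover have "a \<in> V - T" "b \<in> V - T"
    using ab witness_outside[OF T f, of a] witness_outside[OF T f,
        of b] adj_V[OF ab(1)] adj_V[OF ab(2)] by auto
  ultimately show ?thesis using that by blast
qed

lemma both_neighbours:
  assumes "T \<subseteq> V" "witness T \<alpha> (f :: (vertex, 'k::field) vpoly)" "w p k \<in> T"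
    and "\<And>c. c \<in> V - T \<Longrightarrow> adj (w p k) c \<Longrightarrow> c = x \<or> c = y"
  shows "\<alpha> x \<noteq> 0 \<and> \<alpha> y \<noteq> 0"
proof -
  obtain a b where "a \<in> V - T" "b \<in> V - T" "adj (w p k) a" "adj (w p k) b" "\<alpha> a \<noteq> 0" "\<alpha> b \<noteq> 0" "a \<noteq> b"
    using two_neighbours[OF assms(1-3)] by blast
  then show ?thesis using assms(4)[of a] assms(4)[of b] by metis
qed

lemma separate_neighbour:
  assumes "T \<subseteq> V" "witness T \<alpha> (f :: (vertex, 'k::field) vpoly)" "w p k \<in> T"
    and "\<And>c. c \<in> V - T \<Longrightarrow> adj (w p k) c \<Longrightarrow> c = x \<or> c = y \<or> c = z" "conn (V - T) y z"
  shows "\<alpha> x \<noteq> 0"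
proof -
  obtain a b where "a \<in> V - T" "b \<in> V - T" "adj (w p k) a" "adj (w p k) b" "\<alpha> a \<noteq> 0" "\<alpha> b \<noteq> 0"
    "\<not> conn (V - T) a b"
    using two_neighbours[OF assms(1-3)] by blast
  then show ?thesis using assms(4)[of a] assms(4)[of b] assms(5) conn_sym[OF assms(5)] conn_refl
    by metis
qed

lemma supp_outside:
  assumes "T \<subseteq> V" "witness T \<alpha> (f :: (vertex, 'k::field) vpoly)" "v \<in> V" "\<alpha> v \<noteq> 0"
  shows "v \<in> V - T"
  using assms(3,4) witness_outside[OF assms(1,2), of v] by auto

text \<open>
  The support contains the centre \<open>w(0)\<close>, since without it the star would fall apart. The vertices at
  \<open>-2\<close> and \<open>2\<close> force \<open>w(1)\<close> and \<open>w(-1)\<close> into it, and each forces a further vertex of the same side. If the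
  degree is only 4, then both force the same vertex \<open>w(x)\<close>, and the witness is linear in \<open>w(1)\<close>. It
  vanishes if \<open>w(1)\<close> is parallel to \<open>w(-1)\<close>, because of the vertex at \<open>x + 1\<close>, which misses \<open>w(x)\<close>, and if
  \<open>w(1)\<close> is parallel to \<open>w(x)\<close>, because of the vertex at \<open>-2\<close>, which misses \<open>w(-1)\<close>.
\<close>

lemma lower_star:
  assumes T: "T \<subseteq> V" "\<And>k. w p k \<in> T \<longleftrightarrow> even k \<and>
      \<not> M dvd k" and f: "witness T \<alpha> (f :: (vertex, 'k::field) vpoly)"
  shows "5 \<le> (\<Sum>v\<in>V. \<alpha> v)"
proof (rule ccontr)
  assume less: "\<not> ?thesis"
  have out: "w p k \<in> V - T" if "odd k \<or> k = 0" for k using that T by auto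
  have rep: "\<exists>i. x = w p i \<and> (odd i \<or> x = w p 0)" if x: "x \<in> V - T" for x
  proof -
    obtain i where i: "x = w p i" using x w_cases by blast
    moreover have "w p i \<notin> T" using x i by simp
    then have "odd i \<or> w p i = w p 0" unfolding T(2) w_eq by simp
    ultimately show ?thesis by blast
  qed
  have a0: "\<alpha> (w p 0) \<noteq> 0"
  proof -
    let ?U = "{v \<in> V. \<alpha> v \<noteq> 0} \<union> {w p 3, w p 5}"
    have "conn (V - T) (w p 3) (w p 5)"
      by (rule conn_path2[of _ "w p 0"]) (simp_all add: w_adj out del: Diff_iff)
    then obtain c where c: "c \<in> ?U" "adj (w p 3) c"
      using witness_not_isolated[OF T(1) f, of ?U "w p 3" "w p 5"] supp_outside[OF T(1) f] out
      by (auto simp: w_eq)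
    then have "c \<in> V - T" using supp_outside[OF T(1) f] out[of 3] out[of 5] by auto
    then have "c = w p 0" using rep[of c] c by (auto simp: w_adj)
    then show ?thesis using c by (auto simp: w_eq)
  qed
  have nb: "(\<exists>s. s = e \<and> \<alpha> (w p s) \<noteq> 0) \<and> (\<exists>x. odd x \<and> \<not> M dvd (x - 1) \<and> \<not> M dvd (x + 1) \<and>
      \<not> M dvd (x + 3 * e) \<and> \<alpha> (w p x) \<noteq> 0)"
    if e: "e = 1 \<or> e = -1" for e
  proof -
    have "w p (- 2 * e) \<in> T" using e by (auto simp: T(2))
    then obtain a b where ab: "a \<in> V - T" "b \<in> V - T" "adj (w p (- 2 * e)) a"
        "adj (w p (- 2 * e)) b" "\<alpha> a \<noteq> 0" "\<alpha> b \<noteq> 0" "a \<noteq> b"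
      "\<not> conn (V - T) a b" using two_neighbours[OF T(1) f] by blast
    have far: "\<exists>x. c = w p x \<and> odd x \<and> \<not> M dvd (x - 1) \<and> \<not> M dvd (x + 1) \<and> \<not> M dvd (x + 3 * e) \<and>
        adj c (w p 0)"
      if c: "c \<in> V - T" "adj (w p (- 2 * e)) c" "c \<noteq> w p e" for c
    proof -
      obtain i where i: "c = w p i" "odd i" using rep[OF c(1)] c(2) e by (auto simp: w_adj)
      have 1: "\<not> M dvd (i - e)" using c i by (simp add: w_eq)
      have "\<not> M dvd (i + e)" "\<not> M dvd (i + 3 * e)"
        using c(2) e dvd_diff_commute[of M "- 2 * e - 1" i] dvd_diff_commute[of M "- 2 * e + 1" i]
        by (auto simp: i w_adj algebra_simps)
      then have "\<not> M dvd (i - 1)" "\<not> M dvd (i + 1)" "\<not> M dvd (i + 3 * e)" using 1 e by auto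
      then show ?thesis using i by (auto simp: w_adj)
    qed
    have "\<alpha> (w p e) \<noteq> 0"
    proof
      assume "\<alpha> (w p e) = 0"
      then have "a \<noteq> w p e" "b \<noteq> w p e" using ab by auto
      then have "adj a (w p 0)" "adj b (w p 0)" using far[OF ab(1,3)] far[OF ab(2,4)] by auto
      then show False using conn_path2[of a "w p 0" b "V - T"] ab out[of 0] adj_sym by auto
    qed
    moreover have "a \<noteq> w p e \<or> b \<noteq> w p e" using ab by blast
    ultimately show ?thesis using far[of a] far[of b] ab by blast
  qed
  have a1: "\<alpha> (w p 1) \<noteq> 0" "\<alpha> (w p (-1)) \<noteq> 0" using nb[of 1] nb[of "-1"] by auto
  obtain x where x: "odd x" "\<not> M dvd (x - 1)" "\<not> M dvd (x + 1)" "\<not> M dvd (x - 3)" "\<alpha> (w p x) \<noteq> 0"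
    using nb[of "-1"] by auto
  obtain y where y: "odd y" "\<not> M dvd (y - 1)" "\<not> M dvd (y + 1)" "\<not> M dvd (y + 3)" "\<alpha> (w p y) \<noteq> 0"
    using nb[of 1] by auto
  let ?A = "{w p 0, w p 1, w p (-1), w p x}"
  have x0: "\<not> M dvd x" "\<not> M dvd y" "\<not> M dvd - x" using M_even[of x] M_even[of y] x y by auto
  have ne: "w p x \<noteq> w p 0" "w p x \<noteq> w p 1" "w p x \<noteq> w p (-1)" using x x0 by (auto simp: w_eq)
  have "w p 0 \<noteq> w p 1" "w p 0 \<noteq> w p (-1)" "w p 1 \<noteq> w p (-1)" by (simp_all add: w_eq)
  then have "card ?A = 4" using ne ne[symmetric] by simp
  then have one: "\<And>a. a \<in> ?A \<Longrightarrow> \<alpha> a = 1" and supp: "\<And>v. v \<in> V \<Longrightarrow> \<alpha> v \<noteq> 0 \<Longrightarrow> v \<in> ?A"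
    using sum_le_card[of ?A \<alpha>] less a0 a1 x by auto
  have "w p y = w p x" using supp[of "w p y"] y x0 by (auto simp: w_eq)
  then have "M dvd (y - x)" by (simp add: w_eq)
  then have x3: "\<not> M dvd (x + 3)" using y(4) dvd_add[of M "y - x" "x + 3"] by auto
  have van: "ev V Z f = 0" if k: "even k" "\<not> M dvd k" and
    eq: "\<And>a b. a \<in> ?A \<Longrightarrow> b \<in> ?A \<Longrightarrow> adj (w p k) a \<Longrightarrow> adj (w p k) b \<Longrightarrow> Z a = Z b" and
    Z0: "Z (w p 0) = Z (w p x)" for k and Z :: "vertex \<Rightarrow> 'k coord \<times> 'k coord"
  proof -
    obtain c where c: "\<And>a. a \<in> ?A \<Longrightarrow> adj (w p k) a \<Longrightarrow> Z a = c"
    proof (cases "\<exists>a\<in>?A. adj (w p k) a")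
      case True
      then obtain a where "a \<in> ?A" "adj (w p k) a" by blast
      then show ?thesis using that[of "Z a"] eq by blast
    next
      case False
      then show ?thesis using that by blast
    qed
    have kT: "w p k \<in> T" using k T by simp
    have kA: "w p k \<notin> ?A" using witness_outside[OF T(1) f kT] one by fastforce
    have "ev V (Z(w p k := c)) f = 0"
    proof (rule witness_vanishes[OF T(1) f, of "insert (w p k) ?A"])
      fix a b assume ab: "a \<in> insert (w p k) ?A" "b \<in> insert (w p k) ?A" "adj a b"
      have inner: "Z a = Z b" if "a \<in> ?A" "b \<in> ?A"
        using that ab(3) x(1) Z0 by (auto simp: w_adj)
      show "(Z(w p k := c)) a = (Z(w p k := c)) b"
      proof (cases "a = w p k \<or> b = w p k")
        case True
        then show ?thesis using ab c[of a] c[of b] adj_sym[of a b] kA by (metis fun_upd_apply insertE)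
      next
        case False
        then show ?thesis using ab inner by auto
      qed
    qed (use supp kT in auto)
    moreover have "ev V (Z(w p k := c)) f = ev V Z f"
      using supp kA by (intro witness_cong[OF f]) auto
    ultimately show ?thesis by simp
  qed
  let ?Z = "\<lambda>v. label_vec (comp_label T v) :: 'k coord \<times> 'k coord"
  have "adj (w p x) (w p 0)" using x by (simp add: w_adj)
  then have "adj (w p 0) (w p x)" using adj_sym by blast
  then have "conn (V - T) (w p 0) (w p x)" using out x by (intro conn_adj) auto
  then have Zx: "?Z (w p 0) = ?Z (w p x)" by (metis comp_label_eq_iff)
  have "\<not> conn (V - T) (w p (-1)) (w p x)"
  proof
    assume c: "conn (V - T) (w p (-1)) (w p x)"
    have "w p (-1) = w p x"
    proof (rule conn_isolated[OF c])
      fix v assume "v \<in> V - T"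
      then obtain i where i: "v = w p i" "odd i \<or> v = w p 0" using rep by blast
      then show "\<not> adj (w p (-1)) v" by (cases "odd i") (auto simp: w_adj)
    qed
    then show False using ne by simp
  qed
  then have det: "det2 (?Z (w p (-1))) (?Z (w p x)) \<noteq> 0"
    by (intro det2_label_vec) (simp add: comp_label_eq_iff)
  have "ev V ?Z f = 0"
  proof (rule witness_linear_zero[OF f, of "w p 1" "?Z (w p (-1))" "?Z (w p x)"])
    have not_adj: "\<not> adj (w p (x + 1)) (w p x)" "\<not> adj (w p (-2)) (w p (-1))"
      "\<not> adj (w p (x + 1)) (w p 0)" "\<not> adj (w p (-2)) (w p 0)" using x by (simp_all add: w_adj)
    have n1: "\<not> M dvd (x + 1 - 1 - 1)" using x by simp
    show "ev V (?Z(w p 1 := ?Z (w p (-1)))) f = 0"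
    proof (rule van[of "x + 1"])
      fix a b assume "a \<in> ?A" "b \<in> ?A" "adj (w p (x + 1)) a" "adj (w p (x + 1)) b"
      then have "a \<in> {w p 1, w p (-1)}" "b \<in> {w p 1, w p (-1)}" using not_adj by auto
      then show "(?Z(w p 1 := ?Z (w p (-1)))) a = (?Z(w p 1 := ?Z (w p (-1)))) b" by auto
    qed (use x ne Zx in \<open>auto simp: w_eq\<close>)
    show "ev V (?Z(w p 1 := ?Z (w p x))) f = 0"
    proof (rule van[of "-2"])
      fix a b assume "a \<in> ?A" "b \<in> ?A" "adj (w p (-2)) a" "adj (w p (-2)) b"
      then have "a \<in> {w p 1, w p x}" "b \<in> {w p 1, w p x}" using not_adj by auto
      then show "(?Z(w p 1 := ?Z (w p x))) a = (?Z(w p 1 := ?Z (w p x))) b" using ne by auto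
    qed (use ne Zx in \<open>auto simp: w_eq\<close>)
  qed (use one det in auto)
  then show False using witness_nonzero[OF T(1) f] by simp
qed

text \<open>
  The support contains the centres \<open>w(1)\<close> and \<open>w(-1)\<close>, since they are the only neighbours of \<open>w(-2)\<close> and
  of \<open>w(2)\<close> outside \<open>T\<close>, and every vertex of \<open>T\<close> needs \<open>w(0)\<close> and a second even neighbour. A single second
  neighbour \<open>w(l)\<close> cannot serve all of \<open>T\<close>, because \<open>l + 1\<close> or \<open>l - 1\<close> belongs to \<open>T\<close>.
\<close>

lemma lower_double_star:
  assumes T: "T \<subseteq> V" "\<And>k. w p k \<in> T \<longleftrightarrow> odd k \<and> \<not> M dvd (k - 1) \<and> \<not> M dvd (k + 1)"
    and f: "witness T \<alpha> (f :: (vertex, 'k::field) vpoly)"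
  shows "5 \<le> (\<Sum>v\<in>V. \<alpha> v)"
proof (rule ccontr)
  assume less: "\<not> ?thesis"
  have out: "w p k \<in> V - T" if "even k \<or> k = 1 \<or> k = -1" for k
  proof -
    have "w p k \<notin> T" unfolding T(2) using that by (elim disjE) simp_all
    then show ?thesis by simp
  qed
  have rep: "\<exists>i. x = w p i \<and> (even i \<or> x = w p 1 \<or> x = w p (-1))" if x: "x \<in> V - T" for x
  proof -
    obtain i where i: "x = w p i" using x w_cases by blast
    moreover have "w p i \<notin> T" using x i by simp
    then have "even i \<or> w p i = w p 1 \<or> w p i = w p (-1)" unfolding T(2) w_eq by auto
    ultimately show ?thesis by blast
  qed
  have centre: "\<alpha> (w p e) \<noteq> 0" if e: "e = 1 \<or> e = -1" for e
  proof -
    let ?U = "{v \<in> V. \<alpha> v \<noteq> 0} \<union> {w p (- 2 * e), w p 4}"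
    have e4: "adj (w p e) (w p 4)" "adj (w p (- 2 * e)) (w p e)" "w p (- 2 * e) \<noteq> w p 4" using e
      by (auto simp: w_adj w_eq)
    have o: "w p (- 2 * e) \<in> V - T" "w p 4 \<in> V - T" "w p e \<in> V - T" using out e by auto
    have "conn (V - T) (w p (- 2 * e)) (w p 4)"
      by (rule conn_path2[OF e4(2,1) o(1,3,2)])
    then obtain c where c: "c \<in> ?U" "adj (w p (- 2 * e)) c"
      using witness_not_isolated[OF T(1) f, of ?U "w p (- 2 * e)"
          "w p 4"] supp_outside[OF T(1) f] o e4(3)
      by auto
    then have "c \<in> V - T" using supp_outside[OF T(1) f] o by auto
    then obtain i where i: "c = w p i" "even i \<or> c = w p 1 \<or> c = w p (-1)" using rep by blast
    then have "c = w p 1 \<or> c = w p (-1)" using c(2) e by (cases "even i") (auto simp: w_adj)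
    then have "c = w p e" using c(2) e by (auto simp: w_adj)
    moreover have "w p e \<noteq> w p (- 2 * e)" "w p e \<noteq> w p 4" using e by (auto simp: w_eq)
    ultimately show ?thesis using c(1) by auto
  qed
  have even_nb: "\<exists>i. even i \<and> c = w p i" if c: "adj (w p k) c" "odd k" for c k
  proof -
    obtain i where "c = w p i" using adj_V[OF c(1)] w_cases by blast
    then show ?thesis using c by (auto simp: w_adj)
  qed
  have to4: "conn (V - T) (w p i) (w p 4)" if i: "even i" "\<not> M dvd i" for i
  proof (cases "M dvd (i - 2)")
    case True
    then have "w p i = w p 2" by (rule w_rep)
    then show ?thesis using conn_path2[of "w p 2" "w p (-1)" "w p 4" "V - T"] out by (simp add: w_adj)
  next
    case False
    then have "adj (w p i) (w p 1)" using i by (simp add: w_adj)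
    then show ?thesis using conn_path2[of "w p i" "w p 1" "w p 4" "V - T"] out i by (simp add: w_adj)
  qed
  have pair: "\<exists>l. even l \<and> \<not> M dvd l \<and> \<alpha> (w p 0) \<noteq> 0 \<and> \<alpha> (w p l) \<noteq> 0 \<and> adj (w p k) (w p l)"
      if k: "w p k \<in> T" for k
  proof -
    obtain a b where ab: "a \<in> V - T" "b \<in> V - T" "adj (w p k) a" "adj (w p k) b" "\<alpha> a \<noteq> 0" "\<alpha> b \<noteq> 0"
        "a \<noteq> b"
      "\<not> conn (V - T) a b" using two_neighbours[OF T(1) f k] by blast
    have "odd k" using k T by simp
    then obtain i j where ij: "even i" "a = w p i" "even j" "b = w p j" using even_nb ab by metis
    then have "M dvd i \<or> M dvd j" using to4[of i] to4[of j] ab conn_trans conn_sym by blast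
    then show ?thesis
    proof
      assume "M dvd i"
      then have "a = w p 0" "\<not> M dvd j" using ij ab by (auto simp: w_eq)
      then show ?thesis using ab ij by auto
    next
      assume "M dvd j"
      then have "b = w p 0" "\<not> M dvd i" using ij ab by (auto simp: w_eq)
      then show ?thesis using ab ij by auto
    qed
  qed
  obtain l where l: "even l" "\<not> M dvd l" "\<alpha> (w p 0) \<noteq> 0" "\<alpha> (w p l) \<noteq> 0"
    using pair[of 3] by (auto simp: T(2))
  let ?A = "{w p 0, w p 1, w p (-1), w p l}"
  have lodd: "\<not> M dvd (l - 1)" "\<not> M dvd (l + 1)" using M_even[of "l - 1"] M_even[of "l + 1"] l by auto
  then have ne: "w p l \<noteq> w p 0" "w p l \<noteq> w p 1" "w p l \<noteq> w p (-1)" using l by (auto simp: w_eq)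
  have "w p 0 \<noteq> w p 1" "w p 0 \<noteq> w p (-1)" "w p 1 \<noteq> w p (-1)" by (simp_all add: w_eq)
  then have "card ?A = 4" using ne ne[symmetric] by simp
  then have supp: "\<And>v. v \<in> V \<Longrightarrow> \<alpha> v \<noteq> 0 \<Longrightarrow> v \<in> ?A"
    using sum_le_card(2)[of ?A \<alpha>] less centre l by auto
  obtain k where k: "w p k \<in> T" "k = l + 1 \<or> k = l - 1"
  proof (cases "M dvd (l + 2)")
    case True
    then have "\<not> M dvd (l - 2)" using M_dvd_trans[OF True, of "l - 2"] by auto
    then show ?thesis using that[of "l - 1"] l by (simp add: T(2))
  next
    case False
    then show ?thesis using that[of "l + 1"] l by (simp add: T(2) add.commute)
  qed
  obtain l' where l': "even l'" "\<not> M dvd l'" "\<alpha> (w p l') \<noteq> 0" "adj (w p k) (w p l')"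
    using pair[OF k(1)] by blast
  have "\<not> M dvd (l' - 1)" "\<not> M dvd (l' + 1)" using M_even[of "l' - 1"] M_even[of "l' + 1"] l' by auto
  then have "w p l' = w p l" using supp[of "w p l'"] l' by (auto simp: w_eq)
  moreover have "\<not> adj (w p k) (w p l)" using k by (auto simp: w_adj)
  ultimately show False using l' by simp
qed

text \<open>
  The vertices at \<open>4\<close>, \<open>3\<close> and \<open>-3\<close> force all five vertices into the support. If the degree were 5, the
  witness would be linear in \<open>w(0)\<close>; it vanishes if \<open>w(0)\<close> is parallel to \<open>w(-2)\<close> (because of \<open>3\<close>) or to \<open>w(2)\<close>
  (because of \<open>-3\<close>), which belong to different components.
\<close>

lemma lower_P5:
  assumes T: "T \<subseteq> V" "V - T = {w p (-2), w p (-1), w p 0, w p 1, w p 2}"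
    and f: "witness T \<alpha> (f :: (vertex, 'k::field) vpoly)"
  shows "6 \<le> (\<Sum>v\<in>V. \<alpha> v)"
proof (rule ccontr)
  assume less: "\<not> ?thesis"
  have inT: "v \<in> T" if "v \<in> V" "v \<notin> {w p (-2), w p (-1), w p 0, w p 1, w p 2}" for v using that T(2)
    by blast
  have T4: "w p 4 \<in> T" "w p 3 \<in> T" "w p (-3) \<in> T" by (rule inT; simp add: w_eq)+
  have 1: "\<alpha> (w p 1) \<noteq> 0 \<and> \<alpha> (w p (-1)) \<noteq> 0"
    by (rule both_neighbours[OF T(1) f T4(1)]) (auto simp: T(2) w_adj)
  have 2: "\<alpha> (w p 0) \<noteq> 0 \<and> \<alpha> (w p (-2)) \<noteq> 0"
    by (rule both_neighbours[OF T(1) f T4(2)]) (auto simp: T(2) w_adj)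
  have 3: "\<alpha> (w p 0) \<noteq> 0 \<and> \<alpha> (w p 2) \<noteq> 0"
    by (rule both_neighbours[OF T(1) f T4(3)]) (auto simp: T(2) w_adj)
  let ?A = "{w p (-2), w p (-1), w p 0, w p 1, w p 2}"
  have "card ?A = 5" by (simp add: w_eq)
  then have one: "\<And>a. a \<in> ?A \<Longrightarrow> \<alpha> a = 1" and supp: "\<And>v. v \<in> V \<Longrightarrow> \<alpha> v \<noteq> 0 \<Longrightarrow> v \<in> ?A"
    using sum_le_card[of ?A \<alpha>] less 1 2 3 by auto
  let ?Z = "\<lambda>v. label_vec (comp_label T v) :: 'k coord \<times> 'k coord"
  have "conn (V - T) (w p (-2)) (w p 1)" "conn (V - T) (w p (-1)) (w p 2)"
    by (rule conn_adj; simp add: T(2) w_adj)+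
  then have Zc: "?Z (w p 1) = ?Z (w p (-2))" "?Z (w p 2) = ?Z (w p (-1))"
    by (metis comp_label_eq_iff)+
  have "\<not> conn (V - T) (w p (-2)) (w p (-1))"
  proof
    assume c: "conn (V - T) (w p (-2)) (w p (-1))"
    have "w p (-1) \<in> {w p (-2), w p 1}"
      by (rule conn_closed[OF c]) (auto simp: T(2) w_adj)
    then show False by (simp add: w_eq)
  qed
  then have det: "det2 (?Z (w p (-2))) (?Z (w p (-1))) \<noteq> 0"
    by (intro det2_label_vec) (simp add: comp_label_eq_iff)
  have van: "ev V (?Z(w p 0 := ?Z (w p (- 2 * e)))) f = 0" if e: "e = 1 \<or> e = -1" for e
  proof -
    have "ev V (?Z(w p 0 := ?Z (w p (- 2 * e)), w p (3 * e) := ?Z (w p (- 2 * e)))) f = 0"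
    proof (rule witness_vanishes[OF T(1) f, of "insert (w p (3 * e)) ?A"])
      show "(?Z(w p 0 := ?Z (w p (- 2 * e)), w p (3 * e) := ?Z (w p (- 2 * e)))) a =
          (?Z(w p 0 := ?Z (w p (- 2 * e)), w p (3 * e) := ?Z (w p (- 2 * e)))) b"
        if "a \<in> insert (w p (3 * e)) ?A" "b \<in> insert (w p (3 * e)) ?A" "adj a b" for a b
        using that e Zc by (auto simp: w_adj w_eq)
    qed (use supp T4 e in \<open>auto simp: T(1)\<close>)
    moreover have "ev V (?Z(w p 0 := ?Z (w p (- 2 * e)), w p (3 * e) := ?Z (w p (- 2 * e)))) f =
        ev V (?Z(w p 0 := ?Z (w p (- 2 * e)))) f"
    proof (rule witness_cong[OF f])
      fix v assume "v \<in> V" "\<alpha> v \<noteq> 0"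
      then have "v \<noteq> w p (3 * e)" using supp[of v] e by (auto simp: w_eq)
      then show "(?Z(w p 0 := ?Z (w p (- 2 * e)), w p (3 * e) := ?Z (w p (- 2 * e)))) v =
          (?Z(w p 0 := ?Z (w p (- 2 * e)))) v"
        by simp
    qed
    ultimately show ?thesis by simp
  qed
  have "ev V ?Z f = 0"
  proof (rule witness_linear_zero[OF f _ _ det])
    show "\<alpha> (w p 0) \<le> 1" using one by simp
    show "ev V (?Z(w p 0 := ?Z (w p (-2)))) f = 0" using van[of 1] by simp
    show "ev V (?Z(w p 0 := ?Z (w p (-1)))) f = 0" using van[of "-1"] Zc(2) by simp
  qed simp
  then show False using witness_nonzero[OF T(1) f] by simp
qed

text \<open>
  A vertex of \<open>T\<close> next to a leaf on the cycle misses this leaf and needs the other leaf of the same star;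
  an odd vertex of \<open>T\<close> needs both centres. So all six vertices belong to the support.
\<close>

lemma lower_two_P3_even:
  assumes T: "T \<subseteq> V" "V - T = {w p (-1), w p 0, w p 1, w p (m - 1), w p m, w p (m + 1)}"
    and m: "even m" "\<not> M dvd m" "\<not> M dvd (m - 2)" "\<not> M dvd (m + 2)"
    and f: "witness T \<alpha> (f :: (vertex, 'k::field) vpoly)"
  shows "6 \<le> (\<Sum>v\<in>V. \<alpha> v)"
proof -
  have m': "\<not> M dvd (- m - 2)" "\<not> M dvd (2 - m)" "\<not> M dvd (- 2 - m)" "\<not> M dvd (2 + m)"
    using m M_dvd_neg(1)[of m 2] M_dvd_neg(1)[of 2 m]
      by (simp_all add: dvd_diff_commute[of M 2 m] add.commute)
  have mo: "\<not> M dvd (m - 1)" "\<not> M dvd (m + 1)" "\<not> M dvd (1 + m)" "\<not> M dvd (m - 3)" "\<not> M dvd (3 - m)"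
      "\<not> M dvd (1 - m)" "\<not> M dvd (m + 3)" "\<not> M dvd (3 + m)"
    "\<not> M dvd (- 1 - m)" "\<not> M dvd (- 3 - m)" "\<not> M dvd (- m - 1)"
    using m(1) M_even by fastforce+
  note ms = m m' mo
  let ?A = "{w p (-1), w p 0, w p 1, w p (m - 1), w p m, w p (m + 1)}"
  have inT: "v \<in> T" if "v \<in> V" "v \<notin> ?A" for v using that T(2) by blast
  have in': "w p (-1) \<in> V - T" "w p 0 \<in> V - T" "w p 1 \<in> V - T" "w p (m - 1) \<in> V - T" "w p m \<in> V - T"
    "w p (m + 1) \<in> V - T" by (simp_all add: T(2))
  have "conn (V - T) (w p (m - 1)) (w p (m + 1))"
    by (rule conn_path2[OF _ _ in'(4,2,6)]) (use ms in \<open>simp_all add: w_adj\<close>)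
  then have cm: "conn (V - T) (w p (m - 1)) (w p (m + 1))" "conn (V - T) (w p (m + 1)) (w p (m - 1))"
    using conn_sym by blast+
  have "conn (V - T) (w p (-1)) (w p 1)"
    by (rule conn_path2[OF _ _ in'(1,5,3)]) (use ms in \<open>simp_all add: w_adj\<close>)
  then have c1: "conn (V - T) (w p (-1)) (w p 1)" "conn (V - T) (w p 1) (w p (-1))"
    using conn_sym by blast+
  have odd_T: "w p 2 \<in> T" "w p (-2) \<in> T" "w p (m + 2) \<in> T" "w p (m - 2) \<in> T"
    by (rule inT; use ms in \<open>simp add: w_eq\<close>)+
  have 1: "\<alpha> (w p (-1)) \<noteq> 0"
    by (rule separate_neighbour[OF T(1) f odd_T(1) _ cm(1)]) (use m(1) in \<open>auto simp: T(2) w_adj\<close>)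
  have 2: "\<alpha> (w p 1) \<noteq> 0"
    by (rule separate_neighbour[OF T(1) f odd_T(2) _ cm(1)]) (use m(1) in \<open>auto simp: T(2) w_adj\<close>)
  have 3: "\<alpha> (w p (m - 1)) \<noteq> 0"
    by (rule separate_neighbour[OF T(1) f odd_T(3) _ c1(1)]) (use m(1) in \<open>auto simp: T(2) w_adj\<close>)
  have 4: "\<alpha> (w p (m + 1)) \<noteq> 0"
    by (rule separate_neighbour[OF T(1) f odd_T(4) _ c1(1)]) (use m(1) in \<open>auto simp: T(2) w_adj\<close>)
  obtain k where k: "odd k" "w p k \<in> T"
  proof (cases "M dvd (m - 4)")
    case True
    then have "\<not> M dvd (m + 4)" using M_dvd_trans[OF True, of "m + 4"] by auto
    then have "\<not> M dvd (- 4 - m)" using M_dvd_neg(1)[of 4 m] by (simp add: add.commute)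
    then have "w p (-3) \<in> T" using ms by (intro inT) (auto simp: w_eq)
    then show ?thesis using that[of "-3"] by simp
  next
    case False
    then have "\<not> M dvd (4 - m)" by (simp add: dvd_diff_commute)
    then have "w p 3 \<in> T" using ms by (intro inT) (auto simp: w_eq)
    then show ?thesis using that[of 3] by simp
  qed
  have 5: "\<alpha> (w p 0) \<noteq> 0 \<and> \<alpha> (w p m) \<noteq> 0"
    by (rule both_neighbours[OF T(1) f k(2)]) (use k(1) m(1) in \<open>auto simp: T(2) w_adj\<close>)
  have "card ?A = 6" using ms by (simp add: w_eq)
  moreover have "card ?A \<le> (\<Sum>v\<in>V. \<alpha> v)" using 1 2 3 4 5 by (intro sum_ge_card) auto
  ultimately show ?thesis by simp
qed

text \<open>
  The vertices at \<open>6\<close> and \<open>-1\<close> force \<open>1, 3\<close> and \<open>2, 4\<close> into the support; \<open>5\<close> and \<open>0\<close> are needed to connect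
  \<open>2\<close> with \<open>3\<close>.
\<close>

lemma lower_P6:
  assumes T: "T \<subseteq> V" "V - T = {w p 0, w p 1, w p 2, w p 3, w p 4, w p 5}"
    and f: "witness T \<alpha> (f :: (vertex, 'k::field) vpoly)"
  shows "6 \<le> (\<Sum>v\<in>V. \<alpha> v)"
proof -
  let ?A = "{w p 0, w p 1, w p 2, w p 3, w p 4, w p 5}"
  have inT: "v \<in> T" if "v \<in> V" "v \<notin> ?A" for v using that T(2) by blast
  have T6: "w p 6 \<in> T" "w p (-1) \<in> T" by (rule inT; simp add: w_eq)+
  have 1: "\<alpha> (w p 1) \<noteq> 0 \<and> \<alpha> (w p 3) \<noteq> 0"
    by (rule both_neighbours[OF T(1) f T6(1)]) (auto simp: T(2) w_adj)
  have 2: "\<alpha> (w p 2) \<noteq> 0 \<and> \<alpha> (w p 4) \<noteq> 0"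
    by (rule both_neighbours[OF T(1) f T6(2)]) (auto simp: T(2) w_adj)
  have "conn (V - T) (w p 2) (w p 3)"
    by (rule conn_path3[of _ "w p 5" "w p 0"]) (simp_all add: T(2) w_adj)
  then have c: "conn (V - T) (w p 2) (w p 3)" "conn (V - T) (w p 3) (w p 2)" using conn_sym by blast+
  let ?U = "{v \<in> V. \<alpha> v \<noteq> 0}"
  have U: "?U \<subseteq> ?A" using supp_outside[OF T(1) f] T(2) by blast
  obtain a where a: "a \<in> ?U" "adj (w p 2) a"
    using witness_not_isolated[OF T(1) f, of ?U "w p 2" "w p 3"] U 1 2 c T(2) by (auto simp: w_eq)
  then have "a \<in> ?A" using U by blast
  then have "a = w p 5" using a by (auto simp: w_adj)
  moreover obtain b where b: "b \<in> ?U" "adj (w p 3) b"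
    using witness_not_isolated[OF T(1) f, of ?U "w p 3" "w p 2"] U 1 2 c T(2) by (auto simp: w_eq)
  then have "b \<in> ?A" using U by blast
  then have "b = w p 0" using b by (auto simp: w_adj)
  ultimately have "card ?A \<le> (\<Sum>v\<in>V. \<alpha> v)" using 1 2 a b by (intro sum_ge_card) auto
  then show ?thesis by (simp add: w_eq)
qed

text \<open>
  Each of the four vertices of \<open>T\<close> next to the two paths on the cycle has only two possible neighbours,
  and together these are all six vertices.
\<close>

lemma lower_two_P3_odd:
  assumes T: "T \<subseteq> V" "V - T = {w p (-1), w p 0, w p 1, w p (m - 1), w p m, w p (m + 1)}"
    and m: "odd m" "\<not> M dvd (m - 1)" "\<not> M dvd (m + 1)" "\<not> M dvd (m - 3)" "\<not> M dvd (m + 3)"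
    and f: "witness T \<alpha> (f :: (vertex, 'k::field) vpoly)"
  shows "6 \<le> (\<Sum>v\<in>V. \<alpha> v)"
proof -
  have m': "\<not> M dvd (- m - 1)" "\<not> M dvd (1 - m)" "\<not> M dvd (- m - 3)" "\<not> M dvd (3 - m)"
    "\<not> M dvd (- 1 - m)" "\<not> M dvd (- 3 - m)" "\<not> M dvd (1 + m)" "\<not> M dvd (3 + m)"
    using m M_dvd_neg(1)[of m 1] M_dvd_neg(1)[of 1 m] M_dvd_neg(1)[of m 3] M_dvd_neg(1)[of 3 m]
    by (simp_all add: dvd_diff_commute[of M 1 m] dvd_diff_commute[of M 3 m] add.commute)
  have mo: "\<not> M dvd m" "\<not> M dvd - m" "\<not> M dvd (m + 2)" "\<not> M dvd (2 + m)" "\<not> M dvd (m - 2)"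
      "\<not> M dvd (2 - m)" "\<not> M dvd (- 2 - m)" "\<not> M dvd (- m - 2)"
    using m(1) M_even by fastforce+
  note ms = m m' mo
  let ?A = "{w p (-1), w p 0, w p 1, w p (m - 1), w p m, w p (m + 1)}"
  have inT: "v \<in> T" if "v \<in> V" "v \<notin> ?A" for v using that T(2) by blast
  have T2: "w p 2 \<in> T" "w p (-2) \<in> T" "w p (m + 2) \<in> T" "w p (m - 2) \<in> T"
    by (rule inT; use ms in \<open>simp add: w_eq\<close>)+
  have 1: "\<alpha> (w p (-1)) \<noteq> 0 \<and> \<alpha> (w p m) \<noteq> 0"
    by (rule both_neighbours[OF T(1) f T2(1)]) (use m(1) in \<open>auto simp: T(2) w_adj\<close>)
  have 2: "\<alpha> (w p 1) \<noteq> 0 \<and> \<alpha> (w p m) \<noteq> 0"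
    by (rule both_neighbours[OF T(1) f T2(2)]) (use m(1) in \<open>auto simp: T(2) w_adj\<close>)
  have 3: "\<alpha> (w p (m - 1)) \<noteq> 0 \<and> \<alpha> (w p 0) \<noteq> 0"
    by (rule both_neighbours[OF T(1) f T2(3)]) (use m(1) in \<open>auto simp: T(2) w_adj\<close>)
  have 4: "\<alpha> (w p (m + 1)) \<noteq> 0 \<and> \<alpha> (w p 0) \<noteq> 0"
    by (rule both_neighbours[OF T(1) f T2(4)]) (use m(1) in \<open>auto simp: T(2) w_adj\<close>)
  have "card ?A = 6" using ms by (simp add: w_eq)
  moreover have "card ?A \<le> (\<Sum>v\<in>V. \<alpha> v)" using 1 2 3 4 by (intro sum_ge_card) auto
  ultimately show ?thesis by simp
qed

text \<open>
  A cyclic word of length five over two letters has three equal consecutive letters or is a rotation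
  of \<open>a b a b b\<close>.
\<close>

lemma cyclic_words:
  fixes a b c d e :: bool
  obtains "(a = b \<and> b = c)"
    | "(b = c \<and> c = d)"
    | "(c = d \<and> d = e)"
    | "(d = e \<and> e = a)"
    | "(e = a \<and> a = b)"
    | "(a \<noteq> b \<and> c = a \<and> d = b \<and> e = b)"
    | "(b \<noteq> c \<and> d = b \<and> e = c \<and> a = c)"
    | "(c \<noteq> d \<and> e = c \<and> a = d \<and> b = d)"
    | "(d \<noteq> e \<and> a = d \<and> b = e \<and> c = e)"
    | "(e \<noteq> a \<and> b = e \<and> c = a \<and> d = a)"
  by argo

text \<open>
  Number the even positions cyclically by \<open>\<int>/5\<close>. An odd vertex is adjacent to three consecutive ones, so
  the witness vanishes whenever three consecutive vectors agree.

  If some vertex does not occur in the degree, its vector is free. Of the other four, in their cyclic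
  order, the two inner ones must occur, and each of the two outer ones must have degree at least 2, as
  otherwise the witness is linear in it and vanishes for two independent values.

  If all five occur and the degree is 5, the witness is linear in every vector. By linearity it is
  determined by its values at words in two vectors \<open>q\<close> and \<open>r\<close>, and the only words without three equal
  consecutive letters are the rotations of \<open>q r q r r\<close>. With the last two vectors equal to \<open>r\<close>, the
  witness vanishes if the first two or the second and third vector agree. So it is alternating in these
  three vectors of the plane, and it vanishes at this word as well.
\<close>

lemma lower_part_5:
  assumes n: "n = 5" and T: "T \<subseteq> V"
      "\<And>k. w p k \<in> T \<longleftrightarrow> odd k" and f: "witness T \<alpha> (f :: (vertex, 'k::field) vpoly)"
  shows "6 \<le> (\<Sum>v\<in>V. \<alpha> v)"
proof (rule ccontr)
  assume less: "\<not> ?thesis"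
  have M10: "M = 10" unfolding M_def using n by simp
  let ?Z = "\<lambda>v. label_vec (comp_label T v) :: 'k coord \<times> 'k coord"
  have rep: "\<exists>i. v = w p i \<and> even i" if v: "v \<in> V - T" for v
  proof -
    obtain i where "v = w p i" using v w_cases by blast
    then show ?thesis using v T(2) by auto
  qed
  have triple: "ev V Z f = 0" if e: "even e" "Z (w p e) = c" "Z (w p (e + 2)) = c" "Z (w p (e + 4)) = c"
    for e c and Z :: "vertex \<Rightarrow> 'k coord \<times> 'k coord"
  proof -
    let ?k = "w p (e + 7)"
    have kT: "?k \<in> T" using e T by simp
    have nb: "Z a = c" if a: "a \<in> V - T" "adj ?k a" for a
    proof -
      obtain i where i: "a = w p i" "even i" using rep[OF a(1)] by blast
      have "\<not> 10 dvd (e + 7 - i - 1)" "\<not> 10 dvd (e + 7 - i + 1)" using a(2)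
        by (simp_all add: i w_adj M10)
      then have "10 dvd (i - e) \<or> 10 dvd (i - (e + 2)) \<or> 10 dvd (i - (e + 4))" using i(2) e(1)
        by presburger
      then have "a = w p e \<or> a = w p (e + 2) \<or> a = w p (e + 4)" by (simp add: i w_eq M10)
      then show ?thesis using e by auto
    qed
    have "ev V (Z(?k := c)) f = 0"
    proof (rule witness_vanishes[OF T(1) f, of "insert ?k (V - T)"])
      fix a b assume ab: "a \<in> insert ?k (V - T)" "b \<in> insert ?k (V - T)" "adj a b"
      have part: "\<not> adj a b" if ab': "a \<in> V - T" "b \<in> V - T"
        using rep[OF ab'(1)] rep[OF ab'(2)] by (auto simp: w_adj)
      then have "a = ?k \<or> b = ?k" using ab by blast
      then show "(Z(?k := c)) a = (Z(?k := c)) b"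
        using ab nb[of a] nb[of b] adj_sym[of a b] by (metis fun_upd_apply insertE)
    qed (use supp_outside[OF T(1) f] kT in auto)
    moreover have "ev V (Z(?k := c)) f = ev V Z f"
      using witness_outside[OF T(1) f kT] by (intro witness_cong[OF f]) auto
    ultimately show ?thesis by simp
  qed
  have cyc: "w p (e + 10) = w p e" "w p (e + 12) = w p (e + 2)" for e by (simp_all add: w_eq M10)
  have ne: "w p (e + i) \<noteq> w p (e + j)" if "\<bar>i - j\<bar> < 10" "i \<noteq> j" for e i j
    using not_M_dvd[of "i - j"] that by (simp add: w_eq)
  have det: "det2 (?Z (w p i)) (?Z (w p j)) \<noteq> 0" if "w p i \<noteq> w p j" for i j
    using no_conn_one_part[OF T(2), of "w p i" "w p j"] that
      by (intro det2_label_vec) (auto simp: comp_label_eq_iff)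
  have nz: "ev V ?Z f \<noteq> 0" by (rule witness_nonzero[OF T(1) f])
  show False
  proof (cases "\<exists>e. even e \<and> \<alpha> (w p e) = 0")
    case True
    then obtain e where e: "even e" "\<alpha> (w p e) = 0" by blast
    \<comment> \<open>The free vertex is \<open>?x 0\<close>; the others are \<open>?x 2\<close>, \<open>?x 4\<close>, \<open>?x 6\<close>, \<open>?x 8\<close> in cyclic order.\<close>
    let ?x = "\<lambda>i. w p (e + i)"
    have free: "ev V (Z(?x 0 := c)) f = ev V Z f" for Z c
      using e by (intro witness_cong[OF f]) auto
    have 1: "\<alpha> (?x 4) \<noteq> 0"
    proof
      assume 0: "\<alpha> (?x 4) = 0"
      have "ev V (?Z(?x 4 := ?Z (?x 2), ?x 0 := ?Z (?x 2))) f = 0"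
        using ne[of 2 4 e] ne[of 2 0 e] ne[of 4 0 e]
          by (intro triple[of e _ "?Z (?x 2)"]) (use e in auto)
      then have "ev V (?Z(?x 4 := ?Z (?x 2))) f = 0" using free by simp
      moreover have "ev V (?Z(?x 4 := ?Z (?x 2))) f = ev V ?Z f" using 0
        by (intro witness_cong[OF f]) auto
      ultimately show False using nz by simp
    qed
    have 2: "\<alpha> (?x 6) \<noteq> 0"
    proof
      assume 0: "\<alpha> (?x 6) = 0"
      have "ev V (?Z(?x 6 := ?Z (?x 8), ?x 0 := ?Z (?x 8))) f = 0"
        using ne[of 8 6 e] ne[of 8 0 e] ne[of 6 0 e] cyc[of e] e
        by (intro triple[of "e + 6" _ "?Z (?x 8)"]) (auto simp: add.assoc)
      then have "ev V (?Z(?x 6 := ?Z (?x 8))) f = 0" using free by simp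
      moreover have "ev V (?Z(?x 6 := ?Z (?x 8))) f = ev V ?Z f" using 0
        by (intro witness_cong[OF f]) auto
      ultimately show False using nz by simp
    qed
    have 3: "\<not> \<alpha> (?x 2) \<le> 1"
    proof
      assume le: "\<alpha> (?x 2) \<le> 1"
      have "ev V ?Z f = 0"
      proof (rule witness_linear_zero[OF f _ le det[OF ne[of 4 8]]])
        have "ev V (?Z(?x 2 := ?Z (?x 4), ?x 0 := ?Z (?x 4))) f = 0"
          using ne[of 2 4 e] ne[of 2 0 e] ne[of 4 0 e]
            by (intro triple[of e _ "?Z (?x 4)"]) (use e in auto)
        then show "ev V (?Z(?x 2 := ?Z (?x 4))) f = 0" using free by simp
        have "ev V (?Z(?x 2 := ?Z (?x 8), ?x 0 := ?Z (?x 8))) f = 0"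
          using ne[of 2 8 e] ne[of 2 0 e] ne[of 8 0 e] cyc[of e] e
          by (intro triple[of "e + 8" _ "?Z (?x 8)"]) (auto simp: add.assoc)
        then show "ev V (?Z(?x 2 := ?Z (?x 8))) f = 0" using free by simp
      qed auto
      then show False using nz by simp
    qed
    have 4: "\<not> \<alpha> (?x 8) \<le> 1"
    proof
      assume le: "\<alpha> (?x 8) \<le> 1"
      have "ev V ?Z f = 0"
      proof (rule witness_linear_zero[OF f _ le det[OF ne[of 2 6]]])
        have "ev V (?Z(?x 8 := ?Z (?x 2), ?x 0 := ?Z (?x 2))) f = 0"
          using ne[of 2 8 e] ne[of 2 0 e] ne[of 8 0 e] cyc[of e] e
          by (intro triple[of "e + 8" _ "?Z (?x 2)"]) (auto simp: add.assoc)
        then show "ev V (?Z(?x 8 := ?Z (?x 2))) f = 0" using free by simp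
        have "ev V (?Z(?x 8 := ?Z (?x 6), ?x 0 := ?Z (?x 6))) f = 0"
          using ne[of 8 6 e] ne[of 8 0 e] ne[of 6 0 e] cyc[of e] e
          by (intro triple[of "e + 6" _ "?Z (?x 6)"]) (auto simp: add.assoc)
        then show "ev V (?Z(?x 8 := ?Z (?x 6))) f = 0" using free by simp
      qed auto
      then show False using nz by simp
    qed
    have "(\<Sum>v\<in>{?x 2, ?x 4, ?x 6, ?x 8}. \<alpha> v) \<le> (\<Sum>v\<in>V. \<alpha> v)" by (intro sum_mono2) auto
    moreover have "(\<Sum>v\<in>{?x 2, ?x 4, ?x 6, ?x 8}. \<alpha> v) = \<alpha> (?x 2) + (\<alpha> (?x 4) + (\<alpha> (?x 6) + \<alpha> (?x 8)))"
      using ne[of 2 4 e] ne[of 2 6 e] ne[of 2 8 e] ne[of 4 6 e] ne[of 4 8 e] ne[of 6 8 e] by simp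
    ultimately show False using 1 2 3 4 less by linarith
  next
    case False
    let ?A = "{w p 0, w p 2, w p 4, w p 6, w p 8}"
    have "card ?A = 5" by (simp add: w_eq)
    then have one: "\<And>a. a \<in> ?A \<Longrightarrow> \<alpha> a = 1" and supp: "\<And>v. v \<in> V \<Longrightarrow> \<alpha> v \<noteq> 0 \<Longrightarrow> v \<in> ?A"
    proof -
      have even: "\<alpha> (w p e) \<noteq> 0" if "even e" for e using False that by blast
      have nz: "\<alpha> a \<noteq> 0" if "a \<in> ?A" for a
        using that even[of 0] even[of 2] even[of 4] even[of 6] even[of 8] by (elim insertE) simp_all
      show "\<And>a. a \<in> ?A \<Longrightarrow> \<alpha> a = 1" "\<And>v. v \<in> V \<Longrightarrow> \<alpha> v \<noteq> 0 \<Longrightarrow> v \<in> ?A"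
        using sum_le_card[of ?A \<alpha>, OF _ nz] less \<open>card ?A = 5\<close> by auto
    qed
    have one': "\<alpha> (w p e) = 1" if e: "even e" for e
    proof -
      have "\<alpha> (w p e) \<noteq> 0" using False e by blast
      then show ?thesis by (intro one supp) auto
    qed
    have lin: "ev V Z f = 0" if "even e" "det2 q r \<noteq> 0" "ev V (Z(w p e := q)) f = 0"
        "ev V (Z(w p e := r)) f = 0"
      for e q r and Z :: "vertex \<Rightarrow> 'k coord \<times> 'k coord"
      using one'[OF that(1)] that by (intro witness_linear_zero[OF f _ _ that(2,3,4)]) auto
    have add: "ev V (Z(w p e := (fst q + fst r, snd q + snd r))) f = ev V (Z(w p e := q)) f +
        ev V (Z(w p e := r)) f"
      if "even e" "det2 q r \<noteq> 0" for e q r and Z :: "vertex \<Rightarrow> 'k coord \<times> 'k coord"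
    proof -
      have "det2 q r * ev V (Z(w p e := (fst q + fst r, snd q + snd r))) f =
          det2 (fst q + fst r, snd q + snd r) r * ev V (Z(w p e := q)) f + det2 q (fst q + fst r,
              snd q + snd r) * ev V (Z(w p e := r)) f"
        using f one'[OF that(1)] by (intro ev_plucker[where \<alpha> = \<alpha>]) (auto simp: witness_def)
      moreover have "det2 (fst q + fst r, snd q + snd r) r = det2 q r"
          "det2 q (fst q + fst r, snd q + snd r) = det2 q r"
        by (simp_all add: det2_def algebra_simps)
      ultimately have "det2 q r * ev V (Z(w p e := (fst q + fst r, snd q + snd r))) f =
          det2 q r * (ev V (Z(w p e := q)) f + ev V (Z(w p e := r)) f)"
        by (simp add: distrib_left)
      then show ?thesis using that(2) mult_left_cancel by blast
    qed
    \<comment> \<open>With two pairs of equal vectors around a fifth one, the fifth can be moved into either pair.\<close>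
    have pairs1: "ev V Z f = 0" if e: "even e" "Z (w p e) = q" "Z (w p (e + 2)) = q"
        "Z (w p (e + 6)) = r" "Z (w p (e + 8)) = r" "det2 q r \<noteq> 0"
      for e q r and Z :: "vertex \<Rightarrow> 'k coord \<times> 'k coord"
    proof (rule lin[of "e + 4" q r])
      show "ev V (Z(w p (e + 4) := q)) f = 0"
        using ne[of 0 4 e] ne[of 2 4 e] e by (intro triple[of e _ q]) auto
      show "ev V (Z(w p (e + 4) := r)) f = 0"
        using ne[of 6 4 e] ne[of 8 4 e] e by (intro triple[of "e + 4" _ r]) (auto simp: add.assoc)
    qed (use e in auto)
    have pairs2: "ev V Z f = 0" if e: "even e" "Z (w p (e + 2)) = q" "Z (w p (e + 4)) = q"
        "Z (w p (e + 6)) = r" "Z (w p (e + 8)) = r" "det2 q r \<noteq> 0"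
      for e q r and Z :: "vertex \<Rightarrow> 'k coord \<times> 'k coord"
    proof (rule lin[of e q r])
      show "ev V (Z(w p e := q)) f = 0"
        using ne[of 0 4 e] ne[of 2 0 e] e by (intro triple[of e _ q]) auto
      show "ev V (Z(w p e := r)) f = 0"
        using ne[of 6 0 e] ne[of 8 0 e] cyc[of e] e
          by (intro triple[of "e + 6" _ r]) (auto simp: add.assoc)
    qed (use e in auto)
    have alt: "ev V Z f = 0" if e: "even e" "Z (w p e) = q" "Z (w p (e + 2)) = r"
        "Z (w p (e + 4)) = q" "Z (w p (e + 6)) = r" "Z (w p (e + 8)) = r" "det2 q r \<noteq> 0"
      for e q r and Z :: "vertex \<Rightarrow> 'k coord \<times> 'k coord"
    proof -
      \<comment> \<open>The value at \<open>(q + r, q + r)\<close> in the first two places is expanded by additivity.\<close>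
      let ?s = "(fst q + fst r, snd q + snd r)" and ?W = "\<lambda>a b. Z(w p e := a, w p (e + 2) := b)"
      have n: "w p e \<noteq> w p (e + 2)" "w p e \<noteq> w p (e + 4)" "w p e \<noteq> w p (e + 6)" "w p e \<noteq> w p (e + 8)"
        "w p (e + 4) \<noteq> w p e" "w p (e + 6) \<noteq> w p e" "w p (e + 8) \<noteq> w p e"
        "w p (e + 4) \<noteq> w p (e + 2)" "w p (e + 6) \<noteq> w p (e + 2)" "w p (e + 8) \<noteq> w p (e + 2)"
        using ne[of 0 2 e] ne[of 0 4 e] ne[of 0 6 e] ne[of 0 8 e] ne[of 4 0 e] ne[of 6 0 e] ne[of 8 0 e]
          ne[of 4 2 e] ne[of 6 2 e] ne[of 8 2 e] by simp_all
      have sr: "det2 ?s r \<noteq> 0" using e(7) by (simp add: det2_def algebra_simps)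
      have W2: "ev V (?W a ?s) f = ev V (?W a q) f + ev V (?W a r) f" for a
        using add[OF _ e(7), of "e + 2" "Z(w p e := a)"] e(1) by simp
      have swap: "?W a b = Z(w p (e + 2) := b, w p e := a)" for a b
        using n by (simp add: fun_upd_twist)
      have W1: "ev V (?W ?s b) f = ev V (?W q b) f + ev V (?W r b) f" for b
        using add[OF e(1,7), of "Z(w p (e + 2) := b)"] by (simp add: swap)
      have "ev V (?W ?s ?s) f = 0"
        by (rule pairs1[of e _ ?s r]) (use e sr n in auto)
      moreover have "ev V (?W q q) f = 0"
        by (rule triple[of e _ q]) (use e n in auto)
      moreover have "ev V (?W r r) f = 0"
        by (rule triple[of "e + 8" _ r]) (use e n cyc[of e] in \<open>auto simp: add.assoc\<close>)
      moreover have "ev V (?W r q) f = 0"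
        by (rule pairs2[of e _ q r]) (use e n in auto)
      ultimately have "ev V (?W q r) f = 0" using W1[of ?s] W2[of q] W2[of r] by simp
      moreover have "?W q r = Z" using e by auto
      ultimately show ?thesis by simp
    qed
    let ?q = "label_vec 0 :: 'k coord \<times> 'k coord" and ?r = "label_vec 1 :: 'k coord \<times> 'k coord"
    have qr: "det2 ?q ?r \<noteq> 0" "det2 ?r ?q \<noteq> 0" by (simp_all add: det2_label_vec)
    then have qr': "?q \<noteq> ?r" by auto
    have words: "ev V Z f = 0" if "\<And>x. x \<in> ?A \<Longrightarrow> Z x = ?q \<or> Z x = ?r" for Z
    proof -
      have c: "w p 10 = w p 0" "w p 12 = w p 2" "w p 14 = w p 4" "w p 16 = w p 6"
        by (simp_all add: w_eq M10)
      have z: "Z (w p 0) = ?q \<or> Z (w p 0) = ?r" "Z (w p 2) = ?q \<or> Z (w p 2) = ?r"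
          "Z (w p 4) = ?q \<or> Z (w p 4) = ?r"
        "Z (w p 6) = ?q \<or> Z (w p 6) = ?r" "Z (w p 8) = ?q \<or> Z (w p 8) = ?r" using that by simp_all
      have t0: "Z (w p 0) = x \<Longrightarrow> Z (w p 2) = x \<Longrightarrow> Z (w p 4) = x \<Longrightarrow> ?thesis" for x
        using triple[of 0 Z x] c by simp
      have a0: "Z (w p 0) = x \<Longrightarrow> Z (w p 2) = y \<Longrightarrow> Z (w p 4) = x \<Longrightarrow> Z (w p 6) = y \<Longrightarrow>
          Z (w p 8) = y \<Longrightarrow> det2 x y \<noteq> 0 \<Longrightarrow> ?thesis" for x y
        using alt[of 0 Z x y] c by simp
      have t2: "Z (w p 2) = x \<Longrightarrow> Z (w p 4) = x \<Longrightarrow> Z (w p 6) = x \<Longrightarrow> ?thesis" for x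
        using triple[of 2 Z x] c by simp
      have a2: "Z (w p 2) = x \<Longrightarrow> Z (w p 4) = y \<Longrightarrow> Z (w p 6) = x \<Longrightarrow> Z (w p 8) = y \<Longrightarrow>
          Z (w p 0) = y \<Longrightarrow> det2 x y \<noteq> 0 \<Longrightarrow> ?thesis" for x y
        using alt[of 2 Z x y] c by simp
      have t4: "Z (w p 4) = x \<Longrightarrow> Z (w p 6) = x \<Longrightarrow> Z (w p 8) = x \<Longrightarrow> ?thesis" for x
        using triple[of 4 Z x] c by simp
      have a4: "Z (w p 4) = x \<Longrightarrow> Z (w p 6) = y \<Longrightarrow> Z (w p 8) = x \<Longrightarrow> Z (w p 0) = y \<Longrightarrow>
          Z (w p 2) = y \<Longrightarrow> det2 x y \<noteq> 0 \<Longrightarrow> ?thesis" for x y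
        using alt[of 4 Z x y] c by simp
      have t6: "Z (w p 6) = x \<Longrightarrow> Z (w p 8) = x \<Longrightarrow> Z (w p 0) = x \<Longrightarrow> ?thesis" for x
        using triple[of 6 Z x] c by simp
      have a6: "Z (w p 6) = x \<Longrightarrow> Z (w p 8) = y \<Longrightarrow> Z (w p 0) = x \<Longrightarrow> Z (w p 2) = y \<Longrightarrow>
          Z (w p 4) = y \<Longrightarrow> det2 x y \<noteq> 0 \<Longrightarrow> ?thesis" for x y
        using alt[of 6 Z x y] c by simp
      have t8: "Z (w p 8) = x \<Longrightarrow> Z (w p 0) = x \<Longrightarrow> Z (w p 2) = x \<Longrightarrow> ?thesis" for x
        using triple[of 8 Z x] c by simp
      have a8: "Z (w p 8) = x \<Longrightarrow> Z (w p 0) = y \<Longrightarrow> Z (w p 2) = x \<Longrightarrow> Z (w p 4) = y \<Longrightarrow>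
          Z (w p 6) = y \<Longrightarrow> det2 x y \<noteq> 0 \<Longrightarrow> ?thesis" for x y
        using alt[of 8 Z x y] c by simp
      define b where "b k \<longleftrightarrow> Z (w p k) = ?q" for k
      let ?v = "\<lambda>k. if b k then ?q else ?r"
      have zb: "Z (w p 0) = ?v 0" "Z (w p 2) = ?v 2" "Z (w p 4) = ?v 4" "Z (w p 6) = ?v 6"
          "Z (w p 8) = ?v 8"
        using z by (auto simp: b_def)
      have dv: "det2 (?v k) (?v l) \<noteq> 0" if "b k \<noteq> b l" for k l using that qr by auto
      consider "(b 0 = b 2 \<and> b 2 = b 4)"
        | "(b 2 = b 4 \<and> b 4 = b 6)"
        | "(b 4 = b 6 \<and> b 6 = b 8)"
        | "(b 6 = b 8 \<and> b 8 = b 0)"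
        | "(b 8 = b 0 \<and> b 0 = b 2)"
        | "(b 0 \<noteq> b 2 \<and> b 4 = b 0 \<and> b 6 = b 2 \<and> b 8 = b 2)"
        | "(b 2 \<noteq> b 4 \<and> b 6 = b 2 \<and> b 8 = b 4 \<and> b 0 = b 4)"
        | "(b 4 \<noteq> b 6 \<and> b 8 = b 4 \<and> b 0 = b 6 \<and> b 2 = b 6)"
        | "(b 6 \<noteq> b 8 \<and> b 0 = b 6 \<and> b 2 = b 8 \<and> b 4 = b 8)"
        | "(b 8 \<noteq> b 0 \<and> b 2 = b 8 \<and> b 4 = b 0 \<and> b 6 = b 0)"
        by (rule cyclic_words)
      then show ?thesis
      proof cases
        case 1
        then show ?thesis using t0[of "?v 0"] zb by simp
      next
        case 2
        then show ?thesis using t2[of "?v 2"] zb by simp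
      next
        case 3
        then show ?thesis using t4[of "?v 4"] zb by simp
      next
        case 4
        then show ?thesis using t6[of "?v 6"] zb by simp
      next
        case 5
        then show ?thesis using t8[of "?v 8"] zb by simp
      next
        case 6
        then show ?thesis using a0[of "?v 0" "?v 2", OF _ _ _ _ _ dv] zb by simp
      next
        case 7
        then show ?thesis using a2[of "?v 2" "?v 4", OF _ _ _ _ _ dv] zb by simp
      next
        case 8
        then show ?thesis using a4[of "?v 4" "?v 6", OF _ _ _ _ _ dv] zb by simp
      next
        case 9
        then show ?thesis using a6[of "?v 6" "?v 8", OF _ _ _ _ _ dv] zb by simp
      next
        case 10
        then show ?thesis using a8[of "?v 8" "?v 0", OF _ _ _ _ _ dv] zb by simp
      qed
    qed
    have w4: "ev V Z f = 0" if "\<And>x. x \<in> {w p 2, w p 4, w p 6, w p 8} \<Longrightarrow> Z x = ?q \<or> Z x = ?r" for Z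
    proof (rule lin[OF _ qr(1), of 0])
      show "ev V (Z(w p 0 := ?q)) f = 0" "ev V (Z(w p 0 := ?r)) f = 0"
        by (rule words; use that in \<open>auto simp del: One_nat_def\<close>)+
    qed simp
    have w3: "ev V Z f = 0" if "\<And>x. x \<in> {w p 4, w p 6, w p 8} \<Longrightarrow> Z x = ?q \<or> Z x = ?r" for Z
    proof (rule lin[OF _ qr(1), of 2])
      show "ev V (Z(w p 2 := ?q)) f = 0" "ev V (Z(w p 2 := ?r)) f = 0"
        by (rule w4; use that in \<open>auto simp del: One_nat_def\<close>)+
    qed simp
    have w2: "ev V Z f = 0" if "\<And>x. x \<in> {w p 6, w p 8} \<Longrightarrow> Z x = ?q \<or> Z x = ?r" for Z
    proof (rule lin[OF _ qr(1), of 4])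
      show "ev V (Z(w p 4 := ?q)) f = 0" "ev V (Z(w p 4 := ?r)) f = 0"
        by (rule w3; use that in \<open>auto simp del: One_nat_def\<close>)+
    qed simp
    have w1: "ev V Z f = 0" if "\<And>x. x \<in> {w p 8} \<Longrightarrow> Z x = ?q \<or> Z x = ?r" for Z
    proof (rule lin[OF _ qr(1), of 6])
      show "ev V (Z(w p 6 := ?q)) f = 0" "ev V (Z(w p 6 := ?r)) f = 0"
        by (rule w2; use that in \<open>auto simp del: One_nat_def\<close>)+
    qed simp
    have w0: "ev V Z f = 0" if "\<And>x. x \<in> {} \<Longrightarrow> Z x = ?q \<or> Z x = ?r" for Z
    proof (rule lin[OF _ qr(1), of 8])
      show "ev V (Z(w p 8 := ?q)) f = 0" "ev V (Z(w p 8 := ?r)) f = 0"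
        by (rule w1; use that in \<open>auto simp del: One_nat_def\<close>)+
    qed simp
    have "ev V ?Z f = 0" by (rule w0) simp
    then show False using nz by simp
  qed
qed


section \<open>The types of cut sets in terms of positions\<close>

lemma vert_part: "vert k \<in> partX n \<longleftrightarrow> even k" "vert k \<in> partY n \<longleftrightarrow> odd k"
proof -
  have "vert k \<in> partX n \<union> partY n" using vert_in[of k] by (simp add: vertsG)
  then show "vert k \<in> partX n \<longleftrightarrow> even k" "vert k \<in> partY n \<longleftrightarrow> odd k"
    by (auto simp: vert_def partX_def partY_def split: if_splits)
qed

lemma vert_mod: "vert (2 * int j) = Uv (j mod n)" "vert (2 * int j + 1) = Vv (j mod n)"
proof -
  have "int n dvd int j - int (j mod n)"
    by (simp add: zmod_int)
  then have "2 * int n dvd 2 * (int j - int (j mod n))" by (rule mult_dvd_mono[OF dvd_refl])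
  then have d: "M dvd (2 * int j - 2 * int (j mod n))" unfolding M_def right_diff_distrib .
  have "j mod n < n" using n5 by simp
  then show "vert (2 * int j) = Uv (j mod n)" "vert (2 * int j + 1) = Vv (j mod n)"
    using vert_Uv[of "j mod n"] vert_Vv[of "j mod n"] vert_cong[OF d] vert_cong[of "2 * int j + 1"
        "2 * int (j mod n) + 1"] d
    by simp_all
qed

lemma w_part: "w p k \<in> partX n \<longleftrightarrow> even (p + k)" "w p k \<in> partY n \<longleftrightarrow> odd (p + k)"
  by (simp_all add: w_def vert_part)

lemma type2_positions:
  assumes "type2 n T"
  obtains p where "\<And>k. w p k \<in> T \<longleftrightarrow> odd k"
proof -
  have in_T: "w p k \<in> T \<longleftrightarrow> w p k \<notin> V - T" for p k by simp
  consider "V - T = partX n" | "V - T = partY n" using assms by (auto simp: type2_def Let_def)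
  then show ?thesis
  proof cases
    case 1
    then have "\<And>k. w 0 k \<in> T \<longleftrightarrow> odd k" unfolding in_T by (simp add: w_part)
    then show ?thesis by (rule that)
  next
    case 2
    then have "\<And>k. w 1 k \<in> T \<longleftrightarrow> odd k" unfolding in_T by (simp add: w_part)
    then show ?thesis by (rule that)
  qed
qed

lemma type3_positions:
  assumes "type3 n T"
  obtains p where "\<And>k. w p k \<in> T \<longleftrightarrow> even k \<and> \<not> M dvd k"
proof -
  have in_T: "w p k \<in> T \<longleftrightarrow> w p k \<notin> V - T" for p k by simp
  obtain i where "i < n" "V - T = partX n \<union> {Vv i} \<or> V - T = partY n \<union> {Uv i}"
    using assms by (auto simp: type3_def Let_def)
  then consider "V - T = partX n \<union> {w (2 * int i + 1) 0}" | "V - T = partY n \<union> {w (2 * int i) 0}"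
    by (auto simp: w_def vert_Uv vert_Vv)
  then show ?thesis
  proof cases
    case 1
    then have "\<And>k. w (2 * int i + 1) k \<in> T \<longleftrightarrow> even k \<and> \<not> M dvd k" unfolding in_T
      by (auto simp: w_part w_eq)
    then show ?thesis by (rule that)
  next
    case 2
    then have "\<And>k. w (2 * int i) k \<in> T \<longleftrightarrow> even k \<and> \<not> M dvd k" unfolding in_T by (auto simp: w_part w_eq)
    then show ?thesis by (rule that)
  qed
qed

lemma type4_positions:
  assumes "type4 n T"
  obtains p where "\<And>k. w p k \<in> T \<longleftrightarrow> odd k \<and> \<not> M dvd (k - 1) \<and> \<not> M dvd (k + 1)"
proof -
  have in_T: "w p k \<in> T \<longleftrightarrow> w p k \<notin> V - T" for p k by simp
  obtain i where i: "i < n" "V - T = partX n \<union> {Vv i, Vv ((i + 1) mod n)} \<or>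
      V - T = partY n \<union> {Uv i, Uv ((i + 1) mod n)}"
    using assms by (auto simp: type4_def Let_def)
  have "Vv i = w (2 * int i + 2) (-1)" "Vv ((i + 1) mod n) = w (2 * int i + 2) 1"
    "Uv i = w (2 * int i + 1) (-1)" "Uv ((i + 1) mod n) = w (2 * int i + 1) 1"
    using vert_mod[of "i + 1"] vert_mod[of i] i(1) by (simp_all add: w_def algebra_simps)
  then consider "V - T = partX n \<union> {w (2 * int i + 2) (-1), w (2 * int i + 2) 1}"
    | "V - T = partY n \<union> {w (2 * int i + 1) (-1), w (2 * int i + 1) 1}"
    using i by auto
  then show ?thesis
  proof cases
    case 1
    then have "\<And>k. w (2 * int i + 2) k \<in> T \<longleftrightarrow> odd k \<and> \<not> M dvd (k - 1) \<and> \<not> M dvd (k + 1)"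
      unfolding in_T by (auto simp: w_part w_eq)
    then show ?thesis by (rule that)
  next
    case 2
    then have "\<And>k. w (2 * int i + 1) k \<in> T \<longleftrightarrow> odd k \<and> \<not> M dvd (k - 1) \<and> \<not> M dvd (k + 1)"
      unfolding in_T by (auto simp: w_part w_eq)
    then show ?thesis by (rule that)
  qed
qed

lemma edge_F_vert: "{vert a, vert b} \<in> edges (F_graph n) \<longleftrightarrow> M dvd (a - b - 1) \<or> M dvd (a - b + 1)"
proof (cases "even (a - b)")
  case True
  have "{vert a, vert b} \<notin> edges (F_graph n)"
  proof
    assume "{vert a, vert b} \<in> edges (F_graph n)"
    then obtain i j where "{vert a, vert b} = {Uv i, Vv j}" by (auto simp: F_graph_def)
    then show False using True by (auto simp: doubleton_eq_iff vert_def split: if_splits)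
  qed
  then show ?thesis using M_even[of "a - b - 1"] M_even[of "a - b + 1"] True by auto
next
  case False
  have "{vert a, vert b} \<in> {{a, b} | a b. a \<in> partX n \<and> b \<in> partY n}"
  proof (cases "even a")
    case True
    then show ?thesis using False vert_part by auto
  next
    case odd: False
    then have "vert b \<in> partX n" "vert a \<in> partY n" using False vert_part by auto
    then show ?thesis by (auto simp: insert_commute)
  qed
  then have "adj (vert a) (vert b) \<longleftrightarrow> {vert a, vert b} \<notin> edges (F_graph n)"
    unfolding adj_def by (simp add: G_graph_def)
  then show ?thesis using False by (auto simp: adj_vert)
qed

lemma edge_F_neighbour:
  assumes "{vert a, v} \<in> edges (F_graph n)" "v \<in> V"
  shows "v = vert (a + 1) \<or> v = vert (a - 1)"
proof -
  obtain b where b: "v = vert b" using assms vert_cases by blast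
  then have "M dvd (a - b - 1) \<or> M dvd (a - b + 1)" using assms edge_F_vert by simp
  then have "M dvd ((a - 1) - b) \<or> M dvd ((a + 1) - b)" by (simp add: algebra_simps)
  then show ?thesis using b vert_cong[of "a - 1" b] vert_cong[of "a + 1" b] by auto
qed

text \<open>A path in the cycle never turns back, so it runs through consecutive positions.\<close>

lemma path_positions:
  assumes iso: "graph_iso \<phi> (path_graph r) (induced (F_graph n) U)" and U: "U \<subseteq> V" and r: "2 \<le> r"
  obtains p \<epsilon> where "\<epsilon> = 1 \<or> \<epsilon> = -1" "U = (\<lambda>i. vert (p + \<epsilon> * int i)) ` {..<r}"
proof -
  have bij: "bij_betw \<phi> {..<r} (verts (F_graph n) \<inter> U)" using iso
    by (simp add: graph_iso_def path_graph_def induced_def)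
  have vF: "verts (F_graph n) = V" by (simp add: F_graph_def G_graph_def)
  then have img: "\<phi> ` {..<r} = U" and inj: "inj_on \<phi> {..<r}" using bij U by (auto simp: bij_betw_def)
  have inV: "\<phi> i \<in> V" if "i < r" for i using that img U by auto
  have edge: "{\<phi> i, \<phi> (Suc i)} \<in> edges (F_graph n)" if "Suc i < r" for i
  proof -
    have "{i, Suc i} \<in> edges (path_graph r)" using that by (auto simp: path_graph_def)
    then have "{\<phi> i, \<phi> (Suc i)} \<in> edges (induced (F_graph n) U)"
      using iso that unfolding graph_iso_def by (simp add: path_graph_def)
    then show ?thesis by (simp add: induced_def)
  qed
  obtain p where p: "\<phi> 0 = vert p" using inV[of 0] r vert_cases by auto
  have "\<phi> 1 = vert (p + 1) \<or> \<phi> 1 = vert (p - 1)"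
    using edge_F_neighbour[of p "\<phi> 1"] edge[of 0] inV[of 1] p r by simp
  then obtain \<epsilon> :: int where \<epsilon>: "\<epsilon> = 1 \<or> \<epsilon> = -1" "\<phi> 1 = vert (p + \<epsilon>)" by force
  have "\<phi> i = vert (p + \<epsilon> * int i)" if "i < r" for i
    using that
  proof (induction i rule: less_induct)
    case (less i)
    show ?case
    proof (cases "i \<le> 1")
      case True
      then show ?thesis using p \<epsilon> by (cases i) auto
    next
      case False
      then obtain j where j: "i = Suc (Suc j)" by (metis One_nat_def Suc_le_mono le0 not0_implies_Suc)
      have 1: "\<phi> j = vert (p + \<epsilon> * int j)" "\<phi> (Suc j) = vert (p + \<epsilon> * int (Suc j))" using less j by auto
      have "\<phi> i \<noteq> \<phi> j" using inj_on_eq_iff[OF inj, of i j] less.prems j by simp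
      moreover have "\<phi> i = vert (p + \<epsilon> * int (Suc j) + 1) \<or> \<phi> i = vert (p + \<epsilon> * int (Suc j) - 1)"
        using edge_F_neighbour[of "p + \<epsilon> * int (Suc j)"
            "\<phi> i"] edge[of "Suc j"] inV[of i] less.prems 1 j by simp
      ultimately show ?thesis using \<epsilon>(1) 1 j by (auto simp: algebra_simps)
    qed
  qed
  then have "U = (\<lambda>i. vert (p + \<epsilon> * int i)) ` {..<r}" using img by (auto simp: image_iff)
  then show ?thesis using that \<epsilon> by blast
qed

lemma P5_positions:
  assumes "isomorphic (path_graph 5) (induced (F_graph n) U)" "U \<subseteq> V"
  obtains p where "U = {w p (-2), w p (-1), w p 0, w p 1, w p 2}"
proof -
  obtain \<phi> where \<phi>: "graph_iso \<phi> (path_graph 5) (induced (F_graph n) U)" using assms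
    by (auto simp: isomorphic_def)
  have "\<exists>p \<epsilon>. (\<epsilon> = 1 \<or> \<epsilon> = -1) \<and> U = (\<lambda>i. vert (p + \<epsilon> * int i)) ` {..<5}"
    by (rule path_positions[OF \<phi> assms(2)]) (simp, blast)
  then obtain p and \<epsilon> :: int where e: "\<epsilon> = 1 \<or> \<epsilon> = -1" and U: "U = (\<lambda>i. vert (p + \<epsilon> * int i)) ` {..<5}"
    by blast
  have "{..<5} = {0, 1, 2, 3, 4 :: nat}" by auto
  then have U': "U = {vert p, vert (p + \<epsilon>), vert (p + \<epsilon> * 2), vert (p + \<epsilon> * 3), vert (p + \<epsilon> * 4)}"
    unfolding U by simp
  have "U = {w (p + 2 * \<epsilon>) (-2), w (p + 2 * \<epsilon>) (-1), w (p + 2 * \<epsilon>) 0, w (p + 2 * \<epsilon>) 1, w (p + 2 * \<epsilon>) 2}"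
    using e
  proof
    assume "\<epsilon> = 1"
    then show ?thesis unfolding U' by (simp add: w_def add.commute)
  next
    assume "\<epsilon> = -1"
    then show ?thesis unfolding U' by (simp add: w_def add.commute) blast
  qed
  then show ?thesis by (rule that)
qed

lemma P6_positions:
  assumes "isomorphic (path_graph 6) (induced (F_graph n) U)" "U \<subseteq> V"
  obtains p where "U = {w p 0, w p 1, w p 2, w p 3, w p 4, w p 5}"
proof -
  obtain \<phi> where \<phi>: "graph_iso \<phi> (path_graph 6) (induced (F_graph n) U)" using assms
    by (auto simp: isomorphic_def)
  have "\<exists>p \<epsilon>. (\<epsilon> = 1 \<or> \<epsilon> = -1) \<and> U = (\<lambda>i. vert (p + \<epsilon> * int i)) ` {..<6}"
    by (rule path_positions[OF \<phi> assms(2)]) (simp, blast)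
  then obtain p and \<epsilon> :: int where e: "\<epsilon> = 1 \<or> \<epsilon> = -1" and U: "U = (\<lambda>i. vert (p + \<epsilon> * int i)) ` {..<6}"
    by blast
  have "{..<6} = {0, 1, 2, 3, 4, 5 :: nat}" by auto
  then have U': "U = {vert p, vert (p + \<epsilon>), vert (p + \<epsilon> * 2), vert (p + \<epsilon> * 3), vert (p + \<epsilon> * 4),
      vert (p + \<epsilon> * 5)}"
    unfolding U by simp
  show ?thesis
  proof (cases "\<epsilon> = 1")
    case True
    then have "U = {w p 0, w p 1, w p 2, w p 3, w p 4, w p 5}" unfolding U'
      by (simp add: w_def add.commute)
    then show ?thesis by (rule that)
  next
    case False
    then have "U = {w (p - 5) 0, w (p - 5) 1, w (p - 5) 2, w (p - 5) 3, w (p - 5) 4, w (p - 5) 5}"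
      using e unfolding U' by (simp add: w_def add.commute) blast
    then show ?thesis by (rule that)
  qed
qed

text \<open>
  Each copy of \<open>P\<^sub>3\<close> occupies the two cycle neighbours of its centre. As vertices of different copies are
  neither equal nor adjacent on the cycle, the centres are more than three steps apart.
\<close>

lemma two_P3_positions:
  assumes iso: "graph_iso \<phi> two_P3 (induced (F_graph n) U)" and U: "U \<subseteq> V"
  obtains p m where "U = {w p (-1), w p 0, w p 1, w p (m - 1), w p m, w p (m + 1)}"
    "\<phi> (Inl 1) = w p 0" "\<phi> (Inr 1) = w p m"
    "\<forall>c. \<bar>c\<bar> \<le> 3 \<longrightarrow> \<not> M dvd (m + c)"
proof -
  have v: "verts two_P3 = {Inl 0, Inl 1, Inl 2, Inr 0, Inr 1, Inr 2 :: nat + nat}"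
    by (auto simp: two_P3_def disjoint_union_def path_graph_def)
  have p3: "edges (path_graph 3) = {{0, 1}, {1, 2}}"
  proof -
    have "Suc i < 3 \<longleftrightarrow> i = 0 \<or> i = 1" for i by auto
    then show ?thesis by (auto simp: path_graph_def numeral_2_eq_2)
  qed
  have e: "edges two_P3 = {{Inl 0, Inl 1}, {Inl 1, Inl 2}, {Inr 0, Inr 1}, {Inr 1, Inr 2 :: nat + nat}}"
    by (auto simp: two_P3_def disjoint_union_def p3)
  have vF: "verts (F_graph n) = V" by (simp add: F_graph_def G_graph_def)
  have bij: "bij_betw \<phi> (verts two_P3) U" using iso U vF
    by (auto simp: graph_iso_def induced_def Int_absorb1)
  then have img: "U = \<phi> ` verts two_P3" and inj: "inj_on \<phi> (verts two_P3)" by (auto simp: bij_betw_def)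
  have inV: "\<phi> x \<in> V" if "x \<in> verts two_P3" for x using that img U by auto
  have edge: "{\<phi> x, \<phi> y} \<in> edges (F_graph n) \<longleftrightarrow> {x, y} \<in> edges two_P3"
    if "x \<in> verts two_P3" "y \<in> verts two_P3" for x y
  proof -
    have "\<phi> x \<in> U" "\<phi> y \<in> U" using that img by auto
    then show ?thesis using iso that unfolding graph_iso_def by (simp add: induced_def)
  qed
  have arm: "{\<phi> (s 0), \<phi> (s 2)} = {vert (q - 1), vert (q + 1)}"
    if s: "s = Inl \<or> s = Inr" and q: "\<phi> (s 1) = vert q" for s :: "nat \<Rightarrow> nat + nat" and q
  proof -
    have s': "s 0 \<in> verts two_P3" "s 1 \<in> verts two_P3" "s 2 \<in> verts two_P3" "s 0 \<noteq> s 2"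
      using s by (elim disjE; simp add: v)+
    have "{s 1, s 0} \<in> edges two_P3" "{s 1, s 2} \<in> edges two_P3"
      using s by (elim disjE; simp add: e insert_commute)+
    then have "{vert q, \<phi> (s 0)} \<in> edges (F_graph n)" "{vert q, \<phi> (s 2)} \<in> edges (F_graph n)"
      using edge[OF s'(2,1)] edge[OF s'(2,3)] q by simp_all
    then have "\<phi> (s 0) = vert (q + 1) \<or> \<phi> (s 0) = vert (q - 1)"
        "\<phi> (s 2) = vert (q + 1) \<or> \<phi> (s 2) = vert (q - 1)"
      using edge_F_neighbour[of q "\<phi> (s 0)"] edge_F_neighbour[of q "\<phi> (s 2)"] inV[OF s'(1)] inV[OF
          s'(3)] by auto
    moreover have "\<phi> (s 0) \<noteq> \<phi> (s 2)" using inj s' by (auto simp: inj_on_def)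
    ultimately show ?thesis by auto
  qed
  obtain p where p: "\<phi> (Inl 1) = vert p" using inV[of "Inl 1"] v vert_cases by blast
  obtain q where q: "\<phi> (Inr 1) = vert q" using inV[of "Inr 1"] v vert_cases by blast
  have L: "{\<phi> (Inl 0), \<phi> (Inl 2)} = {vert (p - 1), vert (p + 1)}" using arm[of Inl] p by simp
  have R: "{\<phi> (Inr 0), \<phi> (Inr 2)} = {vert (q - 1), vert (q + 1)}" using arm[of Inr] q by simp
  have "U = {\<phi> (Inl 0), \<phi> (Inl 2)} \<union> {\<phi> (Inl 1)} \<union> ({\<phi> (Inr 0), \<phi> (Inr 2)} \<union> {\<phi> (Inr 1)})"
    unfolding img v by auto
  also have "\<dots> = {vert (p - 1), vert p, vert (p + 1), vert (q - 1), vert q, vert (q + 1)}"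
    unfolding L R p q by auto
  finally have "U = {w p (-1), w p 0, w p 1, w p (q - p - 1), w p (q - p), w p (q - p + 1)}"
    by (simp add: w_def)
  moreover have "\<not> M dvd (q - p + c)" if c: "\<bar>c\<bar> \<le> 3" for c
  proof -
    have cross: "x \<noteq> y \<and> {x, y} \<notin> edges (F_graph n)"
      if x: "x \<in> {vert (p - 1), vert p, vert (p + 1)}" and y: "y \<in> {vert (q - 1), vert q, vert (q +
          1)}" for x y
    proof -
      have "{vert (p - 1), vert p, vert (p + 1)} = \<phi> ` {Inl 0, Inl 1, Inl 2}"
        "{vert (q - 1), vert q, vert (q + 1)} = \<phi> ` {Inr 0, Inr 1, Inr 2}"
        using L R p q by auto
      then obtain i j where ij: "x = \<phi> (Inl i)" "y = \<phi> (Inr j)" "Inl i \<in> verts two_P3"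
          "Inr j \<in> verts two_P3"
        using x y v by auto
      then have "{x, y} \<notin> edges (F_graph n)" using edge e by (auto simp: doubleton_eq_iff)
      moreover have "x \<noteq> y" using ij inj by (auto simp: inj_on_def)
      ultimately show ?thesis by blast
    qed
    have far: "\<not> M dvd (q + j - (p + i) + d)" if "\<bar>i\<bar> \<le> 1" "\<bar>j\<bar> \<le> 1" "\<bar>d\<bar> \<le> 1" for i j d
    proof -
      have "i = -1 \<or> i = 0 \<or> i = 1" "j = -1 \<or> j = 0 \<or> j = 1" "d = -1 \<or> d = 0 \<or> d = 1" using that by auto
      moreover have "vert (p + i) \<in> {vert (p - 1), vert p, vert (p + 1)}"
          "vert (q + j) \<in> {vert (q - 1), vert q, vert (q + 1)}"
        using that calculation by auto
      ultimately show ?thesis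
        using cross[of "vert (p + i)" "vert (q + j)"] edge_F_vert[of "q + j"
            "p + i"] vert_eq[of "q + j" "p + i"]
        by (auto simp: insert_commute)
    qed
    have "\<exists>i j d. \<bar>i\<bar> \<le> 1 \<and> \<bar>j\<bar> \<le> 1 \<and> \<bar>d\<bar> \<le> 1 \<and> c = j - i + d"
      using c by presburger
    then obtain i j d where ijd: "\<bar>i\<bar> \<le> 1" "\<bar>j\<bar> \<le> 1" "\<bar>d\<bar> \<le> 1" "c = j - i + d" by blast
    have "q - p + c = q + j - (p + i) + d" using ijd(4) by simp
    then show ?thesis using far[OF ijd(1-3)] by metis
  qed
  ultimately show ?thesis using that[of p "q - p"] p q by (simp add: w_def)
qed

section \<open>The local v-numbers\<close>

text \<open>
  The first argument only carries the field of coefficients.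
\<close>

abbreviation vloc :: "'k::field itself \<Rightarrow> vertex set \<Rightarrow> nat" where
  "vloc _ T \<equiv> v_local V (JG :: (vertex, 'k) vpoly set) (P_ideal (G_graph n) T)"

lemma vloc_eqI:
  assumes "T \<subseteq> V" "\<exists>g :: (vertex, 'k::field) vpoly. certificate T d g"
    "\<And>\<alpha> f. witness T \<alpha> (f :: (vertex, 'k) vpoly) \<Longrightarrow> d \<le> (\<Sum>v\<in>V. \<alpha> v)"
  shows "vloc TYPE('k) T = d"
  using assms v_local_eqI by blast

lemma vloc_type1: "type1 n T \<Longrightarrow> vloc TYPE('k::field) T = 4"
  using vloc_eqI[of T 4] certificate_empty witness_deg_ge_4 by (auto simp: type1_def)

lemma vloc_type2:
  assumes T: "T \<subseteq> V" and t: "type2 n T"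
  shows "vloc TYPE('k::field) T = (if n = 5 then 6 else 4)"
proof -
  obtain p where p: "\<And>k. w p k \<in> T \<longleftrightarrow> odd k" using type2_positions[OF t] by blast
  show ?thesis
  proof (cases "n = 5")
    case True
    have "vloc TYPE('k) T = 6"
      by (rule vloc_eqI[OF T certificate_part(2)[OF T p]]) (rule lower_part_5[OF True T p])
    then show ?thesis using True by simp
  next
    case False
    then have "n \<ge> 6" using n5 by simp
    have "vloc TYPE('k) T = 4"
      by (rule vloc_eqI[OF T certificate_part(1)[OF T p \<open>n \<ge> 6\<close>]]) (rule witness_deg_ge_4[OF T])
    then show ?thesis using False by simp
  qed
qed

lemma vloc_type3:
  assumes T: "T \<subseteq> V" and t: "type3 n T"
  shows "vloc TYPE('k::field) T = 5"
proof -
  obtain p where p: "\<And>k. w p k \<in> T \<longleftrightarrow> even k \<and> \<not> M dvd k" using type3_positions[OF t] by blast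
  show ?thesis by (rule vloc_eqI[OF T certificate_star[OF T p] lower_star[OF T p]])
qed

lemma vloc_type4:
  assumes T: "T \<subseteq> V" and t: "type4 n T"
  shows "vloc TYPE('k::field) T = 5"
proof -
  obtain p where p: "\<And>k. w p k \<in> T \<longleftrightarrow> odd k \<and> \<not> M dvd (k - 1) \<and> \<not> M dvd (k + 1)"
    using type4_positions[OF t] by blast
  show ?thesis by (rule vloc_eqI[OF T certificate_double_star[OF T p] lower_double_star[OF T p]])
qed

lemma vloc_type5:
  assumes T: "T \<subseteq> V" and t: "type5 n T"
  shows "vloc TYPE('k::field) T = 6"
proof -
  obtain p where p: "V - T = {w p (-2), w p (-1), w p 0, w p 1, w p 2}"
    using P5_positions[of "V - T"] t by (auto simp: type5_def Let_def)
  show ?thesis by (rule vloc_eqI[OF T certificate_P5[OF T p] lower_P5[OF T p]])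
qed

lemma vloc_type6:
  assumes T: "T \<subseteq> V" and t: "type6 n T"
  shows "vloc TYPE('k::field) T = 6"
proof -
  obtain \<phi> where \<phi>: "graph_iso \<phi> two_P3 (induced (F_graph n) (V - T))"
    "\<phi> ` {Inl 1, Inr 1} = (V - T) \<inter> partX n \<or> \<phi> ` {Inl 1, Inr 1} = (V - T) \<inter> partY n"
    using t unfolding type6_def Let_def by (auto split: if_splits)
  obtain p m where p: "V - T = {w p (-1), w p 0, w p 1, w p (m - 1), w p m, w p (m + 1)}"
    and c: "\<phi> (Inl 1) = w p 0" "\<phi> (Inr 1) = w p m" and m: "\<forall>c. \<bar>c\<bar> \<le> 3 \<longrightarrow> \<not> M dvd (m + c)"
    by (rule two_P3_positions[OF \<phi>(1) Diff_subset])
  have "{w p 0, w p m} \<subseteq> partX n \<or> {w p 0, w p m} \<subseteq> partY n" using \<phi>(2) c by auto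
  then have "even m" by (auto simp: w_part)
  moreover have "\<not> M dvd m" "\<not> M dvd (m - 2)" "\<not> M dvd (m + 2)"
    using spec[OF m, of 0] spec[OF m, of "-2"] spec[OF m, of 2] by auto
  ultimately show ?thesis
    by (intro vloc_eqI[OF T certificate_two_P3_even[OF T p] lower_two_P3_even[OF T p]])
qed

lemma vloc_type7:
  assumes T: "T \<subseteq> V" and t: "type7 n T"
  shows "vloc TYPE('k::field) T = 6"
proof -
  have card: "card ((V - T) \<inter> partX n) = 3" "card ((V - T) \<inter> partY n) = 3"
    and "isomorphic (path_graph 6) (induced (F_graph n) (V - T)) \<or>
        isomorphic two_P3 (induced (F_graph n) (V - T))"
    using t by (auto simp: type7_def Let_def)
  then consider "isomorphic (path_graph 6) (induced (F_graph n) (V - T))"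
    | \<phi> where "graph_iso \<phi> two_P3 (induced (F_graph n) (V - T))"
    by (auto simp: isomorphic_def)
  then show ?thesis
  proof cases
    case 1
    obtain p where p: "V - T = {w p 0, w p 1, w p 2, w p 3, w p 4, w p 5}"
      by (rule P6_positions[OF 1 Diff_subset])
    show ?thesis by (rule vloc_eqI[OF T certificate_P6[OF T p] lower_P6[OF T p]])
  next
    case 2
    obtain p m where p: "V - T = {w p (-1), w p 0, w p 1, w p (m - 1), w p m, w p (m + 1)}"
      and "\<phi> (Inl 1) = w p 0" "\<phi> (Inr 1) = w p m" and m: "\<forall>c. \<bar>c\<bar> \<le> 3 \<longrightarrow> \<not> M dvd (m + c)"
      by (rule two_P3_positions[OF 2 Diff_subset])
    have "odd m"
    proof
      assume ev: "even m"
      have "(V - T) \<inter> (if even p then partX n else partY n) \<subseteq> {w p 0, w p m}"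
        unfolding p using ev by (auto simp: w_part split: if_splits)
      then have "card ((V - T) \<inter> (if even p then partX n else partY n)) \<le> card {w p 0, w p m}"
        by (intro card_mono) auto
      also have "\<dots> \<le> 2" by (simp add: card_insert_if)
      finally show False using card by (auto split: if_splits)
    qed
    moreover have "\<not> M dvd (m - 1)" "\<not> M dvd (m + 1)" "\<not> M dvd (m - 3)" "\<not> M dvd (m + 3)"
      using spec[OF m, of "-1"] spec[OF m, of 1] spec[OF m, of "-3"] spec[OF m, of 3] by auto
    ultimately show ?thesis
      by (intro vloc_eqI[OF T certificate_two_P3_odd[OF T p] lower_two_P3_odd[OF T p]])
  qed
qed

text \<open>
  Every minimal prime is some \<open>P\<^sub>T\<close> with a certificate, so the bound on the degrees of witnesses applies
  to its local v-number.
\<close>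

lemma v_number_G: "v_number V (JG :: (vertex, 'k::field) vpoly set) = 4"
  unfolding v_number_def
proof (rule cInf_eq_minimum)
  obtain g :: "(vertex, 'k) vpoly" where g: "certificate {} 4 g" using certificate_empty by blast
  have "vloc TYPE('k) {} = 4" by (rule vloc_type1) (simp add: type1_def)
  then show "4 \<in> v_local V JG ` min_primes (poly_ring V) (JG :: (vertex, 'k) vpoly set)"
    using P_ideal_min_prime[OF _ g] by (metis empty_subsetI image_eqI)
next
  fix x assume "x \<in> v_local V JG ` min_primes (poly_ring V) (JG :: (vertex, 'k) vpoly set)"
  then obtain P where P: "P \<in> min_primes (poly_ring V) (JG :: (vertex, 'k) vpoly set)"
      "x = v_local V JG P" by blast
  obtain T where T: "T \<subseteq> V" "P = P_ideal (G_graph n) T" "joins_components T"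
    using min_prime_is_P_ideal[OF P(1)] by blast
  obtain d and g :: "(vertex, 'k) vpoly" where g: "certificate T d g"
    using certificate_exists[OF T(1,3)] by blast
  show "4 \<le> x"
    unfolding P(2) T(2) by (rule v_local_geI[OF T(1) g]) (rule witness_deg_ge_4[OF T(1)])
qed

end

theorem theorem6p13:
  fixes n :: nat and J :: "(vertex, 'k::field) vpoly set"
  assumes "n \<ge> 5"
    and "J = binomial_edge_ideal (G_graph n)"
  shows "(\<forall>T\<in>cut_sets (G_graph n).
      (type1 n T \<longrightarrow> v_local (verts (G_graph n)) J (P_ideal (G_graph n) T) = 4) \<and>
      (type2 n T \<longrightarrow> v_local (verts (G_graph n)) J (P_ideal (G_graph n) T) = (if n = 5 then 6 else 4)) \<and>
      (type3 n T \<or> type4 n T \<longrightarrow> v_local (verts (G_graph n)) J (P_ideal (G_graph n) T) = 5) \<and>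
      (type5 n T \<or> type6 n T \<or> type7 n T \<longrightarrow>
         v_local (verts (G_graph n)) J (P_ideal (G_graph n) T) = 6)) \<and>
    v_number (verts (G_graph n)) J = 4"
proof -
  interpret cycle_complement n using assms(1) by unfold_locales
  have T: "T \<subseteq> V" if "T \<in> cut_sets (G_graph n)" for T using that by (simp add: cut_sets_def)
  show ?thesis
    unfolding assms(2)
  proof (intro conjI ballI impI)
    fix T assume "T \<in> cut_sets (G_graph n)"
    note T = T[OF this]
    show "vloc TYPE('k) T = 4" if "type1 n T" using that by (rule vloc_type1)
    show "vloc TYPE('k) T = (if n = 5 then 6 else 4)" if "type2 n T" using that
      by (rule vloc_type2[OF T])
    show "vloc TYPE('k) T = 5" if "type3 n T \<or> type4 n T"
      using that vloc_type3[OF T] vloc_type4[OF T] by auto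
    show "vloc TYPE('k) T = 6" if "type5 n T \<or> type6 n T \<or> type7 n T"
      using that vloc_type5[OF T] vloc_type6[OF T] vloc_type7[OF T] by auto
  qed (rule v_number_G)
qed

end
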